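(* Let $\mathcal{A}$ be an essential, central hyperplane arrangement in $V=k^{n+1}$ and let $p$ be a positive integer. The following are equivalent: 1. $\widetilde{D^p(\mathcal{A})}$ is locally free on $\mathbf{P}^n$. 1'. $\widetilde{\Omega^p(\mathcal{A})}$ is locally free on $\mathbf{P}^n$. 2. For every $X\in L_{\mathcal{A}}$ with $\mathrm{rank}\,X<\dim V$, the $S$-module $D^p(\mathcal{A}_X)$ is free. 2'. For every $X\in L_{\mathcal{A}}$ with $\mathrm{rank}\,X<\dim V$, the $S$-module $\Omega^p(\mathcal{A}_X)$ is free.
   Context: $k$ is an arbitrary field, $V=k^{n+1}$, $S=\mathrm{Sym}(V^* )$ (a standard graded polynomial ring in $n+1$ variables), $K$ its fraction field, $\mathbf{P}^n=\mathrm{Proj}\,S$; $\widetilde{M}$ is the sheaf on $\mathbf{P}^n$ associated to a graded $S$-module $M$. A (central) hyperplane arrangement $\mathcal{A}$ is a finite set of distinct codimension one linear subspaces of $V$. The intersection lattice $L_{\mathcal{A}}$ is the set of all intersections of elements of $\mathcal{A}$ (including $V$, the empty intersection), with rank $=$ codimension in $V$; $\mathcal{A}$ is essential if $\mathrm{rank}\,L_{\mathcal{A}}=\dim V$, i.e. the intersection of all hyperplanes is $0$. Let $Q$ be the product of linear forms, one defining each hyperplane of $\mathcal{A}$. $D^p(\mathcal{A})=\{\theta\in\Lambda^p(\mathrm{Der}_kS):\theta(Q,f_2,\dots,f_p)\in(Q)\ \forall f_2,\dots,f_p\in S\}$, where $\theta$ is regarded as an alternating $p$-multiderivation. With $\Omega^p_S$,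 $\Omega^p_K$ the $p$-differentials over $k$ of $S$ and $K$, $\Omega^p(\mathcal{A})=\{\omega\in\Omega^p_K:Q\omega\in\Omega^p_S,\ Q\,d\omega\in\Omega^{p+1}_S\}$. For $X\in L_{\mathcal{A}}$, $\mathcal{A}_X=\{H\in\mathcal{A}:X\subset H\}$, regarded as an arrangement in $V$ (in general not essential), and $D^p(\mathcal{A}_X)$, $\Omega^p(\mathcal{A}_X)$ are defined by the same formulas with $Q$ replaced by the defining polynomial of $\mathcal{A}_X$. *)

theory Defs
  imports
    "HOL-Analysis.Analysis"
    "HOL-Library.Poly_Mapping"
    "HOL-Library.Function_Algebras"
    "HOL-Library.FuncSet"
    "HOL-Computational_Algebra.Fraction_Field"
begin

section \<open>The polynomial ring and its fraction field\<close>

text \<open>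
  \<open>V = k\<^sup>n\<^sup>+\<^sup>1\<close> is the type \<open>'k ^ 'n\<close> with \<open>CARD('n) = n + 1\<close>, and \<open>S = Sym V\<^sup>*\<close> is the polynomial
  ring in the coordinates of \<open>V\<close>.  The index type is linearly ordered because the library
  needs a monomial order to see that \<open>S\<close> is a domain; the order also fixes the signs in
  the exterior derivative below.
\<close>

type_synonym ('n, 'k) mpoly = "('n \<Rightarrow>\<^sub>0 nat) \<Rightarrow>\<^sub>0 'k"

definition cst :: "'k::field \<Rightarrow> ('n::{finite,linorder}, 'k) mpoly"
  where "cst c = Poly_Mapping.single 0 c"

definition coord :: "'n \<Rightarrow> ('n::{finite,linorder}, 'k::field) mpoly"
  where "coord i = Poly_Mapping.single (Poly_Mapping.single i 1) 1"

definition total_degree :: "('n::finite \<Rightarrow>\<^sub>0 nat) \<Rightarrow> nat"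
  where "total_degree m = (\<Sum>i\<in>UNIV. Poly_Mapping.lookup m i)"

text \<open>The graded piece \<open>S\<^sub>d\<close>, which is \<open>0\<close> for \<open>d < 0\<close>.\<close>

definition S_deg :: "int \<Rightarrow> ('n::{finite,linorder}, 'k::field) mpoly set"
  where "S_deg d = {f. \<forall>m\<in>Poly_Mapping.keys f. int (total_degree m) = d}"

definition hom_component :: "nat \<Rightarrow> ('n::{finite,linorder}, 'k::field) mpoly \<Rightarrow> ('n, 'k) mpoly"
  where "hom_component d f =
    (\<Sum>m\<in>{m\<in>Poly_Mapping.keys f. total_degree m = d}. Poly_Mapping.single m (Poly_Mapping.lookup f m))"

definition to_frac :: "('n::{finite,linorder}, 'k::field) mpoly \<Rightarrow> ('n, 'k) mpoly fract"
  where "to_frac f = Fract f 1"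

lemma to_frac_hom:
  "to_frac (f + g) = to_frac f + to_frac g"
  "to_frac (f * g) = to_frac f * to_frac g"
  "to_frac 1 = 1"
  by (simp_all add: to_frac_def One_fract_def)

definition K_deg :: "int \<Rightarrow> ('n::{finite,linorder}, 'k::field) mpoly fract set"
  where "K_deg d = {q. \<exists>a b f g. f \<in> S_deg a \<and> g \<in> S_deg b \<and> g \<noteq> 0 \<and> a - b = d \<and> q = Fract f g}"

definition pd :: "'n \<Rightarrow> ('n::{finite,linorder}, 'k::field) mpoly \<Rightarrow> ('n, 'k) mpoly"
  where "pd i f = (\<Sum>m\<in>Poly_Mapping.keys f.
    Poly_Mapping.single (m - Poly_Mapping.single i 1)
      (of_nat (Poly_Mapping.lookup m i) * Poly_Mapping.lookup f m))"

lemma pd_superset: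
  assumes "finite T" "Poly_Mapping.keys f \<subseteq> T"
  shows "pd i f = (\<Sum>m\<in>T. Poly_Mapping.single (m - Poly_Mapping.single i 1)
      (of_nat (Poly_Mapping.lookup m i) * Poly_Mapping.lookup f m))"
  unfolding pd_def
  by (rule sum.mono_neutral_left) (use assms in \<open>auto simp: in_keys_iff\<close>)

lemma pd_add: "pd i (f + g) = pd i f + pd i g"
proof -
  let ?T = "Poly_Mapping.keys f \<union> Poly_Mapping.keys g"
  have "pd i (f + g) = (\<Sum>m\<in>?T. Poly_Mapping.single (m - Poly_Mapping.single i 1)
      (of_nat (Poly_Mapping.lookup m i) * Poly_Mapping.lookup (f + g) m))"
    by (rule pd_superset) (simp_all add: Poly_Mapping.keys_add)
  also have "\<dots> = pd i f + pd i g"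
    by (simp add: pd_superset[of ?T f] pd_superset[of ?T g] lookup_add distrib_left
        single_add sum.distrib)
  finally show ?thesis .
qed

lemma pd_0: "pd i 0 = 0"
  by (simp add: pd_def)

lemma pd_single:
  "pd i (Poly_Mapping.single m c) =
    Poly_Mapping.single (m - Poly_Mapping.single i 1) (of_nat (Poly_Mapping.lookup m i) * c)"
  by (cases "c = 0") (simp_all add: pd_def)

lemma mpoly_induct [case_names zero add]:
  fixes f :: "('n::{finite,linorder}, 'k::field) mpoly"
  assumes "P 0" "\<And>f m c. P f \<Longrightarrow> P (f + Poly_Mapping.single m c)"
  shows "P f"
proof -
  have "f = (\<Sum>m\<in>Poly_Mapping.keys f. Poly_Mapping.single m (Poly_Mapping.lookup f m))"
  proof (rule poly_mapping_eqI)
    fix k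
    show "Poly_Mapping.lookup f k = Poly_Mapping.lookup
      (\<Sum>m\<in>Poly_Mapping.keys f. Poly_Mapping.single m (Poly_Mapping.lookup f m)) k"
      by (simp add: lookup_sum lookup_single when_def in_keys_iff)
  qed
  moreover have "finite T \<Longrightarrow> P (\<Sum>m\<in>T. Poly_Mapping.single m (Poly_Mapping.lookup f m))" for T
    by (induction T rule: finite_induct) (auto simp: assms add.commute [of "Poly_Mapping.single _ _"])
  ultimately show ?thesis
    using finite_keys[of f] by (metis (no_types))
qed

lemma minus_single_add:
  fixes m m' :: "'n::{finite,linorder} \<Rightarrow>\<^sub>0 nat"
  assumes "Poly_Mapping.lookup m' i \<noteq> 0"
  shows "m + m' - Poly_Mapping.single i 1 = m + (m' - Poly_Mapping.single i 1)"
proof (rule poly_mapping_eqI)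
  fix j
  show "Poly_Mapping.lookup (m + m' - Poly_Mapping.single i 1) j =
    Poly_Mapping.lookup (m + (m' - Poly_Mapping.single i 1)) j"
    using assms by (cases "j = i") (auto simp: lookup_add lookup_minus lookup_single when_def)
qed

lemma pd_mult: "pd i (f * g) = f * pd i g + pd i f * g"
proof (induction f rule: mpoly_induct)
  case (add f m c)
  have "pd i (Poly_Mapping.single m c * g) =
    Poly_Mapping.single m c * pd i g + pd i (Poly_Mapping.single m c) * g"
  proof (induction g rule: mpoly_induct)
    case (add g m' c')
    have *: "pd i (Poly_Mapping.single m c * Poly_Mapping.single m' c') =
      Poly_Mapping.single m c * pd i (Poly_Mapping.single m' c') +
      pd i (Poly_Mapping.single m c) * Poly_Mapping.single m' c'"
    proof -
      let ?s = "Poly_Mapping.single" and ?l = "Poly_Mapping.lookup"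
      have r: "?s (m + m' - ?s i 1) (of_nat (?l m' i) * (c * c')) =
          ?s (m + (m' - ?s i 1)) (of_nat (?l m' i) * (c * c'))"
        using minus_single_add[of m' i m] by (cases "?l m' i = 0") simp_all
      have l: "?s (m + m' - ?s i 1) (of_nat (?l m i) * (c * c')) =
          ?s ((m - ?s i 1) + m') (of_nat (?l m i) * (c * c'))"
        using minus_single_add[of m i m'] by (cases "?l m i = 0") (simp_all add: add.commute)
      have "pd i (?s m c * ?s m' c') =
          ?s (m + m' - ?s i 1) (of_nat (?l m' i) * (c * c')) +
          ?s (m + m' - ?s i 1) (of_nat (?l m i) * (c * c'))"
        by (simp add: mult_single pd_single lookup_add distrib_right add.commute flip: single_add)
      then show ?thesis
        unfolding r l by (simp add: mult_single pd_single mult.left_commute mult.assoc)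
    qed
    show ?case
      by (simp add: distrib_left pd_add * add.IH)
  qed (simp add: pd_0)
  then show ?case
    by (simp add: distrib_right pd_add add.IH)
qed (simp add: pd_0)

text \<open>The partial derivative on \<open>K\<close>, by the quotient rule.\<close>

lift_definition pd_frac :: "'n \<Rightarrow> ('n::{finite,linorder}, 'k::field) mpoly fract \<Rightarrow> ('n, 'k) mpoly fract"
  is "\<lambda>i q. (pd i (fst q) * snd q - fst q * pd i (snd q), snd q * snd q)"
proof -
  fix i :: 'n and q r :: "('n, 'k) mpoly \<times> ('n, 'k) mpoly"
  assume qr: "fractrel q r"
  define a b c d where "a = fst q" "b = snd q" "c = fst r" "d = snd r"
  note defs = this
  have e: "a * d = c * b" "b \<noteq> 0" "d \<noteq> 0"
    using qr by (auto simp: defs)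
  have "pd i (a * d) = pd i (c * b)" by (simp add: e)
  then have l: "a * pd i d + pd i a * d = c * pd i b + pd i c * b"
    by (simp add: pd_mult)
  have "(pd i a * b - a * pd i b) * (d * d) = (pd i c * d - c * pd i d) * (b * b)"
    using e(1) l by algebra
  then show "fractrel (pd i (fst q) * snd q - fst q * pd i (snd q), snd q * snd q)
     (pd i (fst r) * snd r - fst r * pd i (snd r), snd r * snd r)"
    unfolding fractrel_iff fst_conv snd_conv defs [symmetric]
    by (intro conjI no_zero_divisors e(2,3))
qed

lemma pd_frac_Fract:
  "g \<noteq> 0 \<Longrightarrow> pd_frac i (Fract f g) = Fract (pd i f * g - f * pd i g) (g * g)"
  by (simp add: Fract.abs_eq pd_frac.abs_eq)


section \<open>Hyperplane arrangements\<close>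

definition hyperplane :: "('k::field ^ 'n::finite) set \<Rightarrow> bool"
  where "hyperplane H \<longleftrightarrow> vec.subspace H \<and> vec.dim H + 1 = CARD('n)"

definition arrangement :: "('k::field ^ 'n::finite) set set \<Rightarrow> bool"
  where "arrangement A \<longleftrightarrow> finite A \<and> (\<forall>H\<in>A. hyperplane H)"

definition intersection_lattice :: "('k::field ^ 'n::finite) set set \<Rightarrow> ('k ^ 'n) set set"
  where "intersection_lattice A = {\<Inter>B | B. B \<subseteq> A}"

definition codim :: "('k::field ^ 'n::finite) set \<Rightarrow> nat"
  where "codim X = CARD('n) - vec.dim X"

definition essential :: "('k::field ^ 'n::finite) set set \<Rightarrow> bool"
  where "essential A \<longleftrightarrow> \<Inter>A = {0}"

definition localization :: "('k::field ^ 'n::finite) set set \<Rightarrow> ('k ^ 'n) set \<Rightarrow> ('k ^ 'n) set set"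
  where "localization A X = {H\<in>A. X \<subseteq> H}"

definition linear_form :: "'k::field ^ 'n::{finite,linorder} \<Rightarrow> ('n, 'k) mpoly"
  where "linear_form a = (\<Sum>i\<in>UNIV. cst (a $ i) * coord i)"

definition defines_hyperplane ::
    "('n::{finite,linorder}, 'k::field) mpoly \<Rightarrow> ('k ^ 'n::{finite,linorder}) set \<Rightarrow> bool"
  where "defines_hyperplane f H \<longleftrightarrow>
    (\<exists>a. f = linear_form a \<and> H = {v. (\<Sum>i\<in>UNIV. a $ i * v $ i) = 0})"

text \<open>The defining polynomial depends on the chosen linear forms \<open>\<alpha> H\<close>, but only up to a unit.\<close>

definition defining_poly ::
    "(('k::field ^ 'n::{finite,linorder}) set \<Rightarrow> ('n, 'k) mpoly) \<Rightarrow>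
     ('k ^ 'n::{finite,linorder}) set set \<Rightarrow> ('n, 'k) mpoly"
  where "defining_poly \<alpha> A = (\<Prod>H\<in>A. \<alpha> H)"


section \<open>Logarithmic multiderivations\<close>

definition derivation :: "(('n::{finite,linorder}, 'k::field) mpoly \<Rightarrow> ('n, 'k) mpoly) \<Rightarrow> bool"
  where "derivation D \<longleftrightarrow>
    (\<forall>f g. D (f + g) = D f + D g) \<and>
    (\<forall>f g. D (f * g) = f * D g + D f * g) \<and>
    (\<forall>c. D (cst c) = 0)"

lemma derivation_pd: "derivation (pd i)"
  by (simp add: derivation_def pd_add pd_mult cst_def pd_single)

text \<open>
  A \<open>p\<close>-multiderivation is a function of the list of its \<open>p\<close> arguments, extended by \<open>0\<close> to
  lists of any other length.
\<close>

type_synonym ('n, 'k) mder = "('n, 'k) mpoly list \<Rightarrow> ('n, 'k) mpoly"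

definition mder_scale ::
    "('n::{finite,linorder}, 'k::field) mpoly \<Rightarrow> ('n, 'k) mder \<Rightarrow> ('n, 'k) mder"
  where "mder_scale g \<theta> = (\<lambda>fs. g * \<theta> fs)"

lemma module_mder: "module mder_scale"
  by unfold_locales (auto simp: mder_scale_def fun_eq_iff algebra_simps)

text \<open>\<open>(D\<^sub>1 \<and> \<dots> \<and> D\<^sub>p)(f\<^sub>1, \<dots>, f\<^sub>p) = det (D\<^sub>i f\<^sub>j)\<close>\<close>

definition wedge :: "(('n::{finite,linorder}, 'k::field) mpoly \<Rightarrow> ('n, 'k) mpoly) list \<Rightarrow> ('n, 'k) mder"
  where "wedge Ds = (\<lambda>fs.
    if length fs = length Ds
    then \<Sum>\<sigma> | \<sigma> permutes {..<length Ds}. of_int (sign \<sigma>) * (\<Prod>i<length Ds. (Ds ! i) (fs ! \<sigma> i))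
    else 0)"

text \<open>
  \<open>\<Lambda>\<^sup>p(Der\<^sub>k S)\<close>, regarded inside the alternating multiderivations.  Since \<open>Der\<^sub>k S\<close> is free on
  the \<open>\<partial>/\<partial>x\<^sub>i\<close>, the canonical map from the abstract exterior power is injective.
\<close>

definition multiderivations :: "nat \<Rightarrow> ('n::{finite,linorder}, 'k::field) mder set"
  where "multiderivations p =
    module.span mder_scale {wedge Ds | Ds. length Ds = p \<and> (\<forall>D\<in>set Ds. derivation D)}"

definition log_der :: "nat \<Rightarrow> ('n::{finite,linorder}, 'k::field) mpoly \<Rightarrow> ('n, 'k) mder set"
  where "log_der p Q =
    {\<theta>\<in>multiderivations p. \<forall>fs. length fs + 1 = p \<longrightarrow> Q dvd \<theta> (Q # fs)}"

text \<open>
  The grading, with \<open>\<partial>/\<partial>x\<^sub>i\<close> in degree \<open>-1\<close>: an element of degree \<open>d\<close> raises the total degree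
  of its homogeneous arguments by \<open>d\<close>.
\<close>

definition log_der_deg ::
    "nat \<Rightarrow> ('n::{finite,linorder}, 'k::field) mpoly \<Rightarrow> int \<Rightarrow> ('n, 'k) mder set"
  where "log_der_deg p Q d =
    {\<theta>\<in>log_der p Q. \<forall>fs es. list_all2 (\<lambda>f e. f \<in> S_deg e) fs es \<and> length fs = p \<longrightarrow>
      \<theta> fs \<in> S_deg (sum_list es + d)}"


section \<open>Logarithmic differential forms\<close>

text \<open>
  The module of differentials of \<open>K\<close> over \<open>k\<close> is free over \<open>K\<close> on the \<open>dx\<^sub>i\<close>, and a form is given
  by its coefficients: \<open>\<omega> :: 'n set \<Rightarrow> K\<close> stands for the sum of the \<open>\<omega> I dx\<^sub>I\<close>, where
  \<open>dx\<^sub>I = dx\<^sub>i\<^sub>1 \<and> \<dots> \<and> dx\<^sub>i\<^sub>p\<close> for \<open>I = {i1 < \<dots> < ip}\<close>.  The forms over \<open>S\<close> are those with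
  coefficients in \<open>S\<close>.
\<close>

type_synonym ('n, 'k) form = "'n set \<Rightarrow> ('n, 'k) mpoly fract"

definition form_scale ::
    "('n::{finite,linorder}, 'k::field) mpoly \<Rightarrow> ('n, 'k) form \<Rightarrow> ('n, 'k) form"
  where "form_scale g \<omega> = (\<lambda>I. to_frac g * \<omega> I)"

lemma module_form: "module form_scale"
  by unfold_locales
    (simp_all add: form_scale_def fun_eq_iff to_frac_hom distrib_left distrib_right mult.assoc)

definition forms_K :: "nat \<Rightarrow> ('n::{finite,linorder}, 'k::field) form set"
  where "forms_K p = {\<omega>. \<forall>I. card I \<noteq> p \<longrightarrow> \<omega> I = 0}"

definition forms_S :: "nat \<Rightarrow> ('n::{finite,linorder}, 'k::field) form set"
  where "forms_S p = {\<omega>\<in>forms_K p. \<forall>I. \<omega> I \<in> range to_frac}"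

text \<open>
  Coefficients of \<open>d\<omega> = \<Sum>\<^sub>I \<Sum>\<^sub>i (\<partial>\<omega>\<^sub>I/\<partial>x\<^sub>i) dx\<^sub>i \<and> dx\<^sub>I\<close>: sorting \<open>dx\<^sub>i \<and> dx\<^sub>I\<close> costs one sign
  for each \<open>j \<in> I\<close> with \<open>j < i\<close>.
\<close>

definition ext_d :: "('n::{finite,linorder}, 'k::field) form \<Rightarrow> ('n, 'k) form"
  where "ext_d \<omega> = (\<lambda>J. \<Sum>i\<in>J. (-1) ^ card {j\<in>J. j < i} * pd_frac i (\<omega> (J - {i})))"

definition log_forms :: "nat \<Rightarrow> ('n::{finite,linorder}, 'k::field) mpoly \<Rightarrow> ('n, 'k) form set"
  where "log_forms p Q =
    {\<omega>\<in>forms_K p. form_scale Q \<omega> \<in> forms_S p \<and> form_scale Q (ext_d \<omega>) \<in> forms_S (p + 1)}"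

text \<open>The grading, with \<open>dx\<^sub>i\<close> in degree \<open>1\<close>.\<close>

definition log_forms_deg ::
    "nat \<Rightarrow> ('n::{finite,linorder}, 'k::field) mpoly \<Rightarrow> int \<Rightarrow> ('n, 'k) form set"
  where "log_forms_deg p Q d = {\<omega>\<in>log_forms p Q. \<forall>I. \<omega> I \<in> K_deg (d - int (card I))}"


section \<open>Free modules\<close>

definition free_submodule :: "('r::comm_ring_1 \<Rightarrow> 'm::ab_group_add \<Rightarrow> 'm) \<Rightarrow> 'm set \<Rightarrow> bool"
  where "free_submodule smul M \<longleftrightarrow>
    (\<exists>B. \<not> module.dependent smul B \<and> module.span smul B = M)"


section \<open>Sheaves on projective space\<close>

definition Proj :: "('n::{finite,linorder}, 'k::field) mpoly set set"
  where "Proj = {P.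
    0 \<in> P \<and> (\<forall>f\<in>P. \<forall>g\<in>P. f + g \<in> P) \<and> (\<forall>f\<in>P. \<forall>g. g * f \<in> P) \<and>
    1 \<notin> P \<and> (\<forall>f g. f * g \<in> P \<longrightarrow> f \<in> P \<or> g \<in> P) \<and>
    (\<forall>f\<in>P. \<forall>d. hom_component d f \<in> P) \<and>
    \<not> (\<forall>d>0. S_deg d \<subseteq> P)}"

definition zariski_open :: "('n::{finite,linorder}, 'k::field) mpoly set set \<Rightarrow> bool"
  where "zariski_open U \<longleftrightarrow> (\<exists>E \<subseteq> (\<Union>d. S_deg d). U = {P\<in>Proj. \<not> E \<subseteq> P})"

text \<open>
  A graded \<open>S\<close>-module is given by the scalar multiplication \<open>smul\<close> of an ambient module and
  the family \<open>M\<close> of its graded pieces; \<open>S\<close> itself is given by \<open>(*)\<close> and \<open>S_deg\<close>.  Elements of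
  the homogeneous localization \<open>M\<^sub>(\<^sub>P\<^sub>)\<close> are classes of pairs \<open>(m, f)\<close>, written \<open>m/f\<close>, with \<open>m\<close>
  and \<open>f\<close> homogeneous of the same degree and \<open>f \<notin> P\<close>.
\<close>

context
  fixes smul :: "('n::{finite,linorder}, 'k::field) mpoly \<Rightarrow> 'm::ab_group_add \<Rightarrow> 'm"
    and M :: "int \<Rightarrow> 'm set"
begin

definition loc_pairs :: "('n, 'k) mpoly set \<Rightarrow> ('m \<times> ('n, 'k) mpoly) set"
  where "loc_pairs P = (\<Union>d. {(m, f). m \<in> M d \<and> f \<in> S_deg d \<and> f \<notin> P})"

definition loc_rel ::
    "('n, 'k) mpoly set \<Rightarrow> (('m \<times> ('n, 'k) mpoly) \<times> ('m \<times> ('n, 'k) mpoly)) set"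
  where "loc_rel P = {((m, f), (m', f')).
    (m, f) \<in> loc_pairs P \<and> (m', f') \<in> loc_pairs P \<and>
    (\<exists>u d. u \<in> S_deg d \<and> u \<notin> P \<and> smul u (smul f' m - smul f m') = 0)}"

definition loc_frac :: "('n, 'k) mpoly set \<Rightarrow> 'm \<Rightarrow> ('n, 'k) mpoly \<Rightarrow> ('m \<times> ('n, 'k) mpoly) set"
  where "loc_frac P m f = loc_rel P `` {(m, f)}"

definition loc_add ::
    "('n, 'k) mpoly set \<Rightarrow> ('m \<times> ('n, 'k) mpoly) set \<Rightarrow> ('m \<times> ('n, 'k) mpoly) set \<Rightarrow>
     ('m \<times> ('n, 'k) mpoly) set"
  where "loc_add P x y =
    (\<Union>(m, f)\<in>x. \<Union>(m', f')\<in>y. loc_frac P (smul f' m + smul f m') (f * f'))"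

text \<open>The action of the local ring \<open>S\<^sub>(\<^sub>P\<^sub>)\<close>.\<close>

definition loc_scale ::
    "('n, 'k) mpoly set \<Rightarrow> (('n, 'k) mpoly \<times> ('n, 'k) mpoly) set \<Rightarrow>
     ('m \<times> ('n, 'k) mpoly) set \<Rightarrow> ('m \<times> ('n, 'k) mpoly) set"
  where "loc_scale P a x =
    (\<Union>(g, h)\<in>a. \<Union>(m, f)\<in>x. loc_frac P (smul g m) (h * f))"

text \<open>
  The sections over \<open>U\<close> of the associated sheaf: functions assigning to each \<open>P \<in> U\<close> an element
  of \<open>M\<^sub>(\<^sub>P\<^sub>)\<close> that are locally given by a single fraction.
\<close>

definition sections ::
    "('n, 'k) mpoly set set \<Rightarrow> (('n, 'k) mpoly set \<Rightarrow> ('m \<times> ('n, 'k) mpoly) set) set"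
  where "sections U = {s \<in> extensional U. \<forall>P\<in>U. \<exists>W d m f.
    zariski_open W \<and> P \<in> W \<and> W \<subseteq> U \<and> m \<in> M d \<and> f \<in> S_deg d \<and>
    (\<forall>P'\<in>W. f \<notin> P' \<and> s P' = loc_frac P' m f)}"

definition lin_comb ::
    "('n, 'k) mpoly set set \<Rightarrow> nat \<Rightarrow>
     (nat \<Rightarrow> ('n, 'k) mpoly set \<Rightarrow> (('n, 'k) mpoly \<times> ('n, 'k) mpoly) set) \<Rightarrow>
     (nat \<Rightarrow> ('n, 'k) mpoly set \<Rightarrow> ('m \<times> ('n, 'k) mpoly) set) \<Rightarrow>
     ('n, 'k) mpoly set \<Rightarrow> ('m \<times> ('n, 'k) mpoly) set"
  where "lin_comb W r a e = (\<lambda>P\<in>W.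
    foldr (\<lambda>i. loc_add P (loc_scale P (a i P) (e i P))) [0..<r] (loc_frac P 0 1))"

end

definition structure_sections ::
    "('n::{finite,linorder}, 'k::field) mpoly set set \<Rightarrow>
     (('n, 'k) mpoly set \<Rightarrow> (('n, 'k) mpoly \<times> ('n, 'k) mpoly) set) set"
  where "structure_sections = sections (*) S_deg"

text \<open>
  Every point has an open neighbourhood \<open>U\<close> with sections \<open>e\<^sub>0, \<dots>, e\<^bsub>r-1\<^esub>\<close> such that the map
  \<open>(a\<^sub>i) \<mapsto> \<Sum> a\<^sub>i e\<^sub>i\<close> from the \<open>r\<close>-th power of the structure sheaf on \<open>U\<close> is an isomorphism, i.e.
  is bijective on sections over every open \<open>W \<subseteq> U\<close>.  By linearity and compatibility with
  restriction every such isomorphism arises in this way from the images \<open>e\<^sub>i\<close> of the unit vectors.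
\<close>

definition sheaf_locally_free ::
    "(('n::{finite,linorder}, 'k::field) mpoly \<Rightarrow> 'm::ab_group_add \<Rightarrow> 'm) \<Rightarrow> (int \<Rightarrow> 'm set) \<Rightarrow> bool"
  where "sheaf_locally_free smul M \<longleftrightarrow>
    (\<forall>P\<in>Proj. \<exists>U r e. zariski_open U \<and> P \<in> U \<and> (\<forall>i<r. e i \<in> sections smul M U) \<and>
      (\<forall>W. zariski_open W \<and> W \<subseteq> U \<longrightarrow>
        bij_betw (\<lambda>a. lin_comb smul M W r a e)
          ({..<r} \<rightarrow>\<^sub>E structure_sections W) (sections smul M W)))"

end

theory Submission
  imports Defs
begin

text \<open>
  Write \<open>Q = \<Prod> \<alpha>\<^sub>H\<close> and \<open>\<rho>\<close> for the rank.  Multiplication by \<open>Q\<close> identifies \<open>\<Omega>\<^sup>p(A)\<close> with the lattice of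
  \<open>p\<close>-forms \<open>\<eta>\<close> over \<open>S\<close> such that every \<open>\<alpha>\<^sub>H\<close> divides \<open>d\<alpha>\<^sub>H \<and> \<eta>\<close>, and contraction with the volume form
  identifies \<open>D\<^sup>p(A)\<close> with the lattice of the same shape in degree \<open>n + 1 - p\<close>.  So everything reduces to
  these lattices \<open>L\<close>, for which there is a criterion of Saito type: the determinant of \<open>\<rho>\<close> elements of \<open>L\<close> is
  divisible by a fixed power \<open>\<Delta>\<close> of \<open>Q\<close>, and by Cramer's rule the elements form a basis of the localisation
  of \<open>L\<close> at a multiplicative set \<open>T\<close> if (and, for generators, only if) the quotient lies in \<open>T\<close>.
  With \<open>T\<close> the units this is freeness, and with \<open>T\<close> the complement of a homogeneous prime it is
  local freeness of the sheaf at a point.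

  A point \<open>P\<close> lies over the flat \<open>X\<close> cut out by the \<open>\<alpha>\<^sub>H\<close> in \<open>P\<close>, and a basis for \<open>A\<^sub>X\<close> becomes a local basis
  for \<open>A\<close> after multiplication by the other \<open>\<alpha>\<^sub>H\<close>, which are units at \<open>P\<close>.  Conversely, at the generic
  point of a flat \<open>X\<close> a local basis for \<open>A\<close> is one for \<open>A\<^sub>X\<close>; expanding it along \<open>X\<close>, on which the forms
  of \<open>A\<^sub>X\<close> do not depend, and taking homogeneous components yields by multilinearity of the determinant
  a tuple whose quotient is a nonzero constant.  Finally the inverse of the matrix of a basis for \<open>D\<^sup>p\<close> gives
  a basis for \<open>\<Omega>\<^sup>p\<close> and vice versa.
\<close>

section \<open>Evaluation homomorphisms and the grading\<close>

text \<open>The exponent in \<open>\<Delta>\<close> is read off at one hyperplane: modulo its linear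
  form, membership in \<open>L\<close> says that the restriction of the form to the hyperplane is 0,
  and the forms of degree q on a hyperplane have rank n choose q. The only factorisation used is
  that linear forms are prime. The field may be finite, so a flat need not have a rational point
  outside a given hypersurface at which a tuple could be expanded. The expansion is made at the
  generic point instead: f(x + M Y), with new variables Y and a projection M onto the flat. The
  linear forms vanishing on the flat do not involve Y, so the coefficients in Y of a lattice element
  stay in the lattice. Setting x = 0 records the value at the generic point; a quotient that is
  nonzero there leads to one with nonzero constant term, and a homogeneous element with nonzero
  constant term is a unit.\<close>

lemma pm_sum_single:
  fixes f :: "'m \<Rightarrow>\<^sub>0 'a::comm_monoid_add"
  shows "(\<Sum>m\<in>Poly_Mapping.keys f. Poly_Mapping.single m (Poly_Mapping.lookup f m)) = f"
  by (rule poly_mapping_eqI) (simp add: lookup_sum lookup_single when_def in_keys_iff)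

lemma pm_induct [case_names zero add]:
  fixes f :: "'m \<Rightarrow>\<^sub>0 'a::comm_monoid_add"
  assumes "P 0" "\<And>f m c. P f \<Longrightarrow> P (f + Poly_Mapping.single m c)"
  shows "P f"
proof -
  have "finite T \<Longrightarrow> P (\<Sum>m\<in>T. Poly_Mapping.single m (Poly_Mapping.lookup f m))" for T
    by (induction T rule: finite_induct) (auto simp: assms add.commute [of "Poly_Mapping.single _ _"])
  then show ?thesis
    using pm_sum_single[of f] by (metis finite_keys)
qed

definition rhom :: "('a::comm_ring_1 \<Rightarrow> 'b::comm_ring_1) \<Rightarrow> bool"
  where "rhom h \<longleftrightarrow> (\<forall>x y. h (x + y) = h x + h y) \<and> (\<forall>x y. h (x * y) = h x * h y) \<and> h 1 = 1"

lemma rhomI: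
  assumes "\<And>x y. h (x + y) = h x + h y" "\<And>x y. h (x * y) = h x * h y" "h 1 = 1"
  shows "rhom h"
  using assms by (simp add: rhom_def)

lemma rhom_add: "rhom h \<Longrightarrow> h (x + y) = h x + h y"
  and rhom_mult: "rhom h \<Longrightarrow> h (x * y) = h x * h y"
  and rhom_1: "rhom h \<Longrightarrow> h 1 = 1"
  by (simp_all add: rhom_def)

lemma rhom_0: "rhom h \<Longrightarrow> h 0 = 0"
  by (metis add_cancel_right_right rhom_add)

lemma rhom_minus: "rhom h \<Longrightarrow> h (- x) = - h x"
  by (metis add.right_inverse add_eq_0_iff rhom_0 rhom_add)

lemma rhom_diff: "rhom h \<Longrightarrow> h (x - y) = h x - h y"
  by (metis diff_conv_add_uminus rhom_add rhom_minus)

lemma rhom_sum: "rhom h \<Longrightarrow> h (sum f X) = (\<Sum>x\<in>X. h (f x))"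
  by (induction X rule: infinite_finite_induct) (simp_all add: rhom_0 rhom_add)

lemma rhom_prod: "rhom h \<Longrightarrow> h (prod f X) = (\<Prod>x\<in>X. h (f x))"
  by (induction X rule: infinite_finite_induct) (simp_all add: rhom_1 rhom_mult)

lemma rhom_power: "rhom h \<Longrightarrow> h (x ^ n) = h x ^ n"
  by (induction n) (simp_all add: rhom_1 rhom_mult)

lemma rhom_of_int: "rhom h \<Longrightarrow> h (of_int n) = of_int n"
proof -
  assume h: "rhom h"
  have "h (of_nat m) = of_nat m" for m
    by (induction m) (simp_all add: h rhom_0 rhom_1 rhom_add)
  then show ?thesis
    by (cases n) (simp_all add: h rhom_minus rhom_diff rhom_1 del: of_nat_Suc)
qed

lemma rhom_comp: "rhom g \<Longrightarrow> rhom h \<Longrightarrow> rhom (\<lambda>x. g (h x))"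
  by (simp add: rhom_def)

lemma rhom_id: "rhom (\<lambda>x. x)"
  by (simp add: rhom_def)

lemma rhom_single0: "rhom (Poly_Mapping.single (0::'m::comm_monoid_add))"
  by (rule rhomI) (simp_all add: single_add mult_single)

lemma rhom_det: "rhom h \<Longrightarrow> h (det A) = det (\<chi> i j. h (A $ i $ j))"
  by (simp add: det_def rhom_sum rhom_prod rhom_mult rhom_of_int)

text \<open>The coefficient ring is arbitrary because the same evaluation serves polynomials over
  \<open>k\<close> and, in \<open>spec\<close>, polynomials in new variables with coefficients in
  \<open>S\<close>.\<close>

definition ev :: "('a::comm_ring_1 \<Rightarrow> 'b::comm_ring_1) \<Rightarrow> ('n::finite \<Rightarrow> 'b) \<Rightarrow> (('n \<Rightarrow>\<^sub>0 nat) \<Rightarrow>\<^sub>0 'a) \<Rightarrow> 'b"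
  where "ev c v f = (\<Sum>m\<in>Poly_Mapping.keys f. c (Poly_Mapping.lookup f m) *
    (\<Prod>i\<in>UNIV. v i ^ Poly_Mapping.lookup m i))"

lemma ev_superset:
  assumes "rhom c" "finite T" "Poly_Mapping.keys f \<subseteq> T"
  shows "ev c v f = (\<Sum>m\<in>T. c (Poly_Mapping.lookup f m) * (\<Prod>i\<in>UNIV. v i ^ Poly_Mapping.lookup m i))"
  unfolding ev_def
  by (rule sum.mono_neutral_left) (use assms in \<open>auto simp: in_keys_iff rhom_0\<close>)

lemma ev_add:
  assumes "rhom c"
  shows "ev c v (f + g) = ev c v f + ev c v g"
proof -
  let ?T = "Poly_Mapping.keys f \<union> Poly_Mapping.keys g"
  have "ev c v (f + g) = (\<Sum>m\<in>?T. c (Poly_Mapping.lookup (f + g) m) * (\<Prod>i\<in>UNIV. v i ^ Poly_Mapping.lookup m i))"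
    by (rule ev_superset) (simp_all add: Poly_Mapping.keys_add assms)
  also have "\<dots> = ev c v f + ev c v g"
    by (simp add: ev_superset[OF assms, of ?T f] ev_superset[OF assms, of ?T g] lookup_add distrib_right
        rhom_add assms sum.distrib)
  finally show ?thesis .
qed

lemma ev_single:
  assumes "rhom c"
  shows "ev c v (Poly_Mapping.single m a) = c a * (\<Prod>i\<in>UNIV. v i ^ Poly_Mapping.lookup m i)"
  by (cases "a = 0") (simp_all add: ev_def rhom_0 assms)

lemma ev_mult:
  assumes "rhom c"
  shows "ev c v (f * g) = ev c v f * ev c v g"
proof (induction f rule: pm_induct)
  case zero
  show ?case by (simp add: ev_def)
next
  case (add f m a)
  have "ev c v (Poly_Mapping.single m a * g) = ev c v (Poly_Mapping.single m a) * ev c v g"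
  proof (induction g rule: pm_induct)
    case (add g m' a')
    show ?case
      by (simp add: distrib_left ev_add assms add.IH mult_single ev_single rhom_mult lookup_add
          power_add prod.distrib)
  qed (simp add: ev_def)
  then show ?case
    by (simp add: distrib_right ev_add assms add.IH)
qed

lemma rhom_ev: "rhom c \<Longrightarrow> rhom (ev c v)"
proof (rule rhomI)
  assume c: "rhom c"
  show "ev c v 1 = 1"
    using ev_single[OF c, of v 0 1] by (simp add: rhom_1 c)
qed (simp_all add: ev_add ev_mult)

lemma ev_const: "rhom c \<Longrightarrow> ev c v (Poly_Mapping.single 0 a) = c a"
  by (simp add: ev_single)

lemma ev_var: "rhom c \<Longrightarrow> ev c v (Poly_Mapping.single (Poly_Mapping.single i 1) 1) = v i"
proof -
  assume c: "rhom c"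
  have "(\<Prod>j\<in>UNIV. v j ^ Poly_Mapping.lookup (Poly_Mapping.single i (1::nat)) j) =
      (\<Prod>j\<in>UNIV. if j = i then v j else 1)"
    by (rule prod.cong) (auto simp: lookup_single)
  then show ?thesis
    by (simp add: ev_single rhom_1 c)
qed

lemma ev_cst: "rhom c \<Longrightarrow> ev c v (cst a) = c a"
  by (simp add: cst_def ev_const)

lemma ev_coord: "rhom c \<Longrightarrow> ev c v (coord i) = v i"
  unfolding coord_def by (rule ev_var)

lemma rhom_cst: "rhom cst"
  using rhom_single0 by (simp add: cst_def[abs_def])

lemma cst_0 [simp]: "cst 0 = 0" and cst_1 [simp]: "cst 1 = 1"
  by (simp_all add: rhom_0 rhom_1 rhom_cst)

lemma mono_conv_prod:
  fixes m :: "'n::{finite,linorder} \<Rightarrow>\<^sub>0 nat"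
  shows "Poly_Mapping.single m (1::'k::field) = (\<Prod>i\<in>UNIV. coord i ^ Poly_Mapping.lookup m i)"
proof -
  have pow: "coord i ^ n = Poly_Mapping.single (Poly_Mapping.single i n) (1::'k)" for i :: 'n and n
    by (induction n) (simp_all add: coord_def mult_single flip: single_add)
  have "finite T \<Longrightarrow> (\<Prod>i\<in>T. coord i ^ Poly_Mapping.lookup m i) =
      Poly_Mapping.single (\<Sum>i\<in>T. Poly_Mapping.single i (Poly_Mapping.lookup m i)) (1::'k)" for T
    by (induction T rule: finite_induct) (simp_all add: pow mult_single)
  moreover have "(\<Sum>i\<in>UNIV. Poly_Mapping.single i (Poly_Mapping.lookup m i)) = m"
    by (rule poly_mapping_eqI) (simp add: lookup_sum lookup_single when_def)
  ultimately show ?thesis by simp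
qed

lemma single_conv_cst: "Poly_Mapping.single m c = cst c * Poly_Mapping.single m 1"
  by (simp add: cst_def mult_single)

lemma mpoly_gen_induct [case_names cst coord add mult]:
  fixes f :: "('n::{finite,linorder}, 'k::field) mpoly"
  assumes "\<And>c. P (cst c)" "\<And>i. P (coord i)" "\<And>f g. P f \<Longrightarrow> P g \<Longrightarrow> P (f + g)"
    "\<And>f g. P f \<Longrightarrow> P g \<Longrightarrow> P (f * g)"
  shows "P f"
proof -
  have pow: "P (coord i ^ n)" for i n
    by (induction n) (use assms(1)[of 1] in \<open>simp_all add: assms\<close>)
  have "finite T \<Longrightarrow> P (\<Prod>i\<in>T. coord i ^ Poly_Mapping.lookup m i)" for T and m :: "'n \<Rightarrow>\<^sub>0 nat"
  proof -
    assume "finite T"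
    then show ?thesis
      using assms(1)[of 1] by (induction T rule: finite_induct) (simp_all add: assms pow)
  qed
  then have "P (Poly_Mapping.single m c)" for m c
    by (simp add: single_conv_cst[of m c] mono_conv_prod assms)
  then show ?thesis
    by (induction f rule: pm_induct) (use assms(1)[of 0] in \<open>simp_all add: assms\<close>)
qed

lemma rhom_eqI:
  fixes f :: "('n::{finite,linorder}, 'k::field) mpoly"
  assumes "rhom g" "rhom h" "\<And>c. g (cst c) = h (cst c)" "\<And>i. g (coord i) = h (coord i)"
  shows "g f = h f"
  by (induction f rule: mpoly_gen_induct) (simp_all add: assms rhom_add rhom_mult)

section \<open>Derivations in coordinates\<close>

lemma pd_coord: "pd i (coord j) = (if i = j then 1 else 0)"
  by (simp add: coord_def pd_single lookup_single when_def)

lemma pd_cst: "pd i (cst c) = 0"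
  by (simp add: cst_def pd_single)

lemma derivation_expand:
  fixes D :: "('n::{finite,linorder}, 'k::field) mpoly \<Rightarrow> ('n, 'k) mpoly"
  assumes "derivation D"
  shows "D f = (\<Sum>i\<in>UNIV. pd i f * D (coord i))"
proof (induction f rule: mpoly_gen_induct)
  case (cst c)
  show ?case using assms by (simp add: derivation_def pd_cst)
next
  case (coord j)
  show ?case by (simp add: pd_coord if_distrib[of "\<lambda>x. x * _"] cong: if_cong)
next
  case (add f g)
  then show ?case using assms
    by (simp add: derivation_def pd_add distrib_right sum.distrib)
next
  case (mult f g)
  then show ?case using assms
    by (simp add: derivation_def pd_mult algebra_simps sum.distrib sum_distrib_left)
qed

lemma pd_sum: "pd i (sum f X) = (\<Sum>x\<in>X. pd i (f x))"
  by (induction X rule: infinite_finite_induct) (simp_all add: pd_0 pd_add)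

lemma pd_linear_form: "pd i (linear_form a) = cst (a $ i)"
  by (simp add: linear_form_def pd_sum pd_mult pd_cst pd_coord if_distrib[of "\<lambda>x. _ * x"] cong: if_cong)

lemma pd_prod:
  assumes "finite X"
  shows "pd i (prod f X) = (\<Sum>x\<in>X. pd i (f x) * prod f (X - {x}))"
  using assms
proof (induction X rule: finite_induct)
  case empty
  then show ?case using pd_cst[of i 1] by simp
next
  case (insert y X)
  have "(\<Sum>x\<in>X. pd i (f x) * prod f (insert y X - {x})) = (\<Sum>x\<in>X. f y * (pd i (f x) * prod f (X - {x})))"
  proof (rule sum.cong)
    fix x assume x: "x \<in> X"
    then have "insert y X - {x} = insert y (X - {x})" using insert by auto
    then show "pd i (f x) * prod f (insert y X - {x}) = f y * (pd i (f x) * prod f (X - {x}))"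
      using insert by (simp add: ac_simps)
  qed simp
  then show ?case
    using insert by (simp add: pd_mult sum_distrib_left mult.commute mult.left_commute)
qed

section \<open>The grading of the polynomial ring\<close>

lemma total_degree_add: "total_degree (m + m') = total_degree m + total_degree m'"
  by (simp add: total_degree_def lookup_add sum.distrib)

lemma S_deg_0 [simp]: "0 \<in> S_deg d"
  by (simp add: S_deg_def)

lemma S_deg_add: "f \<in> S_deg d \<Longrightarrow> g \<in> S_deg d \<Longrightarrow> f + g \<in> S_deg d"
  using Poly_Mapping.keys_add[of f g] by (auto simp: S_deg_def)

lemma S_deg_uminus: "f \<in> S_deg d \<Longrightarrow> - f \<in> S_deg d"
  by (auto simp: S_deg_def in_keys_iff)

lemma S_deg_sum: "(\<And>x. x \<in> X \<Longrightarrow> f x \<in> S_deg d) \<Longrightarrow> sum f X \<in> S_deg d"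
  by (induction X rule: infinite_finite_induct) (auto simp: S_deg_add)

lemma S_deg_mult: "f \<in> S_deg d \<Longrightarrow> g \<in> S_deg e \<Longrightarrow> f * g \<in> S_deg (d + e)"
  using Poly_Mapping.keys_mult[of f g] by (fastforce simp: S_deg_def total_degree_add)

lemma S_deg_single: "Poly_Mapping.single m c \<in> S_deg (int (total_degree m))"
  by (simp add: S_deg_def)

lemma S_deg_cst: "cst c \<in> S_deg 0"
  using S_deg_single[of 0 c] by (simp add: cst_def total_degree_def)

lemma S_deg_1: "1 \<in> S_deg 0"
  using S_deg_cst[of 1] by simp

lemma S_deg_coord: "coord i \<in> S_deg 1"
  using S_deg_single[of "Poly_Mapping.single i 1" 1]
  by (simp add: coord_def total_degree_def lookup_single when_def)

lemma S_deg_linear_form: "linear_form a \<in> S_deg 1"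
  unfolding linear_form_def
  using S_deg_mult[OF S_deg_cst S_deg_coord] by (intro S_deg_sum) simp

lemma S_deg_prod:
  assumes "finite X" "\<And>x. x \<in> X \<Longrightarrow> f x \<in> S_deg (d x)"
  shows "prod f X \<in> S_deg (sum d X)"
  using assms by (induction X rule: finite_induct) (auto simp: S_deg_1 S_deg_mult)

lemma S_deg_power: "f \<in> S_deg d \<Longrightarrow> f ^ n \<in> S_deg (int n * d)"
  by (induction n) (auto simp: S_deg_1 distrib_right dest: S_deg_mult[of f d])

lemma S_deg_pd: "f \<in> S_deg d \<Longrightarrow> pd i f \<in> S_deg (d - 1)"
  unfolding pd_def
proof (rule S_deg_sum)
  fix m assume f: "f \<in> S_deg d" and m: "m \<in> Poly_Mapping.keys f"
  show "Poly_Mapping.single (m - Poly_Mapping.single i 1)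
      (of_nat (Poly_Mapping.lookup m i) * Poly_Mapping.lookup f m) \<in> S_deg (d - 1)"
  proof (cases "Poly_Mapping.lookup m i = 0")
    case False
    then have "Poly_Mapping.single i 1 + (m - Poly_Mapping.single i 1) = m"
      using minus_single_add[of m i "Poly_Mapping.single i 1"] by (metis add_diff_cancel_left')
    then have "total_degree m = total_degree (Poly_Mapping.single i (1::nat)) + total_degree (m - Poly_Mapping.single i 1)"
      by (metis total_degree_add)
    also have "total_degree (Poly_Mapping.single i (1::nat)) = 1"
      by (simp add: total_degree_def lookup_single when_def)
    finally have "int (total_degree (m - Poly_Mapping.single i 1)) = d - 1"
      using f m by (auto simp: S_deg_def)
    then show ?thesis using S_deg_single by metis
  qed simp
qed

text \<open>Indexed by integers, like \<open>S_deg\<close>: splitting off a homogeneous factor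
  lowers the index, possibly below 0, and then the component is 0.\<close>

definition hz :: "int \<Rightarrow> ('n::{finite,linorder}, 'k::field) mpoly \<Rightarrow> ('n, 'k) mpoly"
  where "hz d f = (if d < 0 then 0 else hom_component (nat d) f)"

lemma lookup_hz: "Poly_Mapping.lookup (hz d f) m = (if int (total_degree m) = d then Poly_Mapping.lookup f m else 0)"
proof (cases "d < 0")
  case False
  then have "(int (total_degree m) = d) = (total_degree m = nat d)" by auto
  with False show ?thesis
    by (auto simp: hz_def hom_component_def lookup_sum lookup_single when_def in_keys_iff)
qed (auto simp: hz_def)

lemma hz_add: "hz d (f + g) = hz d f + hz d g"
  by (rule poly_mapping_eqI) (simp add: lookup_hz lookup_add)

lemma hz_0 [simp]: "hz d 0 = 0"
  by (rule poly_mapping_eqI) (simp add: lookup_hz)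

lemma hz_sum: "hz d (sum f X) = (\<Sum>x\<in>X. hz d (f x))"
  by (induction X rule: infinite_finite_induct) (simp_all add: hz_add)

lemma hz_in: "hz d f \<in> S_deg d"
  by (auto simp: S_deg_def in_keys_iff lookup_hz split: if_splits)

lemma hz_same: "f \<in> S_deg e \<Longrightarrow> hz d f = (if d = e then f else 0)"
  by (rule poly_mapping_eqI) (auto simp: lookup_hz S_deg_def in_keys_iff)

lemma hz_sum_all:
  assumes "finite X" "(\<lambda>m. int (total_degree m)) ` Poly_Mapping.keys f \<subseteq> X"
  shows "(\<Sum>d\<in>X. hz d f) = f"
proof (rule poly_mapping_eqI)
  fix m
  show "Poly_Mapping.lookup (\<Sum>d\<in>X. hz d f) m = Poly_Mapping.lookup f m"
  proof (cases "m \<in> Poly_Mapping.keys f")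
    case True
    then have "int (total_degree m) \<in> X" using assms(2) by auto
    then show ?thesis using assms(1) by (simp add: lookup_sum lookup_hz)
  next
    case False
    then show ?thesis by (simp add: lookup_sum lookup_hz in_keys_iff sum.neutral)
  qed
qed

lemma hz_decomp:
  fixes F :: "'a \<Rightarrow> ('n::{finite,linorder}, 'k::field) mpoly"
  assumes "finite Y"
  obtains X where "finite X" "\<And>y. y \<in> Y \<Longrightarrow> (\<Sum>d\<in>X. hz d (F y)) = F y"
proof -
  let ?X = "\<Union>y\<in>Y. (\<lambda>m. int (total_degree m)) ` Poly_Mapping.keys (F y)"
  have "(\<Sum>d\<in>?X. hz d (F y)) = F y" if "y \<in> Y" for y
    by (rule hz_sum_all) (use that assms in auto)
  then show ?thesis using that[of ?X] assms by simp
qed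

lemma hz_mult:
  assumes "g \<in> S_deg e"
  shows "hz d (g * f) = g * hz (d - e) f"
proof -
  obtain X0 where X0: "finite X0" "(\<Sum>d\<in>X0. hz d f) = f"
    using hz_decomp[of "{f}" "\<lambda>x. x"] by auto
  \<comment> \<open>The index \<open>d - e\<close> is added, with component 0 if it was missing, so
    that the sum below collapses to exactly one term.\<close>
  define X where "X = insert (d - e) X0"
  have X: "finite X" "(\<Sum>d\<in>X. hz d f) = f" "d - e \<in> X"
  proof -
    have "hz (d - e) f = 0" if "d - e \<notin> X0"
    proof -
      have "hz (d - e) f = (\<Sum>d'\<in>X0. hz (d - e) (hz d' f))" by (metis X0(2) hz_sum)
      also have "\<dots> = 0" using that by (intro sum.neutral) (auto simp: hz_same[OF hz_in])
      finally show ?thesis .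
    qed
    then show "finite X" "(\<Sum>d\<in>X. hz d f) = f" "d - e \<in> X"
      using X0 by (cases "d - e \<in> X0"; auto simp: X_def insert_absorb)+
  qed
  have "hz d (g * f) = hz d (\<Sum>d'\<in>X. g * hz d' f)"
    using X(2) by (metis sum_distrib_left)
  also have "\<dots> = (\<Sum>d'\<in>X. if d' = d - e then g * hz d' f else 0)"
    unfolding hz_sum
    by (rule sum.cong) (auto simp: hz_same[OF S_deg_mult[OF assms hz_in]])
  also have "\<dots> = g * hz (d - e) f" using X by simp
  finally show ?thesis .
qed

text \<open>Taking the component of degree \<open>b\<close> of \<open>g * f\<close> replaces
  \<open>f\<close> by one of its components, and \<open>S\<close> is a domain.\<close>

lemma S_deg_cancel:
  assumes "g \<in> S_deg a" "g \<noteq> 0" "g * f \<in> S_deg b"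
  shows "f \<in> S_deg (b - a)"
proof -
  have "g * f = g * hz (b - a) f"
    using hz_mult[OF assms(1), of b f] hz_same[OF assms(3), of b] by simp
  then have "f = hz (b - a) f" using assms(2) by simp
  then show ?thesis using hz_in by metis
qed

lemma hz_nonzero: "f \<noteq> 0 \<Longrightarrow> \<exists>d. hz d f \<noteq> 0"
  using hz_decomp[of "{f}" "\<lambda>x. x"] by (metis finite.simps insertI1 sum.neutral)

lemma S_deg_nonneg: "f \<in> S_deg d \<Longrightarrow> f \<noteq> 0 \<Longrightarrow> d \<ge> 0"
proof -
  assume f: "f \<in> S_deg d" "f \<noteq> 0"
  then obtain m where "m \<in> Poly_Mapping.keys f"
    by (metis equals0I keys_eq_empty)
  with f show ?thesis by (auto simp: S_deg_def)
qed

section \<open>Linear forms\<close>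

lemma linear_form_add: "linear_form (a + b) = linear_form a + linear_form b"
  by (simp add: linear_form_def rhom_add[OF rhom_cst] distrib_right sum.distrib)

lemma linear_form_scale: "linear_form (c *s a) = cst c * linear_form a"
  by (simp add: linear_form_def rhom_mult[OF rhom_cst] sum_distrib_left mult.assoc)

lemma linear_form_diff: "linear_form (a - b) = linear_form a - linear_form b"
  by (simp add: linear_form_def rhom_diff[OF rhom_cst] left_diff_distrib sum_subtractf)

lemma linear_form_0 [simp]: "linear_form 0 = 0"
  by (simp add: linear_form_def)

lemma linear_form_axis: "linear_form (axis i 1) = coord i"
  by (simp add: linear_form_def axis_def if_distrib[of cst] if_distrib[of "\<lambda>x. x * _"] cong: if_cong)

lemma cst_eq_0_iff [simp]: "cst c = 0 \<longleftrightarrow> c = 0"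
  unfolding cst_def by (metis lookup_single_eq lookup_zero single_zero)

lemma cst_unit: "c \<noteq> 0 \<Longrightarrow> cst c dvd f"
  by (rule dvdI[of _ _ "cst (inverse c) * f"])
    (simp flip: mult.assoc rhom_mult[OF rhom_cst])

lemma linear_form_eq_0_iff [simp]: "linear_form a = 0 \<longleftrightarrow> a = 0"
proof
  assume "linear_form a = 0"
  then have "cst (a $ i) = pd i 0" for i
    by (metis pd_linear_form)
  then have "a $ i = 0" for i
    by (simp add: pd_0)
  then show "a = 0" by (simp add: vec_eq_iff)
qed simp

text \<open>Solves \<open>linear_form a = 0\<close> for the coordinate \<open>j\<close> and
  substitutes the solution. The quotient of \<open>S\<close> by the linear form is thereby realised
  inside the domain \<open>S\<close>, which makes the form prime.\<close>

definition elim :: "'k::field ^ 'n::{finite,linorder} \<Rightarrow> 'n \<Rightarrow> ('n::{finite,linorder}, 'k) mpoly \<Rightarrow> ('n, 'k) mpoly"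
  where "elim a j = ev cst (\<lambda>i. if i = j then coord j - cst (inverse (a $ j)) * linear_form a else coord i)"

lemma rhom_elim: "rhom (elim a j)"
  unfolding elim_def by (rule rhom_ev[OF rhom_cst])

lemma elim_linear_form:
  assumes "a $ j \<noteq> 0"
  shows "elim a j (linear_form b) = linear_form (b - (b $ j / a $ j) *s a)"
proof -
  have "elim a j (linear_form b) = (\<Sum>i\<in>UNIV. cst (b $ i) * coord i -
      (if i = j then cst (b $ j / a $ j) * linear_form a else 0))"
    unfolding linear_form_def[of b] rhom_sum[OF rhom_elim] rhom_mult[OF rhom_elim]
    by (rule sum.cong)
      (simp_all add: elim_def ev_cst ev_coord rhom_cst rhom_mult divide_inverse right_diff_distrib mult.assoc)
  then show ?thesis
    by (simp add: sum_subtractf linear_form_diff linear_form_scale flip: linear_form_def)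
qed

text \<open>Modulo the form the substitution is the identity: this holds on constants and
  coordinates, hence on sums and products. Its kernel is therefore the ideal of the form.\<close>

lemma linear_form_dvd_iff_elim:
  assumes "a $ j \<noteq> 0"
  shows "linear_form a dvd f \<longleftrightarrow> elim a j f = 0"
proof
  assume "linear_form a dvd f"
  moreover have "elim a j (linear_form a) = 0"
    using assms by (simp add: elim_linear_form)
  ultimately show "elim a j f = 0"
    by (auto simp: rhom_mult rhom_elim)
next
  have "linear_form a dvd f - elim a j f"
  proof (induction f rule: mpoly_gen_induct)
    case (add f g)
    then show ?case
      by (metis add_diff_add dvd_add rhom_add rhom_elim)
  next
    case (mult f g)
    have "f * g - elim a j (f * g) = f * (g - elim a j g) + (f - elim a j f) * elim a j g"
      by (simp add: rhom_mult rhom_elim algebra_simps)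
    then show ?case using mult by simp
  qed (simp_all add: elim_def ev_cst ev_coord rhom_cst)
  moreover assume "elim a j f = 0"
  ultimately show "linear_form a dvd f" by simp
qed

lemma prime_linear_form:
  assumes "a \<noteq> 0"
  shows "prime_elem (linear_form a)"
proof -
  obtain j where j: "a $ j \<noteq> 0" using assms by (auto simp: vec_eq_iff)
  show ?thesis
    unfolding prime_elem_def
    using assms by (simp add: linear_form_dvd_iff_elim[of a j, OF j] rhom_mult rhom_1 rhom_elim)
qed

lemma linear_form_dvd_linear_form:
  assumes "a \<noteq> 0" "linear_form a dvd linear_form b"
  shows "\<exists>c. b = c *s a"
proof -
  obtain j where j: "a $ j \<noteq> 0" using assms by (auto simp: vec_eq_iff)
  have "linear_form (b - (b $ j / a $ j) *s a) = 0"
    using assms(2) by (simp add: linear_form_dvd_iff_elim[of a j, OF j] elim_linear_form[OF j] del: linear_form_eq_0_iff)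
  then show ?thesis by (auto simp only: linear_form_eq_0_iff right_minus_eq)
qed

section \<open>Divisibility by prime elements\<close>

lemma prime_elem_power_dvd_cancel:
  fixes p :: "'a::idom"
  assumes "prime_elem p" "p ^ n dvd x * y" "\<not> p dvd x"
  shows "p ^ n dvd y"
  using assms(2)
proof (induction n arbitrary: y)
  case (Suc n)
  have p: "p \<noteq> 0" using assms by (auto simp: prime_elem_def)
  have "p dvd x * y" using Suc.prems by (meson dvd_power dvd_trans zero_less_Suc)
  then have "p dvd y" using assms by (auto simp: prime_elem_def)
  then obtain z where z: "y = p * z" by auto
  have "p * p ^ n dvd p * (x * z)" using Suc.prems z by (simp add: mult.left_commute)
  then have "p ^ n dvd x * z" using p by simp
  then show ?case using Suc.IH[of z] z by (simp add: mult_dvd_mono)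
qed simp

lemma prime_elem_dvd_prodD:
  assumes "prime_elem (p::'a::comm_semiring_1)" "finite X" "p dvd prod f X"
  shows "\<exists>x\<in>X. p dvd f x"
  using assms(2,3)
proof (induction X rule: finite_induct)
  case empty
  then show ?case using assms(1) by (simp add: prime_elem_def)
next
  case (insert x X)
  then have "p dvd f x \<or> p dvd prod f X" using assms(1) by (simp add: prime_elem_def)
  with insert show ?case by auto
qed

section \<open>Exterior multiplication by a covector\<close>

text \<open>The product of the covector \<open>v\<close> with the form \<open>\<eta>\<close>, with
  the signs of \<open>ext_d\<close>. The ring is arbitrary because the product is also formed over
  S[Y], after \<open>shift\<close>.\<close>

definition wdg :: "('n::{finite,linorder} \<Rightarrow> 'r::comm_ring_1) \<Rightarrow> ('n set \<Rightarrow> 'r) \<Rightarrow> 'n set \<Rightarrow> 'r"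
  where "wdg v \<eta> J = (\<Sum>i\<in>J. (-1) ^ card {j\<in>J. j < i} * v i * \<eta> (J - {i}))"

lemma wdg_add: "wdg v (\<lambda>I. \<eta> I + \<zeta> I) J = wdg v \<eta> J + wdg v \<zeta> J"
  by (simp add: wdg_def distrib_left sum.distrib)

lemma wdg_diff: "wdg v (\<lambda>I. \<eta> I - \<zeta> I) J = wdg v \<eta> J - wdg v \<zeta> J"
  by (simp add: wdg_def right_diff_distrib sum_subtractf)

lemma wdg_scale: "wdg v (\<lambda>I. c * \<eta> I) J = c * wdg v \<eta> J"
  by (simp add: wdg_def sum_distrib_left ac_simps)

lemma wdg_sum: "wdg v (\<lambda>I. \<Sum>x\<in>X. \<eta> x I) J = (\<Sum>x\<in>X. wdg v (\<eta> x) J)"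
proof -
  have "wdg v (\<lambda>I. \<Sum>x\<in>X. \<eta> x I) J =
      (\<Sum>i\<in>J. \<Sum>x\<in>X. (-1) ^ card {j\<in>J. j < i} * v i * \<eta> x (J - {i}))"
    by (simp add: wdg_def sum_distrib_left)
  also have "\<dots> = (\<Sum>x\<in>X. wdg v (\<eta> x) J)"
    unfolding wdg_def by (rule sum.swap)
  finally show ?thesis .
qed

lemma wdg_sum_left: "wdg (\<lambda>i. \<Sum>x\<in>X. c x * v x i) \<eta> J = (\<Sum>x\<in>X. c x * wdg (v x) \<eta> J)"
proof -
  have "wdg (\<lambda>i. \<Sum>x\<in>X. c x * v x i) \<eta> J =
      (\<Sum>i\<in>J. \<Sum>x\<in>X. c x * ((-1) ^ card {j\<in>J. j < i} * v x i * \<eta> (J - {i})))"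
    by (simp add: wdg_def sum_distrib_left sum_distrib_right ac_simps)
  also have "\<dots> = (\<Sum>x\<in>X. c x * wdg (v x) \<eta> J)"
    unfolding wdg_def sum_distrib_left by (rule sum.swap)
  finally show ?thesis .
qed

lemma wdg_rhom: "rhom h \<Longrightarrow> h (wdg v \<eta> J) = wdg (\<lambda>i. h (v i)) (\<lambda>I. h (\<eta> I)) J"
  by (simp add: wdg_def rhom_sum rhom_mult rhom_power rhom_minus rhom_1)

text \<open>The two orders of removing \<open>i < k\<close> from \<open>J\<close> give the same
  product with opposite signs: once \<open>i\<close> is gone, \<open>k\<close> has one predecessor
  less.\<close>

lemma wdg_wdg: "wdg v (wdg v \<eta>) J = 0"
proof -
  define t where "t = (\<lambda>(i, k). (-1) ^ card {j\<in>J. j < i} * v i *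
    ((-1) ^ card {j\<in>J-{i}. j < k} * v k * \<eta> (J - {i} - {k})))"
  have anti: "t (k, i) = - t (i, k)" if "i \<in> J" "k \<in> J" "i < k" for i k
  proof -
    have 1: "{j\<in>J-{k}. j < i} = {j\<in>J. j < i}" using that by auto
    have "{j\<in>J. j < k} = insert i {j\<in>J-{i}. j < k}" using that by auto
    then have 2: "card {j\<in>J. j < k} = Suc (card {j\<in>J-{i}. j < k})" by simp
    have "J - {i} - {k} = J - {k} - {i}" by auto
    moreover have "(-1 * A) * x * (B * y * z) = - (B * y * (A * x * z))" for A B x y z :: 'a
      by (simp add: ac_simps)
    ultimately show ?thesis unfolding t_def prod.case 1 2 power_Suc by metis
  qed
  let ?A = "{(i, k). i \<in> J \<and> k \<in> J \<and> i < k}"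
  let ?B = "{(i, k). i \<in> J \<and> k \<in> J \<and> k < i}"
  have fin: "finite ?A" "finite ?B"
    by (rule finite_subset[of _ "UNIV"]; simp)+
  have "wdg v (wdg v \<eta>) J = (\<Sum>i\<in>J. \<Sum>k\<in>J-{i}. t (i, k))"
    by (simp add: wdg_def sum_distrib_left t_def)
  also have "\<dots> = sum t (SIGMA i:J. J - {i})"
    by (simp add: sum.Sigma)
  also have "(SIGMA i:J. J - {i}) = ?A \<union> ?B" by auto
  also have "sum t (?A \<union> ?B) = sum t ?A + sum t ?B"
    by (rule sum.union_disjoint) (use fin in auto)
  also have "sum t ?B = (\<Sum>x\<in>?A. t (prod.swap x))"
    by (rule sum.reindex_bij_witness[of _ prod.swap prod.swap]) auto
  also have "\<dots> = (\<Sum>x\<in>?A. - t x)"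
    by (rule sum.cong) (auto simp: anti)
  finally show ?thesis by (simp add: sum_negf)
qed

text \<open>The form \<open>dx\<^sub>K\<close>.\<close>

definition ub :: "'n set \<Rightarrow> 'n set \<Rightarrow> 'r::comm_ring_1"
  where "ub K J = (if J = K then 1 else 0)"

text \<open>The coefficients of the differential of \<open>linear_form a\<close>, by
  \<open>pd_linear_form\<close>.\<close>

definition cv :: "'k::field ^ 'n::{finite,linorder} \<Rightarrow> 'n \<Rightarrow> ('n::{finite,linorder}, 'k) mpoly"
  where "cv a i = cst (a $ i)"

text \<open>For \<open>j \<in> K\<close> this is \<open>\<alpha> \<and> dx\<^bsub>K - {j}\<^esub>\<close>, normalised to have coefficient \<open>1\<close> at \<open>dx\<^sub>K\<close>.\<close>

definition gb :: "'k::field ^ 'n::{finite,linorder} \<Rightarrow> 'n \<Rightarrow> 'n set \<Rightarrow> 'n set \<Rightarrow> ('n::{finite,linorder}, 'k) mpoly"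
  where "gb a j K J = cst (inverse (a $ j)) * (-1) ^ card {l\<in>K. l < j} * wdg (cv a) (ub (K - {j})) J"

text \<open>The set \<open>K - {j}\<close> lacks \<open>j\<close>, so only the removal of
  \<open>j\<close> leads to it from a set containing \<open>j\<close>. Hence \<open>gb a j K\<close>
  is \<open>dx\<^sub>K\<close> plus terms whose index sets avoid \<open>j\<close>.\<close>

lemma gb_on:
  assumes "a $ j \<noteq> 0" "j \<in> K" "j \<in> J"
  shows "gb a j K J = (if J = K then 1 else 0)"
proof -
  have *: "J - {i} = K - {j} \<longleftrightarrow> i = j \<and> J = K" if "i \<in> J" for i
    using assms that by blast
  have "wdg (cv a) (ub (K - {j})) J =
      (\<Sum>i\<in>J. if i = j \<and> J = K then (-1) ^ card {l\<in>J. l < j} * cv a j else 0)"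
    unfolding wdg_def ub_def by (rule sum.cong) (auto simp: * split: if_splits)
  also have "\<dots> = (if J = K then (-1) ^ card {l\<in>K. l < j} * cv a j else 0)"
    using assms by auto
  finally show ?thesis
    using assms by (simp add: gb_def cv_def mult.left_commute mult.assoc flip: power_add power_mult_distrib rhom_mult[OF rhom_cst])
qed

lemma gb_card:
  assumes "j \<in> K" "card J \<noteq> card K"
  shows "gb a j K J = 0"
proof -
  have "J - {i} \<noteq> K - {j}" if "i \<in> J" for i
  proof
    assume "J - {i} = K - {j}"
    then have "card (J - {i}) = card (K - {j})" by simp
    moreover have "card J > 0" "card K > 0" using that assms by (auto simp: card_gt_0_iff)
    ultimately show False using assms that by (simp add: card_Diff_singleton)
  qed
  then show ?thesis by (simp add: gb_def wdg_def ub_def)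
qed

lemma wdg_gb: "wdg (cv a) (gb a j K) J = 0"
  using wdg_wdg[of "cv a" "ub (K - {j})" J] by (simp add: gb_def[abs_def] wdg_scale)

section \<open>The lattice of logarithmic forms\<close>

text \<open>
  The forms \<open>\<eta> = Q \<omega>\<close> of degree \<open>q\<close> with \<open>Q\<close> dividing \<open>dQ \<and> \<eta>\<close>.  The degree is an integer because
  \<open>p\<close>-derivations will be identified with forms of degree \<open>n + 1 - p\<close>, which may be negative.
\<close>

definition idx :: "int \<Rightarrow> 'n::finite set set"
  where "idx q = {I. int (card I) = q}"

definition lattice :: "int \<Rightarrow> ('n::{finite,linorder}, 'k::field) mpoly \<Rightarrow> ('n set \<Rightarrow> ('n, 'k) mpoly) set"
  where "lattice q Q = {\<eta>. (\<forall>I. I \<notin> idx q \<longrightarrow> \<eta> I = 0) \<and> (\<forall>J. Q dvd wdg (\<lambda>i. pd i Q) \<eta> J)}"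

lemma lattice_supp: "\<eta> \<in> lattice q Q \<Longrightarrow> I \<notin> idx q \<Longrightarrow> \<eta> I = 0"
  by (simp add: lattice_def)

lemma lattice_0: "(\<lambda>_. 0) \<in> lattice q Q"
  by (simp add: lattice_def wdg_def)

lemma lattice_add: "\<eta> \<in> lattice q Q \<Longrightarrow> \<zeta> \<in> lattice q Q \<Longrightarrow> (\<lambda>I. \<eta> I + \<zeta> I) \<in> lattice q Q"
  by (simp add: lattice_def wdg_add)

lemma lattice_scale: "\<eta> \<in> lattice q Q \<Longrightarrow> (\<lambda>I. c * \<eta> I) \<in> lattice q Q"
  by (simp add: lattice_def wdg_scale)

text \<open>The rank of the \<open>q\<close>-forms on a hyperplane, which is the number of factors
  that the linear form of the hyperplane contributes to a determinant.\<close>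

definition ee :: "'n::finite itself \<Rightarrow> int \<Rightarrow> nat"
  where "ee _ q = (if q < 0 then 0 else (CARD('n) - 1) choose nat q)"

text \<open>The count is the same for all \<open>j\<close>, so \<open>j\<close> can be chosen for
  each hyperplane separately.\<close>

lemma card_idx_notin: "card {I \<in> idx q. (j::'n::finite) \<notin> I} = ee TYPE('n) q"
proof (cases "q < 0")
  case False
  then have "{I \<in> idx q. j \<notin> I} = {I. I \<subseteq> UNIV - {j} \<and> card I = nat q}"
    by (auto simp: idx_def)
  then show ?thesis using False
    by (simp add: ee_def n_subsets card_Diff_singleton)
qed (auto simp: ee_def idx_def)

lemma ee_le: "ee TYPE('n::finite) q \<le> card (idx q :: 'n set set)"
  by (subst card_idx_notin[of q undefined, symmetric]) (rule card_mono, auto)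

text \<open>The identity block only serves to have a square matrix indexed by a type.\<close>

definition pdm :: "int \<Rightarrow> ('n set \<Rightarrow> 'n set \<Rightarrow> 'r) \<Rightarrow> 'r::comm_ring_1 ^ ('n::finite set) ^ ('n set)"
  where "pdm q \<theta> = (\<chi> I J. if I \<in> idx q then \<theta> I J else if I = J then 1 else 0)"

lemma pdm_cong: "(\<And>I. I \<in> idx q \<Longrightarrow> \<theta> I = \<theta>' I) \<Longrightarrow> pdm q \<theta> = pdm q \<theta>'"
  by (simp add: pdm_def vec_eq_iff)

lemma det_mult_rows_pdm:
  "det (pdm q (\<lambda>I J. c I * \<theta> I J)) = (\<Prod>I\<in>idx q. c I) * det (pdm q \<theta>)"
proof -
  have "pdm q (\<lambda>I J. c I * \<theta> I J) = (\<chi> I. (if I \<in> idx q then c I else 1) *s (pdm q \<theta> $ I))"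
    by (simp add: pdm_def vec_eq_iff)
  then have "det (pdm q (\<lambda>I J. c I * \<theta> I J)) = (\<Prod>I\<in>UNIV. if I \<in> idx q then c I else 1) * det (pdm q \<theta>)"
    by (simp add: det_rows_mul)
  also have "(\<Prod>I\<in>UNIV. if I \<in> idx q then c I else 1) = (\<Prod>I\<in>idx q. c I)"
    by (simp add: prod.If_cases)
  finally show ?thesis .
qed

lemma rhom_det_pdm: "rhom h \<Longrightarrow> h (det (pdm q \<theta>)) = det (pdm q (\<lambda>I J. h (\<theta> I J)))"
  by (simp add: rhom_det pdm_def if_distrib[of h] rhom_0 rhom_1 cong: if_cong)

text \<open>The base change adapted to the hyperplane: the forms \<open>gb a j K\<close>, killed by
  exterior multiplication with the covector, and the \<open>dx\<^sub>K\<close> without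
  \<open>dx\<^sub>j\<close>, which restrict to a basis of the forms on the hyperplane.\<close>

definition gmat :: "int \<Rightarrow> 'k::field ^ 'n::{finite,linorder} \<Rightarrow> 'n \<Rightarrow> ('n::{finite,linorder}, 'k) mpoly ^ ('n set) ^ ('n set)"
  where "gmat q a j = (\<chi> K J. if K \<in> idx q \<and> j \<in> K then gb a j K J else if K = J then 1 else 0)"

text \<open>The matrix is \<open>1 + N\<close> with \<open>N\<^sup>2 = 0\<close>.\<close>

lemma det_gmat_unit:
  assumes "a $ j \<noteq> 0"
  shows "det (gmat q a j) dvd 1"
proof -
  \<comment> \<open>The inverse \<open>1 - N\<close>, written as \<open>2 - (1 + N)\<close> in the
    rows where \<open>N\<close> can be nonzero.\<close>
  define G' where "G' = (\<chi> K J. if K \<in> idx q \<and> j \<in> K then (if K = J then 2 else 0) - gb a j K J else if K = J then 1 else 0)"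
  have "gmat q a j ** G' = mat 1"
  proof (simp add: vec_eq_iff, intro allI)
    fix K J
    have "(gmat q a j ** G') $ K $ J = (\<Sum>M\<in>UNIV. gmat q a j $ K $ M * G' $ M $ J)"
      by (simp add: matrix_matrix_mult_def)
    also have "\<dots> = mat 1 $ K $ J"
    proof (cases "K \<in> idx q \<and> j \<in> K")
      case False
      then have "(\<Sum>M\<in>UNIV. gmat q a j $ K $ M * G' $ M $ J) = G' $ K $ J"
      proof -
        have "(\<Sum>M\<in>UNIV. gmat q a j $ K $ M * G' $ M $ J) = (\<Sum>M\<in>UNIV. if K = M then G' $ K $ J else 0)"
          by (rule sum.cong) (use False in \<open>auto simp: gmat_def\<close>)
        then show ?thesis by simp
      qed
      then show ?thesis using False by (auto simp: G'_def mat_def)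
    next
      case True
      have "(\<Sum>M\<in>UNIV. gmat q a j $ K $ M * G' $ M $ J) =
          (\<Sum>M\<in>UNIV. (if M = K then G' $ K $ J else 0) +
            (if M = J then (if j \<in> J then 0 else gb a j K J) else 0))"
      proof (rule sum.cong)
        fix M
        show "gmat q a j $ K $ M * G' $ M $ J = (if M = K then G' $ K $ J else 0) +
            (if M = J then (if j \<in> J then 0 else gb a j K J) else 0)"
        proof (cases "j \<in> M")
          case j: True
          then have "gmat q a j $ K $ M = (if M = K then 1 else 0)"
            using True gb_on[OF assms, of K M] by (simp add: gmat_def)
          then show ?thesis using j by auto
        next
          case j: False
          then have "G' $ M $ J = (if M = J then 1 else 0)" by (simp add: G'_def)
          then show ?thesis using j True by (auto simp: gmat_def)
        qed
      qed simp
      also have "\<dots> = G' $ K $ J + (if j \<in> J then 0 else gb a j K J)"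
        by (simp add: sum.distrib)
      also have "\<dots> = mat 1 $ K $ J"
        using True gb_on[OF assms, of K J] by (auto simp: G'_def mat_def)
      finally show ?thesis .
    qed
    finally show "(gmat q a j ** G') $ K $ J = mat 1 $ K $ J" .
  qed
  then have "det (gmat q a j) * det G' = 1"
    by (metis det_mul det_I)
  then show ?thesis by (metis dvd_triv_left)
qed

text \<open>The forms are to be pairwise non-associated primes; non-proportionality of the normal
  vectors is expressed through divisibility because it is used in this shape.\<close>

locale arr =
  fixes a :: "'h \<Rightarrow> 'k::field ^ 'n::{finite,linorder}" and B :: "'h set"
  assumes finB: "finite B"
    and nz: "h \<in> B \<Longrightarrow> a h \<noteq> 0"
    and np: "h \<in> B \<Longrightarrow> h' \<in> B \<Longrightarrow> h \<noteq> h' \<Longrightarrow> \<not> linear_form (a h) dvd linear_form (a h')"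
begin

abbreviation lf :: "'h \<Rightarrow> ('n, 'k) mpoly"
  where "lf h \<equiv> linear_form (a h)"

definition Q :: "('n, 'k) mpoly"
  where "Q = (\<Prod>h\<in>B. lf h)"

lemma prime_lf: "h \<in> B \<Longrightarrow> prime_elem (lf h)"
  by (simp add: nz prime_linear_form)

lemma Q_nonzero: "Q \<noteq> 0"
  by (simp add: Q_def finB nz)

definition R :: "'h \<Rightarrow> ('n, 'k) mpoly"
  where "R h = (\<Prod>h'\<in>B-{h}. lf h')"

lemma Q_R: "h \<in> B \<Longrightarrow> Q = lf h * R h"
  by (simp add: Q_def R_def prod.remove finB)

lemma not_dvd_R:
  assumes "h \<in> B"
  shows "\<not> lf h dvd R h"
proof
  assume "lf h dvd R h"
  then obtain h' where "h' \<in> B - {h}" "lf h dvd lf h'"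
    unfolding R_def using prime_elem_dvd_prodD[OF prime_lf[OF assms]] finB by (metis finite_Diff)
  then show False using np[of h h'] assms by auto
qed

lemma dvd_R: "h \<in> B \<Longrightarrow> h \<noteq> h' \<Longrightarrow> lf h dvd R h'"
  unfolding R_def by (rule dvd_prodI) (use finB in auto)

lemma wdg_pd_Q: "wdg (\<lambda>i. pd i Q) \<eta> J = (\<Sum>h\<in>B. R h * wdg (cv (a h)) \<eta> J)"
  unfolding wdg_sum_left[symmetric]
  by (simp add: Q_def pd_prod finB pd_linear_form R_def cv_def mult.commute)

text \<open>The gradient of \<open>Q\<close> is the sum of the covectors of all \<open>h\<close>
  with factors \<open>R h\<close>, and \<open>lf h\<close> divides each \<open>R h'\<close> with
  \<open>h'\<close> different from \<open>h\<close>, but not \<open>R h\<close>. So the condition on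
  \<open>Q\<close> splits into one condition for each hyperplane.\<close>

lemma lattice_iff:
  "\<eta> \<in> lattice q Q \<longleftrightarrow>
    (\<forall>I. I \<notin> idx q \<longrightarrow> \<eta> I = 0) \<and> (\<forall>h\<in>B. \<forall>J. lf h dvd wdg (cv (a h)) \<eta> J)"
proof -
  have "Q dvd wdg (\<lambda>i. pd i Q) \<eta> J \<longleftrightarrow> (\<forall>h\<in>B. lf h dvd wdg (cv (a h)) \<eta> J)" for J
  proof
    assume "\<forall>h\<in>B. lf h dvd wdg (cv (a h)) \<eta> J"
    show "Q dvd wdg (\<lambda>i. pd i Q) \<eta> J"
      unfolding wdg_pd_Q
    proof (rule dvd_sum)
      fix h assume "h \<in> B"
      with \<open>\<forall>h\<in>B. lf h dvd wdg (cv (a h)) \<eta> J\<close> show "Q dvd R h * wdg (cv (a h)) \<eta> J"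
        unfolding Q_R[OF \<open>h \<in> B\<close>] mult.commute[of "lf h"] by (intro mult_dvd_mono) auto
    qed
  next
    assume Q: "Q dvd wdg (\<lambda>i. pd i Q) \<eta> J"
    show "\<forall>h\<in>B. lf h dvd wdg (cv (a h)) \<eta> J"
    proof
      fix h assume h: "h \<in> B"
      have "lf h dvd (\<Sum>h\<in>B. R h * wdg (cv (a h)) \<eta> J)"
        using Q Q_R[OF h] unfolding wdg_pd_Q[symmetric] by (intro dvd_trans[OF _ Q]) simp
      moreover have "(\<Sum>h\<in>B. R h * wdg (cv (a h)) \<eta> J) = R h * wdg (cv (a h)) \<eta> J +
          (\<Sum>h'\<in>B-{h}. R h' * wdg (cv (a h')) \<eta> J)"
        using h finB by (simp add: sum.remove)
      moreover have "lf h dvd (\<Sum>h'\<in>B-{h}. R h' * wdg (cv (a h')) \<eta> J)"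
        using h by (intro dvd_sum dvd_mult2 dvd_R) auto
      ultimately have "lf h dvd R h * wdg (cv (a h)) \<eta> J"
        by (simp add: dvd_add_left_iff)
      then show "lf h dvd wdg (cv (a h)) \<eta> J"
        using prime_lf[OF h] not_dvd_R[OF h] by (auto simp: prime_elem_def)
    qed
  qed
  then show ?thesis by (auto simp: lattice_def)
qed

text \<open>The shape in which explicit elements arise: at each hyperplane the condition is met
  either by the scalar \<open>c\<close> or by the form itself.\<close>

lemma Q_scale_in_lattice:
  assumes "\<And>I. I \<notin> idx q \<Longrightarrow> \<eta> I = 0" "\<And>h. h \<in> B \<Longrightarrow> lf h dvd c \<or> (\<forall>J. wdg (cv (a h)) \<eta> J = 0)"
  shows "(\<lambda>I. c * \<eta> I) \<in> lattice q Q"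
  using assms unfolding lattice_iff wdg_scale by fastforce

text \<open>In the basis of \<open>gmat\<close>, the coordinates of a lattice element along the
  \<open>dx\<^sub>K\<close> without \<open>dx\<^sub>j\<close> are divisible by \<open>lf h\<close>.
  The matrix \<open>X\<close> of coordinates has \<open>ee\<close> such columns, and its determinant
  is a factor of the given one.\<close>

lemma lf_power_dvd_det:
  assumes h: "h \<in> B" and \<theta>: "\<And>I. I \<in> idx q \<Longrightarrow> \<theta> I \<in> lattice q Q"
  shows "lf h ^ ee TYPE('n) q dvd det (pdm q \<theta>)"
proof -
  obtain j where j: "a h $ j \<noteq> 0" using nz[OF h] by (auto simp: vec_eq_iff)
  define T where "T = {K \<in> idx q. j \<in> K}"
  \<comment> \<open>What remains after the part along the \<open>gb\<close> is split off; it has no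
    terms with \<open>j\<close>.\<close>
  define rest where "rest = (\<lambda>I K. \<theta> I K - (\<Sum>K'\<in>T. \<theta> I K' * gb (a h) j K' K))"
  define X where "X = (\<chi> I K. if I \<in> idx q then (if K \<in> T then \<theta> I K else rest I K) else if I = K then 1 else 0)"
  have supp: "\<theta> I K = 0" if "I \<in> idx q" "K \<notin> idx q" for I K
    using lattice_supp[OF \<theta>[OF that(1)] that(2)] .
  have gbT: "gb (a h) j K' K = (if K = K' then 1 else 0)" if "K' \<in> T" "j \<in> K" for K K'
    using gb_on[OF j] that by (auto simp: T_def)
  have sumT: "(\<Sum>K'\<in>T. f K' * gb (a h) j K' K) = f K" if "K \<in> T" for f K
  proof -
    have "(\<Sum>K'\<in>T. f K' * gb (a h) j K' K) = (\<Sum>K'\<in>T. if K = K' then f K' else 0)"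
      by (rule sum.cong) (use that in \<open>auto simp: gbT T_def\<close>)
    also have "\<dots> = f K" using that by simp
    finally show ?thesis .
  qed
  have restT: "rest I K = 0" if "I \<in> idx q" "j \<in> K" for I K
  proof (cases "K \<in> idx q")
    case True
    then show ?thesis using sumT[of K "\<theta> I"] that by (simp add: rest_def T_def)
  next
    case False
    have "gb (a h) j K' K = 0" if "K' \<in> T" for K'
      using gb_card[of j K' K] that False by (auto simp: T_def idx_def)
    then show ?thesis using supp that False by (simp add: rest_def)
  qed
  have XG: "pdm q \<theta> = X ** gmat q (a h) j"
  proof (simp add: vec_eq_iff, intro allI)
    fix I J
    have split: "(\<Sum>K\<in>UNIV. x K * gmat q (a h) j $ K $ J) =
        (\<Sum>K\<in>T. x K * gb (a h) j K J) + (if J \<in> T then 0 else x J)" for x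
    proof -
      have "(\<Sum>K\<in>UNIV. x K * gmat q (a h) j $ K $ J) =
          (\<Sum>K\<in>UNIV. if K \<in> T then x K * gb (a h) j K J else 0) + 
          (\<Sum>K\<in>UNIV. if J = K then (if J \<in> T then 0 else x J) else 0)"
        unfolding sum.distrib[symmetric] by (rule sum.cong) (auto simp: gmat_def T_def)
      then show ?thesis by (simp add: sum.If_cases)
    qed
    have "(X ** gmat q (a h) j) $ I $ J = (\<Sum>K\<in>T. X $ I $ K * gb (a h) j K J) + (if J \<in> T then 0 else X $ I $ J)"
      by (simp add: matrix_matrix_mult_def split)
    also have "\<dots> = pdm q \<theta> $ I $ J"
    proof (cases "I \<in> idx q")
      case True
      then have "(\<Sum>K\<in>T. X $ I $ K * gb (a h) j K J) = (\<Sum>K\<in>T. \<theta> I K * gb (a h) j K J)"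
        by (intro sum.cong) (auto simp: X_def)
      then show ?thesis using True sumT[of J "\<theta> I"] by (simp add: X_def pdm_def rest_def)
    next
      case False
      then have "(\<Sum>K\<in>T. X $ I $ K * gb (a h) j K J) = 0"
        by (intro sum.neutral) (auto simp: X_def T_def)
      then show ?thesis using False by (auto simp: X_def pdm_def T_def)
    qed
    finally show "pdm q \<theta> $ I $ J = (X ** gmat q (a h) j) $ I $ J" by simp
  qed
  define E where "E = {K \<in> idx q. j \<notin> K}"
  have dvdE: "lf h dvd X $ I $ K" if K: "K \<in> E" for I K
  proof (cases "I \<in> idx q")
    case True
    have jK: "j \<notin> K" using K by (simp add: E_def)
    have w: "wdg (cv (a h)) (rest I) J = wdg (cv (a h)) (\<theta> I) J" for J
      by (simp add: rest_def[abs_def] wdg_diff wdg_sum wdg_scale wdg_gb)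
    \<comment> \<open>Only the removal of \<open>j\<close> from \<open>insert j K\<close> leaves an
      index set on which \<open>rest I\<close> can be nonzero, so \<open>rest I K\<close> is
      isolated up to a unit.\<close>
    have "wdg (cv (a h)) (rest I) (insert j K) =
        (\<Sum>i\<in>insert j K. if i = j then (-1) ^ card {l\<in>insert j K. l < j} * cv (a h) j * rest I K else 0)"
      unfolding wdg_def
      by (rule sum.cong) (use jK restT[OF True] in \<open>auto simp: insert_Diff_if\<close>)
    then have "wdg (cv (a h)) (rest I) (insert j K) = (-1) ^ card {l\<in>insert j K. l < j} * cv (a h) j * rest I K"
      by simp
    moreover have "lf h dvd wdg (cv (a h)) (rest I) (insert j K)"
      using \<theta>[OF True] h unfolding w lattice_iff by blast
    ultimately have "lf h dvd ((-1) ^ card {l\<in>insert j K. l < j} * cv (a h) j) * rest I K"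
      by simp
    then have "lf h dvd cst (inverse (a h $ j)) * (-1) ^ card {l\<in>insert j K. l < j} *
       (((-1) ^ card {l\<in>insert j K. l < j} * cv (a h) j) * rest I K)"
      by (rule dvd_mult)
    also have "\<dots> = (cst (inverse (a h $ j)) * cst (a h $ j)) * (((-1) ^ card {l\<in>insert j K. l < j} * (-1) ^ card {l\<in>insert j K. l < j})) * rest I K"
      by (simp add: cv_def ac_simps)
    also have "\<dots> = rest I K"
      using j by (simp flip: rhom_mult[OF rhom_cst] power_mult_distrib)
    finally show ?thesis using True K by (simp add: X_def E_def T_def)
  next
    case False
    then show ?thesis using K by (auto simp: X_def E_def)
  qed
  \<comment> \<open>The transpose of \<open>X\<close> with the factor \<open>lf h\<close> cancelled
    in the columns \<open>E\<close>; transposing turns these into rows, as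
    \<open>det_rows_mul\<close> expects.\<close>
  define Y where "Y = (\<chi> K I. if K \<in> E then (SOME y. X $ I $ K = lf h * y) else X $ I $ K)"
  have "transpose X = (\<chi> K. (if K \<in> E then lf h else 1) *s (Y $ K))"
  proof -
    have "X $ I $ K = lf h * (SOME y. X $ I $ K = lf h * y)" if "K \<in> E" for I K
      using dvdE[OF that, of I] by (metis (mono_tags, lifting) dvd_def someI_ex)
    then show ?thesis by (auto simp: vec_eq_iff transpose_def Y_def)
  qed
  then have "det (transpose X) = (\<Prod>K\<in>UNIV. if K \<in> E then lf h else 1) * det (\<chi> K. Y $ K)"
    by (simp only: det_rows_mul)
  then have "det X = (\<Prod>K\<in>UNIV. if K \<in> E then lf h else 1) * det (\<chi> K. Y $ K)"
    by simp
  also have "(\<Prod>K\<in>UNIV. if K \<in> E then lf h else 1) = lf h ^ ee TYPE('n) q"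
    using card_idx_notin[where q=q and j=j] by (simp add: prod.If_cases E_def)
  finally show ?thesis
    unfolding XG det_mul by simp
qed

lemma dvd_det:
  assumes \<theta>: "\<And>I. I \<in> idx q \<Longrightarrow> \<theta> I \<in> lattice q Q"
  shows "Q ^ ee TYPE('n) q dvd det (pdm q \<theta>)"
proof -
  let ?e = "ee TYPE('n) q"
  have "(\<Prod>h\<in>F. lf h) ^ ?e dvd det (pdm q \<theta>)" if "finite F" "F \<subseteq> B" for F
    using that
  proof (induction F rule: finite_induct)
    case (insert h F)
    obtain z where z: "det (pdm q \<theta>) = (\<Prod>h\<in>F. lf h) ^ ?e * z"
      using insert by (auto simp: dvd_def)
    have "\<not> lf h dvd (\<Prod>h\<in>F. lf h) ^ ?e"
    proof
      assume "lf h dvd (\<Prod>h\<in>F. lf h) ^ ?e"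
      then have "lf h dvd (\<Prod>h\<in>F. lf h)"
        using insert prime_lf[of h] by (metis insert_subset prime_elem_dvd_power)
      then obtain h' where "h' \<in> F" "lf h dvd lf h'"
        using prime_elem_dvd_prodD[OF prime_lf[of h] insert(1)] insert by auto
      then show False using np[of h h'] insert by auto
    qed
    moreover have "lf h ^ ?e dvd det (pdm q \<theta>)"
      by (rule lf_power_dvd_det) (use insert.prems \<theta> in auto)
    ultimately have "lf h ^ ?e dvd z"
      using prime_elem_power_dvd_cancel[OF prime_lf[of h], of ?e "(\<Prod>h\<in>F. lf h) ^ ?e" z]
        insert.prems z by simp
    then show ?case using insert z by (simp add: power_mult_distrib mult.commute mult_dvd_mono)
  qed simp
  then show ?thesis unfolding Q_def using finB by blast
qed

end

section \<open>Saito's criterion\<close>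

lemma rhom_to_frac: "rhom to_frac"
  by (rule rhomI) (simp_all add: to_frac_hom)

lemma to_frac_eq_iff [simp]: "to_frac f = to_frac g \<longleftrightarrow> f = g"
  by (simp add: to_frac_def eq_fract)

lemma to_frac_0 [simp]: "to_frac 0 = 0"
  by (simp add: rhom_0 rhom_to_frac)

lemma to_frac_eq_0_iff [simp]: "to_frac f = 0 \<longleftrightarrow> f = 0"
  using to_frac_eq_iff[of f 0] by simp

lemma det_pdm_row_indep_field:
  fixes \<theta> :: "'n::finite set \<Rightarrow> 'n set \<Rightarrow> 'f::field"
  assumes det: "det (pdm q \<theta>) \<noteq> 0" and z: "\<And>J. (\<Sum>I\<in>idx q. c I * \<theta> I J) = 0" and I: "I \<in> idx q"
  shows "c I = 0"
proof -
  obtain A' where A': "pdm q \<theta> ** A' = mat 1"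
    using det by (metis invertible_def invertible_det_nz)
  define c' where "c' = (\<lambda>I. if I \<in> idx q then c I else 0)"
  have *: "(\<Sum>I\<in>UNIV. c' I * pdm q \<theta> $ I $ J) = 0" for J
  proof -
    have "(\<Sum>I\<in>UNIV. c' I * pdm q \<theta> $ I $ J) = (\<Sum>I\<in>idx q. c I * \<theta> I J)"
      by (rule sum.mono_neutral_cong_right) (auto simp: c'_def pdm_def)
    then show ?thesis using z by simp
  qed
  have "c' I = (\<Sum>K\<in>UNIV. c' K * (pdm q \<theta> ** A') $ K $ I)"
    unfolding A' by (simp add: mat_def if_distrib[of "\<lambda>x. _ * x"] cong: if_cong)
  also have "\<dots> = (\<Sum>K\<in>UNIV. \<Sum>J\<in>UNIV. c' K * pdm q \<theta> $ K $ J * A' $ J $ I)"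
    by (simp add: matrix_matrix_mult_def sum_distrib_left mult.assoc)
  also have "\<dots> = (\<Sum>J\<in>UNIV. (\<Sum>K\<in>UNIV. c' K * pdm q \<theta> $ K $ J) * A' $ J $ I)"
    by (subst sum.swap) (simp add: sum_distrib_right)
  finally show ?thesis using * I by (simp add: c'_def)
qed

lemma det_pdm_row_indep:
  fixes \<theta> :: "'n::{finite,linorder} set \<Rightarrow> 'n set \<Rightarrow> ('n, 'k::field) mpoly"
  assumes det: "det (pdm q \<theta>) \<noteq> 0" and z: "\<And>J. (\<Sum>I\<in>idx q. c I * to_frac (\<theta> I J)) = 0" and I: "I \<in> idx q"
  shows "c I = 0"
proof -
  have "det (pdm q (\<lambda>I J. to_frac (\<theta> I J))) \<noteq> 0"
    using det by (simp flip: rhom_det_pdm[OF rhom_to_frac])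
  then show ?thesis using det_pdm_row_indep_field z I by blast
qed

lemma det_pdm_row_indep_S:
  fixes \<theta> :: "'n::{finite,linorder} set \<Rightarrow> 'n set \<Rightarrow> ('n, 'k::field) mpoly"
  assumes det: "det (pdm q \<theta>) \<noteq> 0" and z: "\<And>J. (\<Sum>I\<in>idx q. c I * \<theta> I J) = 0" and I: "I \<in> idx q"
  shows "c I = 0"
proof -
  have "to_frac (c I) = 0"
  proof (rule det_pdm_row_indep[OF det _ I])
    fix J
    show "(\<Sum>I\<in>idx q. to_frac (c I) * to_frac (\<theta> I J)) = 0"
      using z[of J] by (simp flip: rhom_mult[OF rhom_to_frac] rhom_sum[OF rhom_to_frac])
  qed
  then show ?thesis by simp
qed

text \<open>The hypothesis keeps the identity block of the second factor out of the rows in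
  \<open>idx q\<close>.\<close>

lemma pdm_mult:
  assumes "\<And>I K. I \<in> idx q \<Longrightarrow> K \<notin> idx q \<Longrightarrow> c I K = 0"
  shows "pdm q c ** pdm q \<theta> = pdm q (\<lambda>I J. \<Sum>K\<in>idx q. c I K * \<theta> K J)"
proof -
  have "(pdm q c ** pdm q \<theta>) $ I $ J = pdm q (\<lambda>I J. \<Sum>K\<in>idx q. c I K * \<theta> K J) $ I $ J" for I J
  proof (cases "I \<in> idx q")
    case True
    have "(pdm q c ** pdm q \<theta>) $ I $ J = (\<Sum>K\<in>UNIV. c I K * pdm q \<theta> $ K $ J)"
      using True by (simp add: matrix_matrix_mult_def pdm_def)
    also have "\<dots> = (\<Sum>K\<in>idx q. c I K * \<theta> K J)"
      by (rule sum.mono_neutral_cong_right) (auto simp: pdm_def assms True)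
    finally show ?thesis using True by (simp add: pdm_def)
  next
    case False
    have "(pdm q c ** pdm q \<theta>) $ I $ J = (\<Sum>K\<in>UNIV. if I = K then pdm q \<theta> $ I $ J else 0)"
      unfolding matrix_matrix_mult_def vec_lambda_beta
      by (rule sum.cong) (use False in \<open>auto simp: pdm_def\<close>)
    then show ?thesis using False by (simp add: pdm_def)
  qed
  then show ?thesis by (simp add: vec_eq_iff)
qed

text \<open>Saturation means that \<open>T\<close> contains the divisors of its elements, so an
  element is shown to lie in \<open>T\<close> by exhibiting a multiple in \<open>T\<close>. Besides
  the units and the complements of primes, the set of nonzero elements occurs, for clearing
  denominators.\<close>

definition satur :: "('n::{finite,linorder}, 'k::field) mpoly set \<Rightarrow> bool"
  where "satur T \<longleftrightarrow> 1 \<in> T \<and> 0 \<notin> T \<and> (\<forall>x y. x * y \<in> T \<longleftrightarrow> x \<in> T \<and> y \<in> T)"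

lemma unit_mult_iff: "x * y dvd (1::'a::comm_semiring_1) \<longleftrightarrow> x dvd 1 \<and> y dvd 1"
  using mult_dvd_mono[of x 1 y 1] by (auto dest: dvd_mult_left dvd_mult_right)

lemma satur_units: "satur {t. t dvd 1}"
  by (simp add: satur_def unit_mult_iff)

lemma satur_power: "satur T \<Longrightarrow> x \<in> T \<Longrightarrow> x ^ n \<in> T"
  by (induction n) (simp_all add: satur_def)

lemma satur_prod: "satur T \<Longrightarrow> (\<And>x. x \<in> X \<Longrightarrow> f x \<in> T) \<Longrightarrow> prod f X \<in> T"
  by (induction X rule: infinite_finite_induct) (simp_all add: satur_def)

text \<open>By Saito's criterion: the localisation of the lattice at the multiplicative set \<open>T\<close> has a basis.\<close>

definition good :: "('n::{finite,linorder}, 'k::field) mpoly set \<Rightarrow> int \<Rightarrow> ('n, 'k) mpoly \<Rightarrow> bool"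
  where "good T q Q \<longleftrightarrow> (\<exists>\<theta>. (\<forall>I\<in>idx q. \<theta> I \<in> lattice q Q) \<and>
    (\<exists>t\<in>T. det (pdm q \<theta>) = Q ^ ee TYPE('n) q * t))"

context arr
begin

text \<open>Replacing a row by \<open>\<eta>\<close> gives another tuple from the lattice, whose
  determinant is again divisible by the power of \<open>Q\<close>. By Cramer's rule the quotient is
  \<open>t\<close> times the coefficient of \<open>\<eta>\<close> at this row, which therefore lies
  in \<open>S\<close>.\<close>

lemma cramer_lattice:
  assumes \<theta>: "\<And>I. I \<in> idx q \<Longrightarrow> \<theta> I \<in> lattice q Q"
    and det: "det (pdm q \<theta>) = Q ^ ee TYPE('n) q * t" and t: "t \<noteq> 0" and \<eta>: "\<eta> \<in> lattice q Q"
  obtains c where "\<And>J. t * \<eta> J = (\<Sum>I\<in>idx q. c I * \<theta> I J)"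
proof -
  let ?A = "pdm q (\<lambda>I J. to_frac (\<theta> I J))"
  have detA: "det ?A = to_frac (Q ^ ee TYPE('n) q * t)"
    by (simp add: det flip: rhom_det_pdm[OF rhom_to_frac])
  then have "det ?A \<noteq> 0" using t Q_nonzero by simp
  then obtain A' where A': "A' ** ?A = mat 1"
    by (metis invertible_def invertible_det_nz)
  define e where "e = (\<chi> J. to_frac (\<eta> J))"
  define x where "x = (\<chi> i. \<Sum>k\<in>UNIV. e $ k * A' $ k $ i)"
  have xA: "(\<Sum>i\<in>UNIV. x $ i *s row i ?A) = e"
  proof (simp add: vec_eq_iff, intro allI)
    fix J
    have "(\<Sum>i\<in>UNIV. x $ i * row i ?A $ J) = (\<Sum>i\<in>UNIV. \<Sum>k\<in>UNIV. e $ k * (A' $ k $ i * ?A $ i $ J))"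
      by (simp add: x_def row_def sum_distrib_right mult.assoc)
    also have "\<dots> = (\<Sum>k\<in>UNIV. e $ k * (A' ** ?A) $ k $ J)"
      by (subst sum.swap) (simp add: matrix_matrix_mult_def sum_distrib_left)
    also have "\<dots> = e $ J"
      unfolding A' by (simp add: mat_def if_distrib[of "\<lambda>x. _ * x"] cong: if_cong)
    finally show "(\<Sum>i\<in>UNIV. x $ i * row i ?A $ J) = e $ J" .
  qed
  have "\<exists>s. to_frac t * x $ k = to_frac s" if k: "k \<in> idx q" for k
  proof -
    have "(\<chi> i. if i = k then (\<Sum>i\<in>UNIV. x $ i *s row i ?A) else row i ?A) =
        pdm q (\<lambda>I J. to_frac ((\<theta>(k := \<eta>)) I J))"
      unfolding xA using k by (simp add: vec_eq_iff e_def row_def pdm_def)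
    then have "x $ k * det ?A = to_frac (det (pdm q (\<theta>(k := \<eta>))))"
      using cramer_lemma_transpose[of k x ?A] by (simp add: rhom_det_pdm[OF rhom_to_frac])
    moreover have "Q ^ ee TYPE('n) q dvd det (pdm q (\<theta>(k := \<eta>)))"
      by (rule dvd_det) (auto simp: \<theta> \<eta>)
    then obtain s where "det (pdm q (\<theta>(k := \<eta>))) = Q ^ ee TYPE('n) q * s" by auto
    ultimately have "to_frac (Q ^ ee TYPE('n) q) * (to_frac t * x $ k) = to_frac (Q ^ ee TYPE('n) q) * to_frac s"
      by (simp add: detA rhom_mult[OF rhom_to_frac] ac_simps)
    then show ?thesis using Q_nonzero by auto
  qed
  then obtain s where s: "\<And>k. k \<in> idx q \<Longrightarrow> to_frac t * x $ k = to_frac (s k)" by metis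
  have "t * \<eta> J = (\<Sum>I\<in>idx q. s I * \<theta> I J)" for J
  proof (cases "J \<in> idx q")
    case False
    have "\<theta> I J = 0" if "I \<in> idx q" for I using lattice_supp[OF \<theta>[OF that] False] .
    then show ?thesis using lattice_supp[OF \<eta> False] by simp
  next
    case True
    have "to_frac (t * \<eta> J) = to_frac t * (\<Sum>i\<in>UNIV. x $ i * ?A $ i $ J)"
      using xA by (simp add: vec_eq_iff e_def row_def rhom_mult[OF rhom_to_frac])
    also have "(\<Sum>i\<in>UNIV. x $ i * ?A $ i $ J) = (\<Sum>i\<in>idx q. x $ i * to_frac (\<theta> i J))"
      by (rule sum.mono_neutral_cong_right) (use True in \<open>auto simp: pdm_def\<close>)
    also have "to_frac t * \<dots> = (\<Sum>i\<in>idx q. to_frac (s i) * to_frac (\<theta> i J))"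
      unfolding sum_distrib_left by (rule sum.cong) (simp_all add: s flip: mult.assoc)
    also have "\<dots> = to_frac (\<Sum>I\<in>idx q. s I * \<theta> I J)"
      by (simp add: rhom_sum[OF rhom_to_frac] rhom_mult[OF rhom_to_frac])
    finally show ?thesis by simp
  qed
  then show ?thesis by (rule that)
qed

lemma Q_ub_in_lattice: "I \<in> idx q \<Longrightarrow> (\<lambda>J. Q * ub I J) \<in> lattice q Q"
  by (rule Q_scale_in_lattice) (auto simp: ub_def Q_R)

lemma det_pdm_ub: "det (pdm q (\<lambda>I J :: 'n set. c * ub I J)) = (c :: ('n, 'k) mpoly) ^ card (idx q :: 'n set set)"
proof -
  have "pdm q ub = (mat 1 :: ('n, 'k) mpoly ^ ('n set) ^ ('n set))"
    by (simp add: pdm_def vec_eq_iff mat_def ub_def)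
  then show ?thesis by (simp add: det_mult_rows_pdm)
qed

text \<open>The forms \<open>gb\<close> and \<open>lf h\<close> times the remaining
  \<open>dx\<^sub>I\<close> are a basis for the hyperplane \<open>h\<close> alone; the factor
  \<open>R h\<close> enforces the conditions at the others. Apart from the power with exponent
  \<open>ee\<close>, the determinant is prime to \<open>lf h\<close>.\<close>

lemma standard_tuple:
  assumes h: "h \<in> B"
  obtains \<zeta> u where "\<And>I. I \<in> idx q \<Longrightarrow> \<zeta> I \<in> lattice q Q" "u dvd 1"
    "det (pdm q \<zeta>) = R h ^ card (idx q :: 'n set set) * lf h ^ ee TYPE('n) q * u"
proof -
  obtain j where j: "a h $ j \<noteq> 0" using nz[OF h] by (auto simp: vec_eq_iff)
  let ?c = "\<lambda>I :: 'n set. R h * (if j \<in> I then 1 else lf h)"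
  let ?b = "\<lambda>I J :: 'n set. gmat q (a h) j $ I $ J"
  have "(\<lambda>J. ?c I * ?b I J) \<in> lattice q Q" if I: "I \<in> idx q" for I
  proof (rule Q_scale_in_lattice)
    fix J :: "'n set" assume "J \<notin> idx q"
    then show "?b I J = 0"
      using I gb_card[of j I J] by (auto simp: gmat_def idx_def)
  next
    fix h' assume h': "h' \<in> B"
    show "lf h' dvd ?c I \<or> (\<forall>J. wdg (cv (a h')) (?b I) J = 0)"
    proof (cases "h' = h \<and> j \<in> I")
      case True
      then have "?b I = gb (a h) j I" using I by (simp add: gmat_def fun_eq_iff)
      then show ?thesis using True by (simp add: wdg_gb)
    next
      case False
      then show ?thesis using dvd_R[OF h', of h] by (cases "h' = h") auto
    qed
  qed
  moreover have "det (pdm q (\<lambda>I J. ?c I * ?b I J)) =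
      R h ^ card (idx q :: 'n set set) * lf h ^ ee TYPE('n) q * det (gmat q (a h) j)"
  proof -
    have "pdm q ?b = gmat q (a h) j" by (auto simp: pdm_def gmat_def vec_eq_iff)
    moreover have "(\<Prod>I\<in>idx q. ?c I) = R h ^ card (idx q :: 'n set set) * lf h ^ ee TYPE('n) q"
    proof -
      have "{I \<in> idx q. j \<notin> I} = idx q \<inter> - {I. j \<in> I}" by auto
      then have "(\<Prod>I\<in>idx q. if j \<in> I then 1 else lf h) = lf h ^ ee TYPE('n) q"
        using card_idx_notin[where q=q and j=j] by (simp add: prod.If_cases)
      then show ?thesis by (simp add: prod.distrib)
    qed
    ultimately show ?thesis by (simp only: det_mult_rows_pdm)
  qed
  ultimately show ?thesis using det_gmat_unit[of "a h" j q] j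
    by (intro that[of "\<lambda>I J. ?c I * ?b I J" "det (gmat q (a h) j)"])
qed

text \<open>Once denominators from \<open>T\<close> are cleared, the rows of \<open>\<zeta>\<close>
  are combinations of those of \<open>\<theta>\<close>, and the determinant is
  multiplicative.\<close>

lemma det_dvd_of_local_generators:
  assumes T: "satur T"
    and gen: "\<And>\<eta>. \<eta> \<in> lattice q Q \<Longrightarrow> \<exists>t\<in>T. \<exists>c. \<forall>J. t * \<eta> J = (\<Sum>I\<in>idx q. c I * \<theta> I J)"
    and \<zeta>: "\<And>I. I \<in> idx q \<Longrightarrow> \<zeta> I \<in> lattice q Q"
  shows "\<exists>t\<in>T. det (pdm q \<theta>) dvd t * det (pdm q \<zeta>)"
proof -
  have "\<forall>I\<in>idx q. \<exists>t. t \<in> T \<and> (\<exists>c. \<forall>J. t * \<zeta> I J = (\<Sum>K\<in>idx q. c K * \<theta> K J))"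
    using gen \<zeta> by blast
  then obtain t where t: "\<And>I. I \<in> idx q \<Longrightarrow> t I \<in> T"
    and "\<And>I. I \<in> idx q \<Longrightarrow> \<exists>c. \<forall>J. t I * \<zeta> I J = (\<Sum>K\<in>idx q. c K * \<theta> K J)"
    unfolding bchoice_iff by blast
  then obtain c where c: "\<And>I J. I \<in> idx q \<Longrightarrow> t I * \<zeta> I J = (\<Sum>K\<in>idx q. c I K * \<theta> K J)"
    by metis
  define c' where "c' = (\<lambda>I K. if K \<in> idx q then c I K else 0)"
  have "pdm q c' ** pdm q \<theta> = pdm q (\<lambda>I J. t I * \<zeta> I J)"
    by (subst pdm_mult) (auto simp: c'_def c pdm_def vec_eq_iff)
  then have "det (pdm q c' ** pdm q \<theta>) = det (pdm q (\<lambda>I J. t I * \<zeta> I J))"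
    by (rule arg_cong)
  then have "(\<Prod>I\<in>idx q. t I) * det (pdm q \<zeta>) = det (pdm q c') * det (pdm q \<theta>)"
    by (simp only: det_mul det_mult_rows_pdm)
  moreover have "(\<Prod>I\<in>idx q. t I) \<in> T" using satur_prod[OF T] t by blast
  ultimately show ?thesis by (metis dvd_triv_right)
qed

text \<open>The quotient \<open>g\<close> of the determinant by \<open>\<Delta>\<close> divides the corresponding quotients for the tuples
  \<open>R h \<zeta>\<close>, where \<open>\<zeta>\<close> is a basis of the lattice of the single hyperplane \<open>h\<close>, up to elements of \<open>T\<close>;
  this leaves no room for a prime factor of \<open>g\<close> outside \<open>T\<close>.\<close>

lemma det_of_local_generators:
  assumes T: "satur T"
    and \<theta>: "\<And>I. I \<in> idx q \<Longrightarrow> \<theta> I \<in> lattice q Q"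
    and gen: "\<And>\<eta>. \<eta> \<in> lattice q Q \<Longrightarrow> \<exists>t\<in>T. \<exists>c. \<forall>J. t * \<eta> J = (\<Sum>I\<in>idx q. c I * \<theta> I J)"
  shows "\<exists>t\<in>T. det (pdm q \<theta>) = Q ^ ee TYPE('n) q * t"
proof -
  let ?e = "ee TYPE('n) q" and ?N = "card (idx q :: 'n set set)"
  obtain g where g: "det (pdm q \<theta>) = Q ^ ?e * g"
    using dvd_det[of q \<theta>] \<theta> by (auto simp: dvd_def)
  have dvd: "\<exists>t\<in>T. Q ^ ?e * g dvd t * det (pdm q \<zeta>)" if "\<And>I. I \<in> idx q \<Longrightarrow> \<zeta> I \<in> lattice q Q" for \<zeta>
    using det_dvd_of_local_generators[OF T, of q \<theta> \<zeta>] gen that unfolding g by blast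
  have gR: "\<exists>t\<in>T. g dvd t * R h ^ ?N" if h: "h \<in> B" for h
  proof -
    obtain \<zeta> u where \<zeta>: "\<And>I. I \<in> idx q \<Longrightarrow> \<zeta> I \<in> lattice q Q" "u dvd 1"
      "det (pdm q \<zeta>) = R h ^ ?N * lf h ^ ?e * u"
      by (rule standard_tuple[OF h, of q]) blast
    obtain t where t: "t \<in> T" "Q ^ ?e * g dvd t * (R h ^ ?N * lf h ^ ?e * u)"
      using dvd[of \<zeta>] \<zeta>(1,3) by auto
    have "lf h ^ ?e * (R h ^ ?e * g) dvd lf h ^ ?e * ((t * R h ^ ?N) * u)"
      using t(2) by (simp add: Q_R[OF h] power_mult_distrib ac_simps)
    then have "R h ^ ?e * g dvd (t * R h ^ ?N) * u"
      using nz[OF h] by simp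
    then have "g dvd (t * R h ^ ?N) * u" by (rule dvd_mult_right)
    moreover obtain u' where "u * u' = 1" using \<zeta>(2) by (metis dvd_def)
    ultimately have "g dvd t * R h ^ ?N" 
      by (metis (no_types, lifting) dvd_mult2 mult.assoc mult_1_right)
    then show ?thesis using t(1) by blast
  qed
  \<comment> \<open>Removes one hyperplane at a time from the multiple of \<open>g\<close>. A linear
    form in \<open>T\<close> is absorbed into \<open>t\<close>; any other cannot divide
    \<open>g\<close>, because by \<open>gR\<close> it would divide an element of \<open>T\<close>,
    and so it can be cancelled.\<close>
  have red: "\<exists>t\<in>T. g dvd t" if "finite F" "F \<subseteq> B" "\<exists>t\<in>T. g dvd t * (\<Prod>h\<in>F. lf h) ^ ?N" for F
    using that
  proof (induction F rule: finite_induct)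
    case (insert h F)
    then obtain t where t: "t \<in> T" "g dvd t * (lf h ^ ?N * (\<Prod>h\<in>F. lf h) ^ ?N)"
      by (auto simp: power_mult_distrib)
    have h: "h \<in> B" using insert by simp
    show ?case
    proof (cases "lf h \<in> T")
      case True
      then have "t * lf h ^ ?N \<in> T" using t T satur_power[OF T] by (simp add: satur_def)
      moreover have "g dvd (t * lf h ^ ?N) * (\<Prod>h\<in>F. lf h) ^ ?N"
        using t by (simp add: mult.assoc)
      ultimately show ?thesis using insert by blast
    next
      case False
      have "\<not> lf h dvd g"
      proof
        assume "lf h dvd g"
        obtain t' where t': "t' \<in> T" "g dvd t' * R h ^ ?N" using gR[OF h] by blast
        then have "lf h dvd t' * R h ^ ?N" using \<open>lf h dvd g\<close> dvd_trans by blast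
        then have "lf h dvd t'"
          using prime_lf[OF h] not_dvd_R[OF h] by (metis prime_elem_dvd_mult_iff prime_elem_dvd_power)
        then show False using t'(1) False T by (auto simp: satur_def)
      qed
      moreover obtain z where z: "t * (lf h ^ ?N * (\<Prod>h\<in>F. lf h) ^ ?N) = g * z"
        using t by (auto simp: dvd_def)
      moreover have "lf h ^ ?N dvd g * z"
        using z by (metis dvd_triv_left dvd_mult)
      ultimately have "lf h ^ ?N dvd z"
        using prime_elem_power_dvd_cancel[OF prime_lf[OF h]] by blast
      then obtain z' where "z = lf h ^ ?N * z'" by auto
      then have "lf h ^ ?N * (t * (\<Prod>h\<in>F. lf h) ^ ?N) = lf h ^ ?N * (g * z')"
        using z by (simp add: ac_simps)
      then have "t * (\<Prod>h\<in>F. lf h) ^ ?N = g * z'" using nz[OF h] by simp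
      then show ?thesis using insert t by (metis dvd_triv_left insert_subset)
    qed
  qed simp
  \<comment> \<open>The starting multiple comes from the lattice elements \<open>Q\<close> times
    \<open>dx\<^sub>I\<close>.\<close>
  have "\<exists>t\<in>T. g dvd t * Q ^ ?N"
  proof -
    obtain t where "t \<in> T" "Q ^ ?e * g dvd t * Q ^ ?N"
      using dvd[of "\<lambda>I J. Q * ub I J"] Q_ub_in_lattice det_pdm_ub[of q Q] by auto
    then show ?thesis by (meson dvd_mult_right)
  qed
  then obtain t where "t \<in> T" "g dvd t"
    using red[OF finB] unfolding Q_def by blast
  then have "g \<in> T" using T by (auto simp: satur_def)
  then show ?thesis using g by blast
qed

end

section \<open>Duality\<close>

definition pos :: "'n::{finite,linorder} \<Rightarrow> nat"
  where "pos i = card {j. j < i}"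

text \<open>Up to a sign depending only on \<open>card I\<close>, the sign of the shuffle of
  \<open>I\<close> with its complement. Dropping that sign keeps \<open>wdg_star\<close> free of
  signs that depend on the degree.\<close>

definition eps :: "'n::{finite,linorder} set \<Rightarrow> 'r::comm_ring_1"
  where "eps I = (-1) ^ (\<Sum>i\<in>I. pos i)"

lemma eps_sq [simp]: "eps I * eps I = 1"
  by (simp add: eps_def flip: power_add mult_2)

text \<open>The contraction of the multivector with coefficients \<open>x\<close> by the covector
  \<open>v\<close>.\<close>

definition contr :: "('n::{finite,linorder} \<Rightarrow> 'r::comm_ring_1) \<Rightarrow> ('n set \<Rightarrow> 'r) \<Rightarrow> 'n set \<Rightarrow> 'r"
  where "contr v x J = (\<Sum>i\<in>-J. (-1) ^ card {j\<in>J. j < i} * v i * x (insert i J))"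

text \<open>The predecessors of \<open>i\<close> are those in \<open>J\<close> and those outside
  \<open>J\<close>. Hence the signs in \<open>wdg\<close> at \<open>J\<close> and in
  \<open>contr\<close> at \<open>- J\<close> differ by the parity of \<open>pos i\<close>, which is
  what \<open>eps\<close> loses when \<open>i\<close> is removed from \<open>J\<close>.\<close>

lemma wdg_star: "wdg v (\<lambda>I. eps I * x (- I)) J = eps J * contr v x (- J)"
proof -
  have "(-1) ^ card {j\<in>J. j < i} * v i * (eps (J - {i}) * x (- (J - {i}))) =
      eps J * ((-1) ^ card {j\<in>-J. j < i} * v i * x (insert i (- J)))" if "i \<in> J" for i
  proof -
    have "{j. j < i} = {j\<in>J. j < i} \<union> {j\<in>-J. j < i}" by auto
    then have p: "pos i = card {j\<in>J. j < i} + card {j\<in>-J. j < i}"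
      unfolding pos_def by (simp add: card_Un_disjoint disjoint_iff)
    have "(\<Sum>i\<in>J. pos i) = pos i + (\<Sum>i\<in>J-{i}. pos i)"
      using that by (simp add: sum.remove)
    then have e: "eps J = (-1) ^ card {j\<in>J. j < i} * ((-1) ^ card {j\<in>-J. j < i} * eps (J - {i}) :: 'a)"
      by (simp add: eps_def p power_add mult.assoc)
    have s: "(-1) ^ m * (-1) ^ m = (1::'a)" for m by (simp flip: power_mult_distrib)
    have c: "- (J - {i}) = insert i (- J)" using that by auto
    have "eps J * ((-1) ^ card {j\<in>-J. j < i} * v i * x (insert i (- J))) =
       (-1) ^ card {j\<in>J. j < i} * v i * (eps (J - {i}) * x (insert i (- J))) *
       ((-1) ^ card {j\<in>-J. j < i} * (-1) ^ card {j\<in>-J. j < i})"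
      unfolding e by (simp only: ac_simps)
    then show ?thesis by (simp only: s c mult_1_right)
  qed
  then show ?thesis by (simp add: wdg_def contr_def sum_distrib_left)
qed

text \<open>Only the sets \<open>insert i J\<close> with \<open>i\<close> outside \<open>J\<close>
  contribute: contraction is the transpose of exterior multiplication. This is how the inverse of a
  basis matrix comes to satisfy contraction conditions.\<close>

lemma wdg_ub_adjoint: "(\<Sum>I\<in>UNIV. wdg v (ub J) I * x I) = contr v x J"
proof -
  have "(\<Sum>I\<in>UNIV. wdg v (ub J) I * x I) =
      (\<Sum>I\<in>UNIV. \<Sum>i\<in>I. (-1) ^ card {j\<in>I. j < i} * v i * ub J (I - {i}) * x I)"
    by (simp add: wdg_def sum_distrib_right)
  also have "\<dots> = (\<Sum>(I, i)\<in>(SIGMA I:UNIV. I). (-1) ^ card {j\<in>I. j < i} * v i * ub J (I - {i}) * x I)"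
    by (simp add: sum.Sigma)
  also have "\<dots> = (\<Sum>(I, i)\<in>(\<lambda>i. (insert i J, i)) ` (- J). (-1) ^ card {j\<in>I. j < i} * v i * ub J (I - {i}) * x I)"
    by (rule sum.mono_neutral_right) (auto simp: ub_def image_iff)
  also have "\<dots> = (\<Sum>i\<in>-J. (-1) ^ card {j\<in>insert i J. j < i} * v i * ub J (insert i J - {i}) * x (insert i J))"
    by (subst sum.reindex) (auto simp: inj_on_def)
  also have "\<dots> = contr v x J"
    unfolding contr_def
  proof (rule sum.cong)
    fix i assume "i \<in> - J"
    then have "{j \<in> insert i J. j < i} = {j \<in> J. j < i}" "insert i J - {i} = J" by auto
    then show "(-1) ^ card {j\<in>insert i J. j < i} * v i * ub J (insert i J - {i}) * x (insert i J) =
        (-1) ^ card {j\<in>J. j < i} * v i * x (insert i J)"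
      by (simp add: ub_def)
  qed simp
  finally show ?thesis .
qed

lemma compl_idx: "- I \<in> idx (int CARD('n) - q) \<longleftrightarrow> I \<in> idx q" for I :: "'n::finite set"
proof -
  have "card (- I) = CARD('n) - card I" by (simp add: Compl_eq_Diff_UNIV card_Diff_subset)
  moreover have "card I \<le> CARD('n)" by (simp add: card_mono)
  ultimately show ?thesis by (auto simp: idx_def)
qed

text \<open>A set contains \<open>j\<close> exactly if its complement avoids \<open>j\<close>. Hence
  the powers of \<open>Q\<close> belonging to complementary degrees multiply to the determinant of
  the tuple of all \<open>Q\<close> times \<open>dx\<^sub>I\<close>.\<close>

lemma ee_compl: "ee TYPE('n::finite) q + ee TYPE('n) (int CARD('n) - q) = card (idx q :: 'n set set)"
proof -
  fix j :: 'n
  have "card {I \<in> idx (int CARD('n) - q). j \<notin> I} = card {I \<in> idx q. j \<in> I}"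
  proof (rule bij_betw_same_card[of uminus], rule bij_betwI[of _ _ _ uminus])
    show "uminus \<in> {I \<in> idx (int CARD('n) - q). j \<notin> I} \<rightarrow> {I \<in> idx q. j \<in> I}"
      using compl_idx[where q=q] by (auto simp flip: compl_idx[where q=q])
    show "uminus \<in> {I \<in> idx q. j \<in> I} \<rightarrow> {I \<in> idx (int CARD('n) - q). j \<notin> I}"
      by (auto simp: compl_idx)
  qed auto
  moreover have "{I \<in> idx q. j \<notin> I} \<union> {I \<in> idx q. j \<in> I} = idx q"
    "{I \<in> idx q. j \<notin> I} \<inter> {I \<in> idx q. j \<in> I} = {}" by auto
  then have "card {I \<in> idx q. j \<notin> I} + card {I \<in> idx q. j \<in> I} = card (idx q :: 'n set set)"
    by (metis card_Un_disjoint finite)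
  ultimately show ?thesis by (simp add: card_idx_notin)
qed

context arr
begin

text \<open>Each \<open>Q\<close> times \<open>dx\<^sub>I\<close> lies in the lattice, so
  \<open>Q\<close> times the inverse of the basis matrix has entries in \<open>S\<close>. Its
  columns satisfy contraction conditions at all hyperplanes, which \<open>wdg_star\<close> turns
  into the lattice conditions in the complementary degree.\<close>

lemma good_dual:
  assumes "good {t. t dvd 1} q Q"
  shows "good {t. t dvd 1} (int CARD('n) - q) Q"
proof -
  let ?q' = "int CARD('n) - q"
  obtain \<theta> t where \<theta>: "\<And>I. I \<in> idx q \<Longrightarrow> \<theta> I \<in> lattice q Q"
    and t: "t dvd 1" and det: "det (pdm q \<theta>) = Q ^ ee TYPE('n) q * t"
    using assms by (auto simp: good_def)
  obtain t' where t': "t' * t = 1" using t by (metis dvd_def mult.commute)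
  have tnz: "t \<noteq> 0" using t by auto
  have comb: "\<exists>c. \<forall>J. \<eta> J = (\<Sum>K\<in>idx q. c K * \<theta> K J)" if \<eta>: "\<eta> \<in> lattice q Q" for \<eta>
  proof -
    obtain c where c: "\<And>J. t * \<eta> J = (\<Sum>I\<in>idx q. c I * \<theta> I J)"
      by (rule cramer_lattice[of q \<theta> t \<eta>]) (use \<theta> det tnz \<eta> in auto)
    have "\<eta> J = (\<Sum>K\<in>idx q. (t' * c K) * \<theta> K J)" for J
    proof -
      have "\<eta> J = t' * (t * \<eta> J)" using t' by (simp flip: mult.assoc)
      then show ?thesis by (simp add: c sum_distrib_left mult.assoc)
    qed
    then show ?thesis by metis
  qed
  have detnz: "det (pdm q \<theta>) \<noteq> 0" using det tnz Q_nonzero by simp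
  have "\<exists>c. \<forall>J. Q * ub I J = (\<Sum>K\<in>idx q. c K * \<theta> K J)" if "I \<in> idx q" for I
    using comb[OF Q_ub_in_lattice[OF that]] .
  then obtain c0 where c0: "\<And>I J. I \<in> idx q \<Longrightarrow> Q * ub I J = (\<Sum>K\<in>idx q. c0 I K * \<theta> K J)"
    by metis
  \<comment> \<open>Entries outside \<open>idx q\<close> are set to 0, as \<open>pdm_mult\<close>
    and the supports of the dual forms require.\<close>
  define c where "c = (\<lambda>I K. if I \<in> idx q \<and> K \<in> idx q then c0 I K else 0)"
  have c: "Q * ub I J = (\<Sum>K\<in>idx q. c I K * \<theta> K J)" if "I \<in> idx q" for I J
    using c0[OF that] that by (simp add: c_def)
  have contr_dvd: "lf h dvd contr (cv (a h)) (\<lambda>I. c I K) J" if h: "h \<in> B" and K: "K \<in> idx q" for h K J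
  proof (cases "int (card J) + 1 = q")
    case False
    have "c (insert i J) K = 0" if "i \<in> - J" for i
      using False that by (auto simp: c_def idx_def)
    then show ?thesis by (simp add: contr_def)
  next
    case True
    let ?w = "wdg (cv (a h)) (ub J)"
    have w0: "?w I = 0" if "I \<notin> idx q" for I
    proof -
      have "I - {i} \<noteq> J" if "i \<in> I" for i
      proof
        assume "I - {i} = J"
        then have "card J + 1 = card I" using \<open>i \<in> I\<close> card.remove[of I i] by simp
        then show False using \<open>I \<notin> idx q\<close> True by (simp add: idx_def)
      qed
      then show ?thesis by (simp add: wdg_def ub_def)
    qed
    \<comment> \<open>At \<open>h\<close> the form \<open>?w\<close> is killed by its own covector,
      at the other hyperplanes the factor \<open>R h\<close> is divisible. Multiplying its expansion
      in the basis by \<open>lf h\<close> and comparing with the expansion through \<open>c\<close>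
      identifies the contraction as \<open>lf h * d K\<close>.\<close>
    have "(\<lambda>I. R h * ?w I) \<in> lattice q Q"
    proof (rule Q_scale_in_lattice)
      fix h' assume "h' \<in> B"
      then show "lf h' dvd R h \<or> (\<forall>J'. wdg (cv (a h')) ?w J' = 0)"
        by (cases "h' = h") (auto simp: wdg_wdg dvd_R)
    qed (rule w0)
    then obtain d where d: "\<And>I. R h * ?w I = (\<Sum>K\<in>idx q. d K * \<theta> K I)"
      using comb[of "\<lambda>I. R h * ?w I"] by blast
    have "(\<Sum>K\<in>idx q. (lf h * d K - (\<Sum>I\<in>idx q. ?w I * c I K)) * \<theta> K J') = 0" for J'
    proof -
      have "(\<Sum>K\<in>idx q. (lf h * d K) * \<theta> K J') = lf h * (R h * ?w J')"
        by (simp add: d sum_distrib_left mult.assoc)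
      also have "\<dots> = (\<Sum>I\<in>idx q. ?w I * (Q * ub I J'))"
      proof (cases "J' \<in> idx q")
        case True
        have "(\<Sum>I\<in>idx q. ?w I * (Q * ub I J')) = (\<Sum>I\<in>idx q. if J' = I then Q * ?w J' else 0)"
          by (rule sum.cong) (auto simp: ub_def)
        then show ?thesis using True by (simp add: Q_R[OF h] mult.assoc)
      next
        case False
        then have "(\<Sum>I\<in>idx q. ?w I * (Q * ub I J')) = 0" by (intro sum.neutral) (auto simp: ub_def)
        then show ?thesis using w0[OF False] by simp
      qed
      also have "\<dots> = (\<Sum>I\<in>idx q. \<Sum>K\<in>idx q. ?w I * c I K * \<theta> K J')"
        by (rule sum.cong) (simp_all add: c sum_distrib_left mult.assoc)
      also have "\<dots> = (\<Sum>K\<in>idx q. (\<Sum>I\<in>idx q. ?w I * c I K) * \<theta> K J')"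
        by (subst sum.swap) (simp add: sum_distrib_right)
      finally show ?thesis by (simp add: left_diff_distrib sum_subtractf)
    qed
    then have "lf h * d K - (\<Sum>I\<in>idx q. ?w I * c I K) = 0"
      by (rule det_pdm_row_indep_S[OF detnz _ K])
    moreover have "(\<Sum>I\<in>idx q. ?w I * c I K) = (\<Sum>I\<in>UNIV. ?w I * c I K)"
      by (rule sum.mono_neutral_left) (auto simp: w0)
    ultimately have "contr (cv (a h)) (\<lambda>I. c I K) J = lf h * d K"
      using wdg_ub_adjoint[of "cv (a h)" J "\<lambda>I. c I K"] by simp
    then show ?thesis by simp
  qed
  \<comment> \<open>The row \<open>I'\<close> is the column \<open>- I'\<close> of \<open>c\<close>,
    transported by the star of \<open>wdg_star\<close>.\<close>
  define \<omega> where "\<omega> = (\<lambda>I' J. eps J * c (- J) (- I'))"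
  have "\<omega> I' \<in> lattice ?q' Q" if I': "I' \<in> idx ?q'" for I'
  proof -
    have K: "- I' \<in> idx q" using I' compl_idx[of "- I'" q] by simp
    have "\<omega> I' J = 0" if "J \<notin> idx ?q'" for J
      using that compl_idx[of "- J" q] by (simp add: \<omega>_def c_def)
    moreover have "lf h dvd wdg (cv (a h)) (\<omega> I') J" if "h \<in> B" for h J
      unfolding \<omega>_def using wdg_star[of "cv (a h)" "\<lambda>I. c I (- I')" J] contr_dvd[OF that K] by simp
    ultimately show ?thesis by (simp add: lattice_iff)
  qed
  moreover have "\<exists>s. s dvd 1 \<and> det (pdm ?q' \<omega>) = Q ^ ee TYPE('n) ?q' * s"
  proof -
    let ?C = "pdm q c"
    define e where "e = (\<lambda>J :: 'n set. if J \<in> idx ?q' then eps J else (1 :: ('n, 'k) mpoly))"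
    have "?C ** pdm q \<theta> = pdm q (\<lambda>I J. Q * ub I J)"
    proof -
      have "?C ** pdm q \<theta> = pdm q (\<lambda>I J. \<Sum>K\<in>idx q. c I K * \<theta> K J)"
        by (rule pdm_mult) (simp add: c_def)
      also have "\<dots> = pdm q (\<lambda>I J. Q * ub I J)"
        using c by (simp add: pdm_def vec_eq_iff)
      finally show ?thesis .
    qed
    then have "det ?C * det (pdm q \<theta>) = Q ^ card (idx q :: 'n set set)"
      by (metis det_mul det_pdm_ub)
    then have "Q ^ ee TYPE('n) q * (det ?C * t) = Q ^ ee TYPE('n) q * Q ^ ee TYPE('n) ?q'"
      by (simp add: det ac_simps flip: ee_compl power_add)
    then have Ct: "det ?C * t = Q ^ ee TYPE('n) ?q'" using Q_nonzero by simp
    have "transpose (pdm ?q' \<omega>) = (\<chi> J. e J *s (\<chi> I'. ?C $ (- J) $ (- I')))"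
      using compl_idx[where q=q and 'n='n]
      by (auto simp: vec_eq_iff transpose_def pdm_def \<omega>_def e_def c_def simp flip: compl_idx[where q=q])
    then have "det (transpose (pdm ?q' \<omega>)) = (\<Prod>J\<in>UNIV. e J) * det (\<chi> J I'. ?C $ (- J) $ (- I'))"
      by (simp only: det_rows_mul)
    moreover have "det (\<chi> J I'. ?C $ (- J) $ (- I')) = det ?C"
    proof -
      have p: "uminus permutes (UNIV :: 'n set set)"
        by (simp add: permutes_def) (metis double_compl)
      have "det (\<chi> J I'. ?C $ (- J) $ (- I')) = det (\<chi> J I'. (\<chi> J. ?C $ (- J)) $ J $ (- I'))"
        by simp
      also have "\<dots> = of_int (sign (uminus :: 'n set \<Rightarrow> _)) * (of_int (sign (uminus :: 'n set \<Rightarrow> _)) * det ?C)"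
        by (simp only: det_permute_columns[OF p] det_permute_rows[OF p])
      also have "\<dots> = det ?C"
        by (simp flip: mult.assoc of_int_mult)
      finally show ?thesis .
    qed
    ultimately have "det (pdm ?q' \<omega>) = (\<Prod>J\<in>UNIV. e J) * det ?C" by simp
    also have "\<dots> = Q ^ ee TYPE('n) ?q' * ((\<Prod>J\<in>UNIV. e J) * t')"
      using Ct t' by (metis (no_types, lifting) mult.assoc mult.commute mult_1)
    finally have "det (pdm ?q' \<omega>) = Q ^ ee TYPE('n) ?q' * ((\<Prod>J\<in>UNIV. e J) * t')" .
    moreover have "(\<Prod>J\<in>UNIV. e J) dvd 1"
    proof -
      have "(\<Prod>J\<in>UNIV. e J) * (\<Prod>J\<in>UNIV. e J) = 1"
        unfolding prod.distrib[symmetric] by (rule prod.neutral) (simp add: e_def)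
      then show ?thesis by (metis dvd_triv_left)
    qed
    moreover have "t' dvd 1" using t' by (metis dvd_triv_left)
    ultimately show ?thesis by (metis unit_mult_iff)
  qed
  ultimately show ?thesis by (auto simp: good_def)
qed

lemma good_dual_iff: "good {t. t dvd 1} q Q \<longleftrightarrow> good {t. t dvd 1} (int CARD('n) - q) Q"
  using good_dual[of q] good_dual[of "int CARD('n) - q"] by auto

end

section \<open>Passing to homogeneous tuples\<close>

definition ideal_set :: "'r::comm_ring_1 set \<Rightarrow> bool"
  where "ideal_set N \<longleftrightarrow> 0 \<in> N \<and> (\<forall>x\<in>N. \<forall>y\<in>N. x + y \<in> N) \<and> (\<forall>x\<in>N. \<forall>r. r * x \<in> N)"

lemma ideal_set_sum: "ideal_set N \<Longrightarrow> (\<And>x. x \<in> X \<Longrightarrow> f x \<in> N) \<Longrightarrow> sum f X \<in> N"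
  by (induction X rule: infinite_finite_induct) (simp_all add: ideal_set_def)

text \<open>Membership in such a multiple of \<open>N\<close>, with \<open>c\<close> a power of
  \<open>Q\<close>, tests the quotient of a determinant by this power against \<open>N\<close>
  without dividing.\<close>

lemma ideal_set_image:
  assumes "ideal_set N"
  shows "ideal_set {c * f | f. f \<in> N}"
  unfolding ideal_set_def
proof (intro conjI ballI allI)
  show "0 \<in> {c * f | f. f \<in> N}"
    using assms by (auto simp: ideal_set_def intro: exI[of _ 0])
next
  fix x y assume "x \<in> {c * f | f. f \<in> N}" "y \<in> {c * f | f. f \<in> N}"
  then show "x + y \<in> {c * f | f. f \<in> N}"
    using assms by (auto simp: ideal_set_def simp flip: distrib_left)
next
  fix x r assume "x \<in> {c * f | f. f \<in> N}"
  then show "r * x \<in> {c * f | f. f \<in> N}"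
    using assms by (auto simp: ideal_set_def mult.left_commute)
qed

lemma ideal_set_ker: "rhom h \<Longrightarrow> ideal_set {f. h f = 0}"
  by (simp add: ideal_set_def rhom_0 rhom_add rhom_mult)

text \<open>By multilinearity the determinant is a combination of determinants in which every row
  \<open>I\<close> is a single summand \<open>\<rho> (m I) I\<close>. If all of these lay in the
  ideal, so would the determinant; the rows are treated one after the other.\<close>

lemma det_pdm_split_rows:
  fixes \<theta> :: "'n::finite set \<Rightarrow> 'n set \<Rightarrow> 'r::comm_ring_1"
  assumes N: "ideal_set N" and X: "finite X"
    and split: "\<And>I J. I \<in> idx q \<Longrightarrow> \<theta> I J = (\<Sum>m\<in>X. u m * \<rho> m I J)"
    and det: "det (pdm q \<theta>) \<notin> N"
  shows "\<exists>m. det (pdm q (\<lambda>I. \<rho> (m I) I)) \<notin> N"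
proof -
  have "\<exists>m. det (pdm q (\<lambda>I. if I \<in> Z then \<rho> (m I) I else \<theta> I)) \<notin> N" if "finite Z" "Z \<subseteq> idx q" for Z
    using that
  proof (induction Z rule: finite_induct)
    case empty
    then show ?case using det by simp
  next
    case (insert K Z)
    then obtain m where m: "det (pdm q (\<lambda>I. if I \<in> Z then \<rho> (m I) I else \<theta> I)) \<notin> N" by auto
    let ?D = "pdm q (\<lambda>I. if I \<in> Z then \<rho> (m I) I else \<theta> I)"
    define E where "E = (\<lambda>j. pdm q (\<lambda>I. if I \<in> insert K Z then \<rho> ((m(K := j)) I) I else \<theta> I))"
    have "det ?D = det (\<chi> I. if I = K then (\<Sum>j\<in>X. u j *s (\<chi> J. \<rho> j K J)) else ?D $ I)"
      using insert by (intro arg_cong[of _ _ det]) (auto simp: vec_eq_iff pdm_def split)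
    also have "\<dots> = (\<Sum>j\<in>X. det (\<chi> I. if I = K then u j *s (\<chi> J. \<rho> j K J) else ?D $ I))"
      by (rule det_linear_row_sum[OF X])
    also have "\<dots> = (\<Sum>j\<in>X. u j * det (E j))"
    proof (rule sum.cong)
      fix j
      have "E j = (\<chi> I. if I = K then (\<chi> J. \<rho> j K J) else ?D $ I)"
        using insert by (auto simp: vec_eq_iff pdm_def E_def)
      then show "det (\<chi> I. if I = K then u j *s (\<chi> J. \<rho> j K J) else ?D $ I) = u j * det (E j)"
        by (simp only: det_row_mul)
    qed simp
    finally have "(\<Sum>j\<in>X. u j * det (E j)) \<notin> N" using m by simp
    moreover have "(\<Sum>j\<in>X. u j * det (E j)) \<in> N" if "\<forall>j. u j * det (E j) \<in> N"
      by (rule ideal_set_sum[OF N]) (use that in simp)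
    ultimately obtain j where "u j * det (E j) \<notin> N" by blast
    then have "det (E j) \<notin> N" using N by (auto simp: ideal_set_def)
    then show ?case unfolding E_def by blast
  qed
  from this[of "idx q"] obtain m where m: "det (pdm q (\<lambda>I. if I \<in> idx q then \<rho> (m I) I else \<theta> I)) \<notin> N"
    by auto
  also have "pdm q (\<lambda>I. if I \<in> idx q then \<rho> (m I) I else \<theta> I) = pdm q (\<lambda>I. \<rho> (m I) I)"
    by (rule pdm_cong) simp
  finally show ?thesis by blast
qed

lemma det_pdm_S_deg:
  fixes \<theta> :: "'n::{finite,linorder} set \<Rightarrow> 'n set \<Rightarrow> ('n, 'k::field) mpoly"
  assumes "\<And>I J. I \<in> idx q \<Longrightarrow> \<theta> I J \<in> S_deg (d I)"
  shows "det (pdm q \<theta>) \<in> S_deg (\<Sum>I\<in>idx q. d I)"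
proof -
  have of_int: "(of_int z :: ('n, 'k) mpoly) \<in> S_deg 0" for z
  proof -
    have "(of_int z :: ('n, 'k) mpoly) = cst (of_int z)" by (simp add: cst_def)
    then show ?thesis by (simp add: S_deg_cst)
  qed
  have "(\<Prod>I\<in>UNIV. pdm q \<theta> $ I $ p I) \<in> S_deg (\<Sum>I\<in>UNIV. if I \<in> idx q then d I else 0)" for p
    by (rule S_deg_prod) (auto simp: pdm_def assms S_deg_1)
  then have "(\<Prod>I\<in>UNIV. pdm q \<theta> $ I $ p I) \<in> S_deg (\<Sum>I\<in>idx q. d I)" for p
    by (simp add: sum.If_cases)
  then show ?thesis
    unfolding det_def using S_deg_mult[OF of_int] by (intro S_deg_sum) fastforce
qed

lemma wdg_cv_hz: "wdg (cv a) (\<lambda>I. hz d (\<eta> I)) J = hz d (wdg (cv a) \<eta> J)"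
proof -
  have "hz d ((-1) ^ n * cv a i * f) = (-1) ^ n * cv a i * hz d f" for n i f
  proof -
    have "(-1) ^ n * cv a i = cst ((-1) ^ n * a $ i)"
      by (simp add: cv_def rhom_mult rhom_power rhom_minus rhom_1 rhom_cst)
    then have "(-1) ^ n * cv a i \<in> S_deg 0" by (simp add: S_deg_cst)
    from hz_mult[OF this, of d f] show ?thesis by simp
  qed
  then show ?thesis by (simp add: wdg_def hz_sum)
qed

context arr
begin

lemma Q_S_deg: "Q \<in> S_deg (int (card B))"
  using S_deg_prod[OF finB S_deg_linear_form, of a] by (simp add: Q_def)

lemma lattice_hz: "\<eta> \<in> lattice q Q \<Longrightarrow> (\<lambda>J. hz d (\<eta> J)) \<in> lattice q Q"
  unfolding lattice_iff wdg_cv_hz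
  by (auto simp: dvd_def) (metis S_deg_linear_form hz_mult)

text \<open>The homogeneous components of lattice elements are in the lattice, and
  \<open>det_pdm_split_rows\<close> chooses one component in each row without letting the quotient
  fall into \<open>N\<close>.\<close>

lemma homogeneous_tuple:
  assumes N: "ideal_set N" and \<theta>: "\<And>I. I \<in> idx q \<Longrightarrow> \<theta> I \<in> lattice q Q"
    and det: "det (pdm q \<theta>) = Q ^ ee TYPE('n) q * t" and t: "t \<notin> N"
  obtains \<theta>' d t' where "\<And>I. I \<in> idx q \<Longrightarrow> \<theta>' I \<in> lattice q Q" "\<And>I J. \<theta>' I J \<in> S_deg (d I)"
    "det (pdm q \<theta>') = Q ^ ee TYPE('n) q * t'" "t' \<notin> N"
    "t' \<in> S_deg ((\<Sum>I\<in>idx q. d I) - int (ee TYPE('n) q) * int (card B))"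
proof -
  let ?e = "ee TYPE('n) q"
  let ?N = "{Q ^ ?e * f | f. f \<in> N}"
  obtain X where X: "finite X" "\<And>y. y \<in> UNIV \<Longrightarrow> (\<Sum>d\<in>X. hz d (case y of (I, J) \<Rightarrow> \<theta> I J)) = (case y of (I, J) \<Rightarrow> \<theta> I J)"
    using hz_decomp[of UNIV "\<lambda>(I, J). \<theta> I J"] by auto
  have "det (pdm q \<theta>) \<notin> ?N"
    using t Q_nonzero by (auto simp: det)
  moreover have "\<theta> I J = (\<Sum>d\<in>X. 1 * hz d (\<theta> I J))" for I J
    using X(2)[of "(I, J)"] by simp
  ultimately obtain d where d: "det (pdm q (\<lambda>I J. hz (d I) (\<theta> I J))) \<notin> ?N"
    using det_pdm_split_rows[OF ideal_set_image[OF N] X(1), of q \<theta> "\<lambda>_. 1" "\<lambda>d I J. hz d (\<theta> I J)"]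
    by blast
  define \<theta>' where "\<theta>' = (\<lambda>I J. hz (d I) (\<theta> I J))"
  have L: "\<theta>' I \<in> lattice q Q" if "I \<in> idx q" for I
    unfolding \<theta>'_def using lattice_hz[OF \<theta>[OF that]] .
  have S: "\<theta>' I J \<in> S_deg (d I)" for I J by (simp add: \<theta>'_def hz_in)
  obtain t' where t': "det (pdm q \<theta>') = Q ^ ?e * t'"
    using dvd_det[of q \<theta>'] L by (auto simp: dvd_def)
  have "Q ^ ?e * t' \<in> S_deg (\<Sum>I\<in>idx q. d I)"
    using det_pdm_S_deg[of q \<theta>' d] S by (simp add: t')
  then have "t' \<in> S_deg ((\<Sum>I\<in>idx q. d I) - int ?e * int (card B))"
    using S_deg_cancel[OF S_deg_power[OF Q_S_deg]] Q_nonzero by simp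
  moreover have "t' \<notin> N" using d t' by (auto simp flip: \<theta>'_def)
  ultimately show ?thesis using that[OF L S t'] by blast
qed

end

section \<open>Freeness at the generic point of a flat\<close>

lemma lookup_single0_mult:
  fixes f :: "'m::comm_monoid_add \<Rightarrow>\<^sub>0 'a::comm_ring_1"
  shows "Poly_Mapping.lookup (Poly_Mapping.single 0 c * f) m = c * Poly_Mapping.lookup f m"
proof (induction f rule: pm_induct)
  case (add f m' c')
  then show ?case
    by (simp add: distrib_left lookup_add mult_single lookup_single when_def)
qed simp

definition ct :: "('n::{finite,linorder}, 'k::field) mpoly \<Rightarrow> 'k"
  where "ct = ev (\<lambda>x. x) (\<lambda>_. 0)"

lemma rhom_ct: "rhom ct"
  unfolding ct_def by (rule rhom_ev[OF rhom_id])

lemma ct_cst [simp]: "ct (cst c) = c" and ct_coord [simp]: "ct (coord i) = 0"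
  by (simp_all add: ct_def ev_cst ev_coord rhom_id)

text \<open>A monomial with nonzero value at the origin is constant, so the degree must be
  0.\<close>

lemma unit_of_homogeneous:
  assumes "t \<in> S_deg e" "ct t \<noteq> 0"
  shows "t dvd 1"
proof -
  have "\<exists>m\<in>Poly_Mapping.keys t. Poly_Mapping.lookup t m * (\<Prod>i\<in>UNIV. 0 ^ Poly_Mapping.lookup m i) \<noteq> 0"
    using assms(2) unfolding ct_def ev_def by (meson sum.neutral)
  then obtain m where m: "m \<in> Poly_Mapping.keys t" "(\<Prod>i\<in>UNIV. 0 ^ Poly_Mapping.lookup m i) \<noteq> (0::'b)"
    by auto
  have "Poly_Mapping.lookup m i = 0" for i
  proof (rule ccontr)
    assume "Poly_Mapping.lookup m i \<noteq> 0"
    then have "\<exists>i\<in>UNIV. (0::'b) ^ Poly_Mapping.lookup m i = 0" by (auto intro: exI[of _ i])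
    then show False using m(2) by (metis finite prod_zero)
  qed
  then have "total_degree m = 0" by (simp add: total_degree_def)
  then have e: "e = 0" using m assms(1) by (auto simp: S_deg_def)
  have keys: "m' = 0" if "m' \<in> Poly_Mapping.keys t" for m'
  proof -
    have "total_degree m' = 0" using that assms(1) e by (auto simp: S_deg_def)
    then show ?thesis by (intro poly_mapping_eqI) (simp add: total_degree_def)
  qed
  have "t = cst (Poly_Mapping.lookup t 0)"
    unfolding cst_def
  proof (rule poly_mapping_eqI)
    fix k
    show "Poly_Mapping.lookup t k = Poly_Mapping.lookup (Poly_Mapping.single 0 (Poly_Mapping.lookup t 0)) k"
      using keys[of k] by (cases "k = 0") (auto simp: in_keys_iff lookup_single)
  qed
  moreover have "Poly_Mapping.lookup t 0 \<noteq> 0"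
    using calculation assms(2) by (auto simp: rhom_0[OF rhom_ct])
  ultimately show ?thesis using cst_unit by metis
qed

text \<open>Substitution of a linear endomorphism of \<open>V\<close>.\<close>

definition lsub :: "'k::field ^ 'n::{finite,linorder} ^ 'n::{finite,linorder} \<Rightarrow> ('n, 'k) mpoly \<Rightarrow> ('n, 'k) mpoly"
  where "lsub M = ev cst (\<lambda>i. linear_form (M $ i))"

lemma rhom_lsub: "rhom (lsub M)"
  unfolding lsub_def by (rule rhom_ev[OF rhom_cst])

lemma lsub_linear_form: "lsub M (linear_form b) = linear_form (b v* M)"
proof -
  have "lsub M (linear_form b) = (\<Sum>i\<in>UNIV. \<Sum>j\<in>UNIV. cst (b $ i) * (cst (M $ i $ j) * coord j))"
    unfolding linear_form_def[of b] rhom_sum[OF rhom_lsub] rhom_mult[OF rhom_lsub]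
    by (simp add: lsub_def ev_cst ev_coord rhom_cst linear_form_def sum_distrib_left)
  also have "\<dots> = (\<Sum>j\<in>UNIV. \<Sum>i\<in>UNIV. cst (b $ i) * (cst (M $ i $ j) * coord j))"
    by (rule sum.swap)
  also have "\<dots> = linear_form (b v* M)"
    by (simp add: linear_form_def vector_matrix_mult_def rhom_sum[OF rhom_cst] rhom_mult[OF rhom_cst]
        sum_distrib_right sum_distrib_left ac_simps)
  finally show ?thesis .
qed

type_synonym ('n, 'k) mpoly2 = "('n \<Rightarrow>\<^sub>0 nat) \<Rightarrow>\<^sub>0 ('n, 'k) mpoly"

text \<open>\<open>f(x) \<mapsto> f(x + M Y)\<close>, and its left inverse modulo \<open>x = 0\<close>, \<open>Y \<mapsto> x\<close>.\<close>

definition shift :: "'k::field ^ 'n::{finite,linorder} ^ 'n::{finite,linorder} \<Rightarrow> ('n, 'k) mpoly \<Rightarrow> ('n, 'k) mpoly2"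
  where "shift M = ev (\<lambda>c. Poly_Mapping.single 0 (cst c)) (\<lambda>i. Poly_Mapping.single 0 (coord i) +
    (\<Sum>j\<in>UNIV. Poly_Mapping.single 0 (cst (M $ i $ j)) * Poly_Mapping.single (Poly_Mapping.single j 1) 1))"

definition spec :: "('n::{finite,linorder}, 'k::field) mpoly2 \<Rightarrow> ('n, 'k) mpoly"
  where "spec = ev (\<lambda>f. cst (ct f)) coord"

lemma rhom_single_cst: "rhom (\<lambda>c. Poly_Mapping.single 0 (cst c))"
  using rhom_comp[OF rhom_single0 rhom_cst] .

lemma rhom_cst_ct: "rhom (\<lambda>f. cst (ct f))"
  using rhom_comp[OF rhom_cst rhom_ct] .

lemma rhom_shift: "rhom (shift M)"
  unfolding shift_def by (rule rhom_ev[OF rhom_single_cst])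

lemma rhom_spec: "rhom spec"
  unfolding spec_def by (rule rhom_ev[OF rhom_cst_ct])

lemma spec_shift: "spec (shift M f) = lsub M f"
proof -
  have c: "spec (Poly_Mapping.single 0 g) = cst (ct g)" for g :: "('a, 'b) mpoly"
    by (simp add: spec_def ev_const rhom_cst_ct)
  have v: "spec (Poly_Mapping.single (Poly_Mapping.single j 1) 1) = (coord j :: ('a, 'b) mpoly)" for j
    unfolding spec_def by (rule ev_var[OF rhom_cst_ct])
  show ?thesis
  proof (rule rhom_eqI[OF rhom_comp[OF rhom_spec rhom_shift] rhom_lsub])
    fix k show "spec (shift M (cst k)) = lsub M (cst k)"
      by (simp add: shift_def lsub_def ev_cst rhom_single_cst rhom_cst c)
  next
    fix i
    show "spec (shift M (coord i)) = lsub M (coord i)"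
      unfolding shift_def lsub_def ev_coord[OF rhom_single_cst] ev_coord[OF rhom_cst]
        rhom_add[OF rhom_spec] rhom_sum[OF rhom_spec] rhom_mult[OF rhom_spec] c v
      by (simp add: linear_form_def)
  qed
qed

lemma shift_cst: "shift M (cst c) = Poly_Mapping.single 0 (cst c)"
  by (simp add: shift_def ev_cst rhom_single_cst)

lemma shift_linear_form:
  fixes b :: "'k::field ^ 'n::{finite,linorder}"
  assumes "b v* M = 0"
  shows "shift M (linear_form b) = Poly_Mapping.single 0 (linear_form b)"
proof -
  let ?c = "Poly_Mapping.single (0 :: 'n \<Rightarrow>\<^sub>0 nat)"
  let ?Y = "\<lambda>j. Poly_Mapping.single (Poly_Mapping.single j (1::nat)) (1 :: ('n, 'k) mpoly)"
  have "shift M (linear_form b) =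
     (\<Sum>i\<in>UNIV. ?c (cst (b $ i)) * (?c (coord i) + (\<Sum>j\<in>UNIV. ?c (cst (M $ i $ j)) * ?Y j)))"
    unfolding linear_form_def[of b] rhom_sum[OF rhom_shift] rhom_mult[OF rhom_shift] shift_cst
    by (simp add: shift_def ev_coord rhom_single_cst)
  also have "\<dots> = (\<Sum>i\<in>UNIV. ?c (cst (b $ i)) * ?c (coord i)) +
      (\<Sum>i\<in>UNIV. \<Sum>j\<in>UNIV. ?c (cst (b $ i)) * (?c (cst (M $ i $ j)) * ?Y j))"
    by (simp only: distrib_left sum.distrib sum_distrib_left)
  also have "(\<Sum>i\<in>UNIV. \<Sum>j\<in>UNIV. ?c (cst (b $ i)) * (?c (cst (M $ i $ j)) * ?Y j)) =
      (\<Sum>j\<in>UNIV. \<Sum>i\<in>UNIV. ?c (cst (b $ i)) * (?c (cst (M $ i $ j)) * ?Y j))"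
    by (rule sum.swap)
  also have "\<dots> = (\<Sum>j\<in>UNIV. ?c (cst ((b v* M) $ j)) * ?Y j)"
    unfolding vector_matrix_mult_def vec_lambda_beta rhom_sum[OF rhom_single_cst] rhom_mult[OF rhom_single_cst]
      sum_distrib_right by (simp only: ac_simps)
  also have "\<dots> = 0" by (simp add: assms)
  also have "(\<Sum>i\<in>UNIV. ?c (cst (b $ i)) * ?c (coord i)) = ?c (linear_form b)"
    by (simp only: linear_form_def rhom_sum[OF rhom_single0] rhom_mult[OF rhom_single0])
  finally show ?thesis by simp
qed

text \<open>The coefficients of \<open>f(x + M Y)\<close> as a polynomial in \<open>Y\<close> depend linearly on \<open>f\<close> over the
  subring generated by the forms killed by \<open>M\<close>, so that they preserve the lattice; here \<open>M\<close> is to be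
  thought of as a projection onto the flat.\<close>

lemma (in arr) good_units_of_good_ker:
  assumes M: "\<And>h. h \<in> B \<Longrightarrow> a h v* M = 0" and good: "good {f. lsub M f \<noteq> 0} q Q"
  shows "good {t. t dvd 1} q Q"
proof -
  let ?e = "ee TYPE('n) q"
  let ?c = "Poly_Mapping.single (0 :: 'n \<Rightarrow>\<^sub>0 nat)"
  let ?Y = "\<lambda>m :: 'n \<Rightarrow>\<^sub>0 nat. Poly_Mapping.single m (1 :: ('n, 'k) mpoly)"
  obtain \<theta> t where \<theta>: "\<And>I. I \<in> idx q \<Longrightarrow> \<theta> I \<in> lattice q Q" and t: "lsub M t \<noteq> 0"
    and det: "det (pdm q \<theta>) = Q ^ ?e * t"
    using good by (auto simp: good_def)
  have sQ: "shift M (Q ^ ?e) = ?c (Q ^ ?e)"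
    by (simp add: Q_def rhom_power[OF rhom_shift] rhom_prod[OF rhom_shift] rhom_power[OF rhom_single0]
        rhom_prod[OF rhom_single0] shift_linear_form M)
  have cnz: "?c (Q ^ ?e) \<noteq> 0"
  proof
    assume "?c (Q ^ ?e) = 0"
    then have "Poly_Mapping.lookup (?c (Q ^ ?e)) 0 = 0" by simp
    then show False using Q_nonzero by simp
  qed
  \<comment> \<open>The constant \<open>Q ^ ?e\<close> times the kernel of \<open>spec\<close>: the
    shifted quotient \<open>shift M t\<close> has the value \<open>lsub M t\<close> under
    \<open>spec\<close>, which is nonzero.\<close>
  let ?N = "{?c (Q ^ ?e) * f | f. f \<in> {f. spec f = 0}}"
  have N: "ideal_set ?N" by (rule ideal_set_image[OF ideal_set_ker[OF rhom_spec]])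
  have "det (pdm q (\<lambda>I J. shift M (\<theta> I J))) = ?c (Q ^ ?e) * shift M t"
    by (simp only: det sQ rhom_mult[OF rhom_shift] flip: rhom_det_pdm[OF rhom_shift])
  moreover have "?c (Q ^ ?e) * shift M t \<notin> ?N"
    using t cnz by (auto simp: spec_shift[symmetric])
  ultimately have notN: "det (pdm q (\<lambda>I J. shift M (\<theta> I J))) \<notin> ?N" by simp
  define X where "X = (\<Union>I. \<Union>J. Poly_Mapping.keys (shift M (\<theta> I J)))"
  have X: "finite X" unfolding X_def by simp
  have "shift M (\<theta> I J) = (\<Sum>m\<in>X. ?Y m * ?c (Poly_Mapping.lookup (shift M (\<theta> I J)) m))" for I J
  proof -
    let ?f = "shift M (\<theta> I J)"
    have "?f = (\<Sum>m\<in>Poly_Mapping.keys ?f. Poly_Mapping.single m (Poly_Mapping.lookup ?f m))"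
      by (simp add: pm_sum_single)
    also have "\<dots> = (\<Sum>m\<in>X. Poly_Mapping.single m (Poly_Mapping.lookup ?f m))"
      by (rule sum.mono_neutral_left) (use X in \<open>auto simp: X_def in_keys_iff\<close>)
    finally show ?thesis by (simp add: mult_single)
  qed
  then obtain m where m: "det (pdm q (\<lambda>I J. ?c (Poly_Mapping.lookup (shift M (\<theta> I J)) (m I)))) \<notin> ?N"
    using det_pdm_split_rows[OF N X, of q "\<lambda>I J. shift M (\<theta> I J)" ?Y
        "\<lambda>m I J. ?c (Poly_Mapping.lookup (shift M (\<theta> I J)) m)"] notN by blast
  define \<theta>1 where "\<theta>1 = (\<lambda>I J. Poly_Mapping.lookup (shift M (\<theta> I J)) (m I))"
  have \<theta>1: "\<theta>1 I \<in> lattice q Q" if I: "I \<in> idx q" for I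
    unfolding lattice_iff
  proof (intro conjI allI impI ballI)
    fix J :: "'n set" assume "J \<notin> idx q"
    then show "\<theta>1 I J = 0"
      using lattice_supp[OF \<theta>[OF I]] by (simp add: \<theta>1_def rhom_0 rhom_shift)
  next
    fix h J assume h: "h \<in> B"
    obtain z where z: "wdg (cv (a h)) (\<theta> I) J = lf h * z"
      using \<theta>[OF I] h unfolding lattice_iff by blast
    \<comment> \<open>Neither \<open>lf h\<close> nor its covector involves Y, so both pass through
      the extraction of a coefficient.\<close>
    have "lf h * Poly_Mapping.lookup (shift M z) (m I) =
        Poly_Mapping.lookup (shift M (wdg (cv (a h)) (\<theta> I) J)) (m I)"
      by (simp add: z rhom_mult rhom_shift shift_linear_form M h lookup_single0_mult)
    also have "shift M (wdg (cv (a h)) (\<theta> I) J) = wdg (\<lambda>i. ?c (cv (a h) i)) (\<lambda>K. shift M (\<theta> I K)) J"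
      by (simp add: wdg_rhom rhom_shift cv_def shift_cst)
    also have "Poly_Mapping.lookup \<dots> (m I) = wdg (cv (a h)) (\<theta>1 I) J"
    proof -
      have "(-1) ^ n * ?c (cv (a h) i) * f = ?c ((-1) ^ n * cv (a h) i) * f" for n i f
        by (simp add: rhom_mult rhom_power rhom_minus rhom_1 rhom_single0)
      then show ?thesis
        by (simp only: wdg_def lookup_sum lookup_single0_mult \<theta>1_def)
    qed
    finally show "lf h dvd wdg (cv (a h)) (\<theta>1 I) J" by (metis dvd_triv_left)
  qed
  obtain t1 where t1: "det (pdm q \<theta>1) = Q ^ ?e * t1"
    using dvd_det[of q \<theta>1] \<theta>1 by (auto simp: dvd_def)
  have "?c (det (pdm q \<theta>1)) \<notin> ?N"
    using m by (simp add: \<theta>1_def rhom_det_pdm rhom_single0)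
  \<comment> \<open>On polynomials constant in Y, \<open>spec\<close> returns the constant term; so
    the new quotient \<open>t1\<close> does not vanish at the origin.\<close>
  then have "spec (?c t1) \<noteq> 0"
    unfolding t1 rhom_mult[OF rhom_single0] by blast
  then have "t1 \<notin> {f. ct f = 0}"
    by (simp add: spec_def ev_const rhom_cst_ct)
  then obtain \<theta>2 d t2 where "\<And>I. I \<in> idx q \<Longrightarrow> \<theta>2 I \<in> lattice q Q" "\<And>I J. \<theta>2 I J \<in> S_deg (d I)"
    "det (pdm q \<theta>2) = Q ^ ?e * t2" "t2 \<notin> {f. ct f = 0}"
    "t2 \<in> S_deg ((\<Sum>I\<in>idx q. d I) - int ?e * int (card B))"
    using homogeneous_tuple[OF ideal_set_ker[OF rhom_ct], of q \<theta>1 t1] \<theta>1 t1 by metis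
  then show ?thesis using unit_of_homogeneous[of t2] unfolding good_def by blast
qed

section \<open>Points of projective space and flats\<close>

lemma satur_compl_Proj: "P \<in> Proj \<Longrightarrow> satur (- P)"
  by (auto simp: Proj_def satur_def) (metis mult.commute)+

lemma ideal_set_Proj: "P \<in> Proj \<Longrightarrow> ideal_set P"
  by (simp add: Proj_def ideal_set_def)

lemma Proj_prime: "P \<in> Proj \<Longrightarrow> f * g \<in> P \<longleftrightarrow> f \<in> P \<or> g \<in> P"
  using satur_compl_Proj[of P] by (auto simp: satur_def)

lemma Proj_1: "P \<in> Proj \<Longrightarrow> 1 \<notin> P"
  and Proj_0: "P \<in> Proj \<Longrightarrow> 0 \<in> P"
  by (simp_all add: Proj_def)

text \<open>Provides a form of degree 1 that is invertible at \<open>P\<close>; its powers serve to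
  adjust degrees near \<open>P\<close>.\<close>

lemma Proj_coord:
  assumes "P \<in> Proj"
  obtains i where "coord i \<notin> P"
proof (rule ccontr)
  note id = ideal_set_Proj[OF assms]
  assume "\<not> thesis"
  then have c: "coord i \<in> P" for i using that by blast
  have "f \<in> P" if f: "f \<in> S_deg d" and d: "d > 0" for f d
  proof -
    have "Poly_Mapping.single m (Poly_Mapping.lookup f m) \<in> P" if m: "m \<in> Poly_Mapping.keys f" for m
    proof -
      have "int (total_degree m) > 0" using f m d by (auto simp: S_deg_def)
      then have "\<exists>i. Poly_Mapping.lookup m i \<noteq> 0" by (auto simp: total_degree_def intro: ccontr)
      then obtain i where "Poly_Mapping.lookup m i \<noteq> 0" by blast
      then obtain n where n: "Poly_Mapping.lookup m i = Suc n" using not0_implies_Suc by blast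
      have "Poly_Mapping.single m (Poly_Mapping.lookup f m) =
          cst (Poly_Mapping.lookup f m) * (coord i ^ Poly_Mapping.lookup m i *
            (\<Prod>i\<in>UNIV-{i}. coord i ^ Poly_Mapping.lookup m i))"
        by (simp add: single_conv_cst[of m "Poly_Mapping.lookup f m"] mono_conv_prod prod.remove[of UNIV i])
      also have "\<dots> = (cst (Poly_Mapping.lookup f m) * (coord i ^ n *
            (\<Prod>i\<in>UNIV-{i}. coord i ^ Poly_Mapping.lookup m i))) * coord i"
        by (simp add: n ac_simps)
      finally show ?thesis using id c[of i] by (simp add: ideal_set_def)
    qed
    then have "(\<Sum>m\<in>Poly_Mapping.keys f. Poly_Mapping.single m (Poly_Mapping.lookup f m)) \<in> P"
      by (rule ideal_set_sum[OF id])
    then show ?thesis by (simp only: pm_sum_single)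
  qed
  then show False using assms by (auto simp: Proj_def)
qed

lemma S_deg_lsub:
  assumes "f \<in> S_deg d"
  shows "lsub M f \<in> S_deg d"
  unfolding lsub_def ev_def
proof (rule S_deg_sum)
  fix m assume "m \<in> Poly_Mapping.keys f"
  then have d: "d = 0 + (\<Sum>i\<in>UNIV. int (Poly_Mapping.lookup m i) * 1)"
    using assms by (auto simp: S_deg_def total_degree_def)
  show "cst (Poly_Mapping.lookup f m) * (\<Prod>i\<in>UNIV. linear_form (M $ i) ^ Poly_Mapping.lookup m i) \<in> S_deg d"
    unfolding d by (intro S_deg_mult S_deg_cst S_deg_prod S_deg_power S_deg_linear_form) simp
qed

lemma hz_lsub: "hz d (lsub M f) = lsub M (hz d f)"
proof -
  obtain X0 where X0: "finite X0" "(\<Sum>d\<in>X0. hz d f) = f"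
    using hz_decomp[of "{f}" "\<lambda>x. x"] by auto
  have f: "f = (\<Sum>d\<in>X0. hz d f)" using X0 by simp
  have "hz d (lsub M f) = (\<Sum>d'\<in>X0. hz d (lsub M (hz d' f)))"
    by (subst f) (simp add: rhom_sum rhom_lsub hz_sum)
  also have "\<dots> = (\<Sum>d'\<in>X0. lsub M (hz d (hz d' f)))"
    by (rule sum.cong) (simp_all add: hz_same[OF S_deg_lsub[OF hz_in]] hz_same[OF hz_in] rhom_0 rhom_lsub)
  also have "\<dots> = lsub M (hz d f)"
    by (subst (2) f) (simp add: rhom_sum rhom_lsub hz_sum)
  finally show ?thesis .
qed

text \<open>The ideal of the image of \<open>M\<close> as a linear subspace: prime because
  \<open>S\<close> is a domain, homogeneous because the substitution respects degrees, relevant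
  because \<open>M\<close> is nonzero. For a projection onto a flat it is the generic point of the
  flat.\<close>

lemma ker_lsub_Proj:
  assumes "M \<noteq> 0"
  shows "{f. lsub M f = 0} \<in> Proj"
proof -
  obtain i where "M $ i \<noteq> 0" using assms by (auto simp: vec_eq_iff)
  then have "lsub M (coord i) \<noteq> 0" by (simp add: lsub_def ev_coord rhom_cst)
  then have "\<not> (\<forall>d>0. S_deg d \<subseteq> {f. lsub M f = 0})"
    using S_deg_coord[of i] by (auto intro: exI[of _ 1])
  moreover have "lsub M (hom_component d f) = 0" if "lsub M f = 0" for d f
  proof -
    have "lsub M (hz (int d) f) = 0" using that by (simp flip: hz_lsub)
    then show ?thesis by (simp add: hz_def)
  qed
  ultimately show ?thesis
    unfolding Proj_def by (simp add: rhom_0 rhom_1 rhom_add rhom_mult rhom_lsub)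
qed

text \<open>A basis of \<open>W\<close> is placed in the rows of a square matrix, padded with zero
  rows. The matrix is injective, and a left inverse expresses the unit vectors by its rows.\<close>

lemma subspace_eq_UNIV_of_annihilator:
  fixes W :: "('k::field ^ 'n::finite) set"
  assumes W: "vec.subspace W" and z: "\<And>x. (\<And>w. w \<in> W \<Longrightarrow> (\<Sum>i\<in>UNIV. w $ i * x $ i) = 0) \<Longrightarrow> x = 0"
  shows "W = UNIV"
proof -
  obtain C where C: "C \<subseteq> W" "vec.independent C" "W \<subseteq> vec.span C" "card C = vec.dim W"
    using vec.basis_exists by blast
  have finC: "finite C" using C(2) by (rule vec.finiteI_independent)
  have "card C \<le> card (UNIV :: 'n set)"
    using C(4) vec.dim_subset_UNIV[of W] by (simp add: vec.dimension_def card_cart_basis)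
  then obtain g where g: "g ` C \<subseteq> (UNIV :: 'n set)" "inj_on g C"
    using card_le_inj[OF finC, of "UNIV :: 'n set"] by auto
  define f where "f = (\<lambda>i. if i \<in> g ` C then inv_into C g i else 0)"
  have fW: "f i \<in> W" for i
    using C(1) vec.subspace_0[OF W] by (auto simp: f_def inv_into_into g subset_iff)
  have fg: "f (g b) = b" if "b \<in> C" for b using that g(2) by (simp add: f_def)
  define A where "A = (\<chi> i. f i)"
  have inj: "x = 0" if x: "A *v x = 0" for x
  proof (rule z)
    fix w assume "w \<in> W"
    then have "w \<in> vec.span C" using C by auto
    then show "(\<Sum>i\<in>UNIV. w $ i * x $ i) = 0"
    proof (induction rule: vec.span_induct_alt)
      case (step c b y)
      have "(A *v x) $ g b = 0" by (simp add: x)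
      then have "(\<Sum>i\<in>UNIV. b $ i * x $ i) = 0" by (simp add: A_def matrix_vector_mult_def fg step)
      then have "(\<Sum>i\<in>UNIV. c * (b $ i * x $ i)) = 0" by (simp flip: sum_distrib_left)
      then show ?case using step by (simp add: distrib_right sum.distrib mult.assoc)
    qed simp
  qed
  have "\<exists>A'. A' ** A = mat 1"
    unfolding matrix_left_invertible_ker using inj by blast
  then obtain A' where A': "A' ** A = mat 1" by blast
  have "axis i 1 \<in> W" for i
  proof -
    have "axis i 1 = (\<Sum>j\<in>UNIV. A' $ i $ j *s f j)"
    proof (simp add: vec_eq_iff, intro allI)
      fix l
      have "(\<Sum>j\<in>UNIV. A' $ i $ j * f j $ l) = (A' ** A) $ i $ l"
        by (simp add: matrix_matrix_mult_def A_def)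
      then show "axis i 1 $ l = (\<Sum>j\<in>UNIV. A' $ i $ j * f j $ l)"
        unfolding A' by (simp add: mat_def axis_def)
    qed
    then show ?thesis using W fW by (simp add: vec.subspace_sum vec.subspace_scale)
  qed
  then have "x \<in> W" for x
    using basis_expansion[of x] vec.subspace_sum[OF W, of UNIV "\<lambda>i. x $ i *s axis i 1"]
    by (simp add: vec.subspace_scale W)
  then show ?thesis by auto
qed

section \<open>The given arrangement and its localisations at flats\<close>

locale arrangement_data =
  fixes A :: "('k::field ^ 'n::{finite,linorder}) set set"
    and \<alpha> :: "('k ^ 'n::{finite,linorder}) set \<Rightarrow> ('n, 'k) mpoly"
  assumes arrA: "arrangement A" and def\<alpha>: "\<forall>H\<in>A. defines_hyperplane (\<alpha> H) H"
begin

definition nv :: "('k ^ 'n::{finite,linorder}) set \<Rightarrow> 'k ^ 'n::{finite,linorder}"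
  where "nv H = (SOME b. \<alpha> H = linear_form b \<and> H = {v. (\<Sum>i\<in>UNIV. b $ i * v $ i) = 0})"

lemma nv:
  assumes "H \<in> A"
  shows "\<alpha> H = linear_form (nv H)" "H = {v. (\<Sum>i\<in>UNIV. nv H $ i * v $ i) = 0}"
proof -
  have "\<exists>b. \<alpha> H = linear_form b \<and> H = {v. (\<Sum>i\<in>UNIV. b $ i * v $ i) = 0}"
    using def\<alpha> assms by (auto simp: defines_hyperplane_def)
  from someI_ex[OF this] show "\<alpha> H = linear_form (nv H)" "H = {v. (\<Sum>i\<in>UNIV. nv H $ i * v $ i) = 0}"
    by (simp_all add: nv_def)
qed

lemma nv_nonzero:
  assumes "H \<in> A"
  shows "nv H \<noteq> 0"
proof
  assume "nv H = 0"
  then have "H = UNIV" using nv(2)[OF assms] by simp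
  moreover have "vec.dim H + 1 = CARD('n)"
    using arrA assms by (auto simp: arrangement_def hyperplane_def)
  ultimately show False by (simp add: vec.dim_UNIV vec.dimension_def card_cart_basis)
qed

lemma arr_subset:
  assumes "B \<subseteq> A"
  shows "arr nv B"
proof
  show "finite B" using arrA assms finite_subset by (auto simp: arrangement_def)
  show "nv H \<noteq> 0" if "H \<in> B" for H using nv_nonzero assms that by blast
  show "\<not> linear_form (nv H) dvd linear_form (nv H')" if H: "H \<in> B" "H' \<in> B" "H \<noteq> H'" for H H'
  proof
    assume "linear_form (nv H) dvd linear_form (nv H')"
    then obtain c where c: "nv H' = c *s nv H"
      using linear_form_dvd_linear_form nv_nonzero assms H by blast
    then have "c \<noteq> 0" using nv_nonzero[of H'] assms H by auto
    then have "(\<Sum>i\<in>UNIV. nv H' $ i * v $ i) = 0 \<longleftrightarrow> (\<Sum>i\<in>UNIV. nv H $ i * v $ i) = 0" for v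
      by (simp add: c mult.assoc flip: sum_distrib_left)
    then show False using nv(2)[of H] nv(2)[of H'] assms H by auto
  qed
qed

lemma defining_poly_arr: "B \<subseteq> A \<Longrightarrow> defining_poly \<alpha> B = arr.Q nv B"
  using arr.Q_def[OF arr_subset] nv(1) by (simp add: defining_poly_def subset_iff)

lemma localization_subset: "localization A X \<subseteq> A"
  by (auto simp: localization_def)

lemma Q_localization:
  "arr.Q nv A = arr.Q nv (localization A X) * (\<Prod>H\<in>A - localization A X. \<alpha> H)"
proof -
  have "finite A" using arrA by (simp add: arrangement_def)
  then show ?thesis
    unfolding arr.Q_def[OF arr_subset[OF subset_refl]] arr.Q_def[OF arr_subset[OF localization_subset]]
    using prod.subset_diff[OF localization_subset, of "\<lambda>H. linear_form (nv H)" X] nv(1)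
    by (simp add: mult.commute)
qed

lemma good_localization_if_Proj:
  assumes good: "\<forall>P\<in>Proj. good (- P) q (arr.Q nv A)"
    and X: "X \<in> intersection_lattice A" "codim X < CARD('n)"
  shows "good {t. t dvd 1} q (arr.Q nv (localization A X))"
proof -
  let ?B = "localization A X"
  interpret A: arr nv A by (rule arr_subset) simp
  interpret B: arr nv ?B by (rule arr_subset[OF localization_subset])
  let ?e = "ee TYPE('n) q"
  have Xsub: "vec.subspace X"
    using X(1) arrA by (auto simp: intersection_lattice_def arrangement_def hyperplane_def intro!: vec.subspace_Inter)
  have "vec.dim X \<noteq> 0" using X(2) unfolding codim_def by (intro notI) simp
  then obtain x where x: "x \<in> X" "x \<noteq> 0" by (auto simp: vec.dim_eq_0)
  \<comment> \<open>A projection of \<open>V\<close> onto \<open>X\<close>. The kernel of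
    \<open>lsub M\<close> is the generic point of \<open>X\<close>, and the covectors killed by
    \<open>M\<close> are those vanishing on \<open>X\<close>.\<close>
  obtain p where p: "Vector_Spaces.linear (*s) (*s) p" "range p \<subseteq> X" "\<And>v. v \<in> X \<Longrightarrow> p v = v"
    using vec.linear_exists_left_inverse_on[OF vec.linear_id Xsub] by auto
  define M where "M = matrix p"
  have M: "M *v v = p v" for v by (simp add: M_def matrix_works p(1))
  have "M *v x = x" using M p x by simp
  then have "M \<noteq> 0" using x by auto
  then have Proj: "{f. lsub M f = 0} \<in> Proj" by (rule ker_lsub_Proj)
  have adj: "(\<Sum>i\<in>UNIV. (b v* M) $ i * v $ i) = (\<Sum>i\<in>UNIV. b $ i * (M *v v) $ i)" for b v
  proof -
    have "(\<Sum>i\<in>UNIV. (b v* M) $ i * v $ i) = (\<Sum>i\<in>UNIV. \<Sum>j\<in>UNIV. b $ j * M $ j $ i * v $ i)"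
      by (simp add: vector_matrix_mult_def sum_distrib_right sum_distrib_left ac_simps)
    also have "\<dots> = (\<Sum>j\<in>UNIV. \<Sum>i\<in>UNIV. b $ j * M $ j $ i * v $ i)" by (rule sum.swap)
    finally show ?thesis by (simp add: matrix_vector_mult_def sum_distrib_left mult.assoc)
  qed
  have M0: "nv H v* M = 0 \<longleftrightarrow> X \<subseteq> H" if H: "H \<in> A" for H
  proof
    assume "nv H v* M = 0"
    then have z: "(\<Sum>i\<in>UNIV. nv H $ i * (M *v v) $ i) = 0" for v using adj[of "nv H" v] by simp
    show "X \<subseteq> H"
    proof
      fix v assume "v \<in> X"
      then have "M *v v = v" using p(3) M by simp
      then show "v \<in> H" using z[of v] by (subst nv(2)[OF H]) simp
    qed
  next
    assume "X \<subseteq> H"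
    have "(nv H v* M) $ j = 0" for j
    proof -
      have "M *v axis j 1 \<in> H" using \<open>X \<subseteq> H\<close> p(2) M by auto
      then have "(\<Sum>i\<in>UNIV. (nv H v* M) $ i * axis j 1 $ i) = 0"
        unfolding adj by (subst (asm) nv(2)[OF H]) simp
      then show ?thesis by (simp add: axis_def if_distrib[of "\<lambda>x. _ * x"] cong: if_cong)
    qed
    then show "nv H v* M = 0" by (simp add: vec_eq_iff)
  qed
  obtain \<theta> t where \<theta>: "\<And>I. I \<in> idx q \<Longrightarrow> \<theta> I \<in> lattice q A.Q" and t: "lsub M t \<noteq> 0"
    and det: "det (pdm q \<theta>) = A.Q ^ ?e * t"
    using good Proj by (fastforce simp: good_def)
  \<comment> \<open>The subarrangement imposes fewer conditions. The factors by which
    \<open>A.Q\<close> exceeds \<open>B.Q\<close> are nonzero at the generic point of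
    \<open>X\<close> and join \<open>t\<close>.\<close>
  have "\<theta> I \<in> lattice q B.Q" if "I \<in> idx q" for I
    using \<theta>[OF that] localization_subset[of X] unfolding A.lattice_iff B.lattice_iff by blast
  moreover have "det (pdm q \<theta>) = B.Q ^ ?e * ((\<Prod>H\<in>A - ?B. \<alpha> H) ^ ?e * t)"
    by (simp add: det Q_localization[of X] power_mult_distrib mult.assoc)
  moreover have "lsub M ((\<Prod>H\<in>A - ?B. \<alpha> H) ^ ?e * t) \<noteq> 0"
  proof -
    have "lsub M (\<alpha> H) \<noteq> 0" if "H \<in> A - ?B" for H
      using that M0[of H] nv(1)[of H] by (auto simp: lsub_linear_form localization_def)
    then show ?thesis
      using t A.finB by (simp add: rhom_mult rhom_power rhom_prod rhom_lsub)
  qed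
  ultimately have "good {f. lsub M f \<noteq> 0} q B.Q" unfolding good_def by blast
  then show ?thesis
    using B.good_units_of_good_ker M0 by (auto simp: localization_def)
qed

lemma good_Proj_if_localization:
  assumes good: "\<forall>X\<in>intersection_lattice A. codim X < CARD('n) \<longrightarrow>
      good {t. t dvd 1} q (arr.Q nv (localization A X))"
    and ess: "essential A" and P: "P \<in> Proj"
  shows "good (- P) q (arr.Q nv A)"
proof -
  define X where "X = \<Inter>{H\<in>A. \<alpha> H \<in> P}"
  let ?B = "localization A X"
  let ?e = "ee TYPE('n) q"
  interpret A: arr nv A by (rule arr_subset) simp
  interpret B: arr nv ?B by (rule arr_subset[OF localization_subset])
  note sat = satur_compl_Proj[OF P]
  have X: "X \<in> intersection_lattice A" by (auto simp: intersection_lattice_def X_def)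
  \<comment> \<open>Otherwise the linear forms in \<open>P\<close> would have no common zero but 0,
    hence would be all linear forms, and \<open>P\<close> would contain all coordinates.\<close>
  have "vec.dim X \<noteq> 0"
  proof
    assume "vec.dim X = 0"
    then have X0: "X \<subseteq> {0}" by (simp add: vec.dim_eq_0)
    let ?W = "{b. linear_form b \<in> P}"
    have "vec.subspace ?W"
      using ideal_set_Proj[OF P]
      by (simp add: vec.subspace_def linear_form_add linear_form_scale ideal_set_def)
    moreover have "x = 0" if "\<And>w. w \<in> ?W \<Longrightarrow> (\<Sum>i\<in>UNIV. w $ i * x $ i) = 0" for x
    proof -
      have "x \<in> X" unfolding X_def using that nv by fastforce
      then show ?thesis using X0 by auto
    qed
    ultimately have "?W = UNIV" by (rule subspace_eq_UNIV_of_annihilator)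
    then have "coord i \<in> P" for i using linear_form_axis[of i] by (metis UNIV_I mem_Collect_eq)
    then show False using Proj_coord[OF P] by blast
  qed
  moreover have "vec.dim X \<le> CARD('n)"
    using vec.dim_subset_UNIV[of X] by (simp add: vec.dimension_def card_cart_basis)
  ultimately have "codim X < CARD('n)" unfolding codim_def by (simp only: diff_less zero_less_card_finite gr_zeroI)
  then obtain \<theta> t where \<theta>: "\<And>I. I \<in> idx q \<Longrightarrow> \<theta> I \<in> lattice q B.Q" and t: "t dvd 1"
    and det: "det (pdm q \<theta>) = B.Q ^ ?e * t"
    using good[rule_format, OF X] by (auto simp: good_def)
  define h where "h = (\<Prod>H\<in>A - ?B. \<alpha> H)"
  have "\<alpha> H \<in> - P" if "H \<in> A - ?B" for H
    using that by (auto simp: localization_def X_def)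
  then have h: "h \<in> - P" unfolding h_def by (rule satur_prod[OF sat])
  have "t \<in> - P" using t sat unfolding satur_def by (metis dvd_def)
  have "(\<lambda>J. h * \<theta> I J) \<in> lattice q A.Q" if "I \<in> idx q" for I
    unfolding A.lattice_iff
  proof (intro conjI allI impI ballI)
    fix J :: "'n set" assume "J \<notin> idx q"
    then show "h * \<theta> I J = 0" using lattice_supp[OF \<theta>[OF that]] by simp
  next
    fix H J assume H: "H \<in> A"
    show "linear_form (nv H) dvd wdg (cv (nv H)) (\<lambda>J. h * \<theta> I J) J"
    proof (cases "H \<in> ?B")
      case True
      then show ?thesis using \<theta>[OF that] unfolding B.lattice_iff wdg_scale by (metis dvd_mult)
    next
      case False
      then have "\<alpha> H dvd h" unfolding h_def using H A.finB by (intro dvd_prodI) auto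
      then show ?thesis unfolding wdg_scale using nv(1)[OF H] by simp
    qed
  qed
  \<comment> \<open>Scaling all rows contributes \<open>h ^ card (idx q)\<close>; of these factors,
    \<open>?e\<close> complete the power of \<open>B.Q\<close> to that of \<open>A.Q\<close>, and
    the others stay outside \<open>P\<close>.\<close>
  moreover have "det (pdm q (\<lambda>I J. h * \<theta> I J)) = A.Q ^ ?e * (h ^ (card (idx q :: 'n set set) - ?e) * t)"
  proof -
    have "h ^ card (idx q :: 'n set set) = h ^ ?e * h ^ (card (idx q :: 'n set set) - ?e)"
      using ee_le[where q=q and 'n='n] by (simp flip: power_add)
    then show ?thesis
      unfolding det_mult_rows_pdm det Q_localization[of X] h_def[symmetric] power_mult_distrib
      by (simp add: mult.assoc mult.left_commute)
  qed
  moreover have "h ^ (card (idx q :: 'n set set) - ?e) * t \<in> - P"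
    using satur_power[OF sat h] \<open>t \<in> - P\<close> sat by (simp add: satur_def)
  ultimately show ?thesis
    unfolding good_def by (intro exI[of _ "\<lambda>I J. h * \<theta> I J"] conjI ballI bexI)
qed

end

section \<open>Free modules\<close>

text \<open>Counts dimensions in the space of vectors supported on \<open>D\<close>. A priori
  \<open>Y\<close> may be infinite, hence the finite subsets. The bijection re-indexes a basis by
  \<open>idx q\<close>, so that its determinant can be formed.\<close>

lemma bij_betw_basis:
  fixes v :: "'y \<Rightarrow> 'i::finite \<Rightarrow> 'f::field"
  assumes supp: "\<And>y i. y \<in> Y \<Longrightarrow> i \<notin> D \<Longrightarrow> v y i = 0"
    and indep: "\<And>F c. finite F \<Longrightarrow> F \<subseteq> Y \<Longrightarrow> (\<And>i. (\<Sum>y\<in>F. c y * v y i) = 0) \<Longrightarrow> \<forall>y\<in>F. c y = 0"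
    and gen: "\<And>i. i \<in> D \<Longrightarrow> \<exists>F c. finite F \<and> F \<subseteq> Y \<and> (\<forall>j. (\<Sum>y\<in>F. c y * v y j) = (if j = i then 1 else 0))"
  shows "\<exists>\<beta>. bij_betw \<beta> D Y"
proof -
  define w where "w y = (\<chi> i. v y i)" for y
  define W where "W = {x :: 'f ^ 'i. \<forall>i. i \<notin> D \<longrightarrow> x $ i = 0}"
  have inj: "inj_on w Y"
  proof (rule inj_onI, rule ccontr)
    fix y y' assume y: "y \<in> Y" "y' \<in> Y" "w y = w y'" "y \<noteq> y'"
    then have "v y i = v y' i" for i by (simp add: w_def vec_eq_iff)
    then have "\<forall>z\<in>{y, y'}. (if z = y then 1 else -1) = (0::'f)"
      by (intro indep) (use y in auto)
    then show False by simp
  qed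
  have subW: "w ` Y \<subseteq> W" using supp by (auto simp: W_def w_def)
  have ind: "vec.independent (w ` Y)"
    unfolding vec.independent_explicit_finite_subsets
  proof (intro allI impI ballI)
    fix S u x assume S: "S \<subseteq> w ` Y" "finite S" "(\<Sum>v\<in>S. u v *s v) = 0" "x \<in> S"
    then obtain F where F: "F \<subseteq> Y" "finite F" "S = w ` F"
      using finite_subset_image[OF S(2,1)] by blast
    have injF: "inj_on w F" using inj F inj_on_subset by blast
    have "(\<Sum>y\<in>F. u (w y) * v y i) = 0" for i
    proof -
      have "(\<Sum>y\<in>F. u (w y) *s w y) $ i = 0"
        using S(3) by (simp add: F(3) sum.reindex[OF injF])
      then show ?thesis by (simp add: w_def)
    qed
    then have "\<forall>y\<in>F. u (w y) = 0" by (rule indep[OF F(2,1)])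
    then show "u x = 0" using S(4) F(3) by auto
  qed
  have expand: "x = (\<Sum>i\<in>D. x $ i *s axis i 1)" if "x \<in> W" for x
  proof -
    have "(\<Sum>i\<in>D. x $ i *s axis i 1) = (\<Sum>i\<in>UNIV. x $ i *s axis i 1)"
      by (rule sum.mono_neutral_left) (use that in \<open>auto simp: W_def\<close>)
    then show ?thesis by (simp add: basis_expansion)
  qed
  have ax: "axis i 1 \<in> vec.span (w ` Y)" if i: "i \<in> D" for i
  proof -
    obtain F c where F: "F \<subseteq> Y" "\<And>j. (\<Sum>y\<in>F. c y * v y j) = (if j = i then 1 else 0)"
      using gen[OF i] by blast
    have "axis i 1 = (\<Sum>y\<in>F. c y *s w y)"
      using F(2) by (auto simp: vec_eq_iff axis_def w_def)
    also have "\<dots> \<in> vec.span (w ` Y)"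
      using F(1) by (intro vec.span_sum vec.span_scale vec.span_base) auto
    finally show ?thesis .
  qed
  have "W \<subseteq> vec.span (w ` Y)"
  proof
    fix x assume "x \<in> W"
    then have "x = (\<Sum>i\<in>D. x $ i *s axis i 1)" by (rule expand)
    also have "\<dots> \<in> vec.span (w ` Y)" using ax by (intro vec.span_sum vec.span_scale)
    finally show "x \<in> vec.span (w ` Y)" .
  qed
  then have 1: "card (w ` Y) = vec.dim W"
    using subW ind by (intro vec.basis_card_eq_dim)
  let ?U = "(\<lambda>i. axis i (1::'f)) ` D"
  have "vec.independent ?U"
    by (rule vec.independent_mono[OF independent_cart_basis]) (auto simp: cart_basis_def)
  moreover have "W \<subseteq> vec.span ?U"
  proof
    fix x assume "x \<in> W"
    then have "x = (\<Sum>i\<in>D. x $ i *s axis i 1)" by (rule expand)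
    also have "\<dots> \<in> vec.span ?U" by (intro vec.span_sum vec.span_scale vec.span_base) auto
    finally show "x \<in> vec.span ?U" .
  qed
  moreover have "?U \<subseteq> W" by (auto simp: W_def axis_def)
  ultimately have "card ?U = vec.dim W" by (intro vec.basis_card_eq_dim)
  moreover have "card ?U = card D" by (rule card_image) (auto simp: inj_on_def axis_eq_axis)
  ultimately have "card Y = card D" using 1 card_image[OF inj] by simp
  moreover have "finite Y"
    using vec.finiteI_independent[OF ind] finite_image_iff[OF inj] by simp
  ultimately show ?thesis
    using finite_same_card_bij[of D Y] by simp
qed

lemma clear_denominators:
  fixes k :: "'y \<Rightarrow> ('n::{finite,linorder}, 'k::field) mpoly fract"
  assumes T: "satur T" and "finite F" and k: "\<And>y. y \<in> F \<Longrightarrow> \<exists>d\<in>T. \<exists>n. to_frac d * k y = to_frac n"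
  obtains g s where "g \<in> T" "\<And>y. y \<in> F \<Longrightarrow> to_frac g * k y = to_frac (s y)"
proof -
  have "\<exists>g\<in>T. \<forall>y\<in>F. \<exists>s. to_frac g * k y = to_frac s"
    using assms(2) k
  proof (induction F rule: finite_induct)
    case empty
    show ?case using T by (auto simp: satur_def)
  next
    case (insert y F)
    then obtain g where g: "g \<in> T" "\<And>y. y \<in> F \<Longrightarrow> \<exists>s. to_frac g * k y = to_frac s" by auto
    obtain n d where nd: "to_frac d * k y = to_frac n" "d \<in> T" using insert.prems by blast
    have "to_frac (g * d) * k y = to_frac (g * n)"
      by (simp add: rhom_mult[OF rhom_to_frac] mult.assoc flip: nd(1))
    moreover have "\<exists>s. to_frac (g * d) * k z = to_frac s" if z: "z \<in> F" for z
    proof -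
      obtain s where "to_frac g * k z = to_frac s" using g(2)[OF z] by blast
      then have "to_frac (g * d) * k z = to_frac (d * s)"
        by (simp add: rhom_mult[OF rhom_to_frac] mult.commute mult.left_commute)
      then show ?thesis by blast
    qed
    moreover have "g * d \<in> T" using g nd T by (simp add: satur_def)
    ultimately show ?case by (intro bexI[of _ "g * d"]) auto
  qed
  then show ?thesis using that by metis
qed

lemma ex_denominator:
  fixes k :: "('n::{finite,linorder}, 'k::field) mpoly fract"
  shows "\<exists>d\<in>- {0}. \<exists>n. to_frac d * k = to_frac n"
proof -
  obtain n d where nd: "k = Fract n d" "d \<noteq> 0" by (cases k) auto
  then have "to_frac d * k = to_frac n" by (simp add: to_frac_def eq_fract)
  then show ?thesis using nd(2) by blast
qed

lemma satur_nonzero: "satur (- {0})"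
  by (simp add: satur_def)

text \<open>Over \<open>K\<close> the coefficient vectors are a basis of the space with coordinates
  \<open>idx q\<close>: independence over \<open>S\<close> persists after clearing denominators, and
  expanding the elements \<open>Q\<close> times \<open>dx\<^sub>I\<close> yields the unit vectors.
  So \<open>Y\<close> has the size needed for \<open>det_of_local_generators\<close>.\<close>

lemma (in arr) good_of_basis:
  fixes m :: "'y \<Rightarrow> 'n set \<Rightarrow> ('n, 'k) mpoly"
  assumes T: "satur T"
    and m: "\<And>y. y \<in> Y \<Longrightarrow> m y \<in> lattice q Q"
    and indep: "\<And>F c. finite F \<Longrightarrow> F \<subseteq> Y \<Longrightarrow> (\<And>J. (\<Sum>y\<in>F. c y * m y J) = 0) \<Longrightarrow> \<forall>y\<in>F. c y = 0"
    and gen: "\<And>\<eta>. \<eta> \<in> lattice q Q \<Longrightarrow>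
      \<exists>t\<in>T. \<exists>F c. finite F \<and> F \<subseteq> Y \<and> (\<forall>J. t * \<eta> J = (\<Sum>y\<in>F. c y * m y J))"
  shows "good T q Q"
proof -
  have "\<exists>\<beta>. bij_betw \<beta> (idx q :: 'n set set) Y"
  proof (rule bij_betw_basis[where Y=Y and D="idx q" and v="\<lambda>y J. to_frac (m y J)"])
    fix y and J :: "'n set" assume "y \<in> Y" "J \<notin> idx q"
    then show "to_frac (m y J) = 0" using lattice_supp[OF m] by simp
  next
    fix F k assume F: "finite F" "F \<subseteq> Y" and z: "\<And>J. (\<Sum>y\<in>F. k y * to_frac (m y J)) = 0"
    obtain g s where "g \<in> - {0}" and gs: "\<And>y. y \<in> F \<Longrightarrow> to_frac g * k y = to_frac (s y)"
      by (rule clear_denominators[OF satur_nonzero F(1), of k]) (use ex_denominator in auto)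
    then have g: "g \<noteq> 0" by simp
    have "(\<Sum>y\<in>F. s y * m y J) = 0" for J
    proof -
      have "to_frac (\<Sum>y\<in>F. s y * m y J) = (\<Sum>y\<in>F. to_frac g * k y * to_frac (m y J))"
        by (simp add: rhom_sum rhom_mult rhom_to_frac gs)
      also have "\<dots> = 0" using z[of J] by (simp add: mult.assoc flip: sum_distrib_left)
      finally show ?thesis by simp
    qed
    then have "\<forall>y\<in>F. s y = 0" by (rule indep[OF F])
    then have "to_frac g * k y = 0" if "y \<in> F" for y using gs[OF that] that by simp
    then show "\<forall>y\<in>F. k y = 0" using g by simp
  next
    fix I :: "'n set" assume I: "I \<in> idx q"
    obtain t F c where t: "t \<in> T" and F: "finite F" "F \<subseteq> Y"
      and c: "\<And>J. t * (Q * ub I J) = (\<Sum>y\<in>F. c y * m y J)"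
      using gen[OF Q_ub_in_lattice[OF I]] by blast
    have "t \<noteq> 0" using t T by (auto simp: satur_def)
    have "(\<Sum>y\<in>F. to_frac (c y) / to_frac (t * Q) * to_frac (m y J)) = (if J = I then 1 else 0)" for J
    proof -
      have "(\<Sum>y\<in>F. to_frac (c y) / to_frac (t * Q) * to_frac (m y J)) =
          (\<Sum>y\<in>F. to_frac (c y) * to_frac (m y J)) / to_frac (t * Q)"
        by (simp add: sum_divide_distrib)
      also have "(\<Sum>y\<in>F. to_frac (c y) * to_frac (m y J)) = to_frac (t * (Q * ub I J))"
        unfolding c rhom_sum[OF rhom_to_frac] rhom_mult[OF rhom_to_frac] ..
      also have "\<dots> / to_frac (t * Q) = (if J = I then 1 else 0)"
      proof (cases "J = I")
        case True
        have "to_frac (t * Q) \<noteq> 0" using \<open>t \<noteq> 0\<close> Q_nonzero by simp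
        then show ?thesis using True by (simp add: ub_def)
      qed (simp add: ub_def)
      finally show ?thesis .
    qed
    then show "\<exists>F k. finite F \<and> F \<subseteq> Y \<and> (\<forall>J. (\<Sum>y\<in>F. k y * to_frac (m y J)) = (if J = I then 1 else 0))"
      using F by (intro exI[of _ F] exI[of _ "\<lambda>y. to_frac (c y) / to_frac (t * Q)"] conjI allI)
  qed
  then obtain \<beta> where \<beta>: "bij_betw \<beta> (idx q :: 'n set set) Y" by blast
  then have "finite Y" using bij_betw_finite[OF \<beta>] by simp
  have \<theta>: "m (\<beta> I) \<in> lattice q Q" if "I \<in> idx q" for I
    using m bij_betwE[OF \<beta>] that by blast
  have "\<exists>t\<in>T. det (pdm q (\<lambda>I. m (\<beta> I))) = Q ^ ee TYPE('n) q * t"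
  proof (rule det_of_local_generators[OF T \<theta>])
    fix \<eta> assume "\<eta> \<in> lattice q Q"
    then obtain t F c where t: "t \<in> T" and F: "finite F" "F \<subseteq> Y"
      and c: "\<And>J. t * \<eta> J = (\<Sum>y\<in>F. c y * m y J)"
      using gen[of \<eta>] by blast
    have "t * \<eta> J = (\<Sum>I\<in>idx q. (if \<beta> I \<in> F then c (\<beta> I) else 0) * m (\<beta> I) J)" for J
    proof -
      have "(\<Sum>y\<in>F. c y * m y J) = (\<Sum>y\<in>Y. (if y \<in> F then c y else 0) * m y J)"
        by (rule sum.mono_neutral_cong_left) (use F \<open>finite Y\<close> in auto)
      then show ?thesis
        using sum.reindex_bij_betw[OF \<beta>, of "\<lambda>y. (if y \<in> F then c y else 0) * m y J"] c by simp
    qed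
    then show "\<exists>t\<in>T. \<exists>c. \<forall>J. t * \<eta> J = (\<Sum>I\<in>idx q. c I * m (\<beta> I) J)"
      using t by (intro bexI[of _ t] exI) auto
  qed
  then show ?thesis
    unfolding good_def using \<theta> by (intro exI[of _ "\<lambda>I. m (\<beta> I)"]) blast
qed

text \<open>The common setting of \<open>log_der\<close> and \<open>log_forms\<close>, where
  \<open>\<phi>\<close> identifies \<open>Minf\<close> with the lattice. It takes values in
  \<open>K\<close> because it is defined on the whole ambient module, whose elements need not have
  coefficients in \<open>S\<close>.\<close>

locale lattice_module = arr a B + module smul
  for a :: "'h \<Rightarrow> 'k::field ^ 'n::{finite,linorder}" and B :: "'h set"
    and smul :: "('n::{finite,linorder}, 'k::field) mpoly \<Rightarrow> 'm::ab_group_add \<Rightarrow> 'm" +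
  fixes \<phi> :: "'m \<Rightarrow> 'n set \<Rightarrow> ('n, 'k) mpoly fract" and q :: int and Minf :: "'m set"
  assumes \<phi>_add: "\<phi> (m + m') I = \<phi> m I + \<phi> m' I"
    and \<phi>_smul: "\<phi> (smul f m) I = to_frac f * \<phi> m I"
    and Minf: "subspace Minf"
    and \<phi>_inj: "m \<in> Minf \<Longrightarrow> (\<And>I. \<phi> m I = 0) \<Longrightarrow> m = 0"
    and \<phi>_lattice: "m \<in> Minf \<Longrightarrow> \<exists>\<eta>\<in>lattice q Q. \<phi> m = (\<lambda>I. to_frac (\<eta> I))"
    and \<phi>_surj: "\<eta> \<in> lattice q Q \<Longrightarrow> \<exists>m\<in>Minf. \<phi> m = (\<lambda>I. to_frac (\<eta> I))"
begin

lemma \<phi>_0: "\<phi> 0 I = 0"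
  using \<phi>_smul[of 0 0 I] by simp

lemma \<phi>_sum: "\<phi> (sum f X) I = (\<Sum>x\<in>X. \<phi> (f x) I)"
  by (induction X rule: infinite_finite_induct) (simp_all add: \<phi>_0 \<phi>_add)

lemma \<phi>_diff: "\<phi> (m - m') I = \<phi> m I - \<phi> m' I"
  using \<phi>_add[of "m - m'" m' I] by simp

lemma \<phi>_eqD:
  assumes "m \<in> Minf" "m' \<in> Minf" "\<And>I. \<phi> m I = \<phi> m' I"
  shows "m = m'"
proof -
  have "m - m' = 0"
    by (rule \<phi>_inj) (use assms Minf in \<open>auto simp: subspace_diff \<phi>_diff\<close>)
  then show ?thesis by simp
qed

definition coeffs :: "'m \<Rightarrow> 'n set \<Rightarrow> ('n, 'k) mpoly"
  where "coeffs m = (SOME \<eta>. \<eta> \<in> lattice q Q \<and> \<phi> m = (\<lambda>I. to_frac (\<eta> I)))"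

lemma coeffs:
  assumes "m \<in> Minf"
  shows "coeffs m \<in> lattice q Q" "\<phi> m I = to_frac (coeffs m I)"
proof -
  have "\<exists>\<eta>. \<eta> \<in> lattice q Q \<and> \<phi> m = (\<lambda>I. to_frac (\<eta> I))"
    using \<phi>_lattice[OF assms] by blast
  from someI_ex[OF this] have "coeffs m \<in> lattice q Q \<and> \<phi> m = (\<lambda>I. to_frac (coeffs m I))"
    by (simp only: coeffs_def)
  then show "coeffs m \<in> lattice q Q" "\<phi> m I = to_frac (coeffs m I)" by simp_all
qed

lemma free_iff_good: "free_submodule smul Minf \<longleftrightarrow> good {t. t dvd 1} q Q"
proof
  assume "free_submodule smul Minf"
  then obtain B0 where ind: "\<not> dependent B0" and span: "span B0 = Minf"
    by (auto simp: free_submodule_def)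
  have BM: "b \<in> Minf" if "b \<in> B0" for b using span_base[OF that] span by simp
  show "good {t. t dvd 1} q Q"
  proof (rule good_of_basis[OF satur_units, where Y=B0 and m=coeffs])
    fix F c assume F: "finite F" "F \<subseteq> B0" and z: "\<And>J. (\<Sum>y\<in>F. c y * coeffs y J) = 0"
    have "(\<Sum>y\<in>F. smul (c y) y) = 0"
    proof (rule \<phi>_inj)
      show "(\<Sum>y\<in>F. smul (c y) y) \<in> Minf"
        using F BM Minf by (intro subspace_sum subspace_scale) auto
      fix I
      have "\<phi> (\<Sum>y\<in>F. smul (c y) y) I = (\<Sum>y\<in>F. to_frac (c y) * to_frac (coeffs y I))"
        unfolding \<phi>_sum \<phi>_smul by (rule sum.cong) (use F BM coeffs(2) in auto)
      also have "\<dots> = to_frac (\<Sum>y\<in>F. c y * coeffs y I)"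
        by (simp add: rhom_sum rhom_mult rhom_to_frac)
      finally show "\<phi> (\<Sum>y\<in>F. smul (c y) y) I = 0" using z by simp
    qed
    then show "\<forall>y\<in>F. c y = 0" using ind F unfolding dependent_explicit by blast
  next
    fix \<eta> assume "\<eta> \<in> lattice q Q"
    then obtain m where m: "m \<in> Minf" "\<phi> m = (\<lambda>I. to_frac (\<eta> I))" using \<phi>_surj by blast
    then obtain F r where F: "finite F" "F \<subseteq> B0" "m = (\<Sum>y\<in>F. smul (r y) y)"
      using span by (auto simp: span_explicit)
    have "1 * \<eta> J = (\<Sum>y\<in>F. r y * coeffs y J)" for J
    proof -
      have "to_frac (\<eta> J) = \<phi> m J" using m by simp
      also have "\<dots> = (\<Sum>y\<in>F. to_frac (r y) * to_frac (coeffs y J))"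
        unfolding F(3) \<phi>_sum \<phi>_smul by (rule sum.cong) (use F BM coeffs(2) in auto)
      also have "\<dots> = to_frac (\<Sum>y\<in>F. r y * coeffs y J)"
        by (simp add: rhom_sum rhom_mult rhom_to_frac)
      finally show ?thesis by simp
    qed
    then show "\<exists>t\<in>{t. t dvd 1}. \<exists>F c. finite F \<and> F \<subseteq> B0 \<and> (\<forall>J. t * \<eta> J = (\<Sum>y\<in>F. c y * coeffs y J))"
      using F by (intro bexI[of _ 1] exI[of _ F] exI[of _ r]) auto
  qed (use BM coeffs in auto)
next
  assume "good {t. t dvd 1} q Q"
  then obtain \<theta> t where \<theta>: "\<And>I. I \<in> idx q \<Longrightarrow> \<theta> I \<in> lattice q Q" and t: "t dvd 1"
    and det: "det (pdm q \<theta>) = Q ^ ee TYPE('n) q * t" by (auto simp: good_def)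
  have tnz: "t \<noteq> 0" using t by auto
  have detnz: "det (pdm q \<theta>) \<noteq> 0" using det tnz Q_nonzero by simp
  have "\<exists>m. m \<in> Minf \<and> \<phi> m = (\<lambda>J. to_frac (\<theta> I J))" if "I \<in> idx q" for I
    using \<phi>_surj[OF \<theta>[OF that]] by blast
  then obtain b where b: "\<And>I. I \<in> idx q \<Longrightarrow> b I \<in> Minf"
    "\<And>I. I \<in> idx q \<Longrightarrow> \<phi> (b I) = (\<lambda>J. to_frac (\<theta> I J))" by metis
  have \<phi>b: "\<phi> (\<Sum>I\<in>idx q. smul (c I) (b I)) J = (\<Sum>I\<in>idx q. to_frac (c I) * to_frac (\<theta> I J))" for c J
    unfolding \<phi>_sum \<phi>_smul by (rule sum.cong) (simp_all add: b)
  \<comment> \<open>Since \<open>dependent\<close> speaks of sets, the family \<open>b\<close> has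
    to be injective before its independence can be transferred to its image.\<close>
  have inj: "inj_on b (idx q)"
  proof (rule inj_onI, rule ccontr)
    fix I I' assume I: "I \<in> idx q" "I' \<in> idx q" "b I = b I'" "I \<noteq> I'"
    then have eq: "\<theta> I J = \<theta> I' J" for J using b(2)[of I] b(2)[of I'] by (simp add: fun_eq_iff)
    define c :: "'n set \<Rightarrow> ('n, 'k) mpoly" where "c = (\<lambda>K. if K = I then 1 else if K = I' then - 1 else 0)"
    have "(\<Sum>K\<in>idx q. c K * \<theta> K J) = 0" for J
    proof -
      have "(\<Sum>K\<in>idx q. c K * \<theta> K J) = (\<Sum>K\<in>{I, I'}. c K * \<theta> K J)"
        by (rule sum.mono_neutral_right) (use I in \<open>auto simp: c_def\<close>)
      also have "\<dots> = 0" using I eq[of J] by (simp add: c_def)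
      finally show ?thesis .
    qed
    then have "c I = 0" by (rule det_pdm_row_indep_S[OF detnz _ I(1)])
    then have "(1 :: ('n, 'k) mpoly) = 0" by (simp add: c_def)
    then show False by simp
  qed
  have "\<not> dependent (b ` idx q)"
  proof
    assume "dependent (b ` idx q)"
    then obtain u where u: "\<exists>v\<in>b ` idx q. u v \<noteq> 0" "(\<Sum>v\<in>b ` idx q. smul (u v) v) = 0"
      unfolding dependent_finite[OF finite_imageI[OF finite]] by blast
    have z: "(\<Sum>I\<in>idx q. smul (u (b I)) (b I)) = 0"
      using u(2) by (simp add: sum.reindex[OF inj])
    have "u (b I) = 0" if "I \<in> idx q" for I
    proof -
      have "to_frac (u (b I)) = 0"
        by (rule det_pdm_row_indep[OF detnz _ that]) (use \<phi>b[of "\<lambda>I. u (b I)"] in \<open>simp add: z \<phi>_0\<close>)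
      then show ?thesis by simp
    qed
    then show False using u(1) by auto
  qed
  moreover have "span (b ` idx q) = Minf"
  proof
    show "span (b ` idx q) \<subseteq> Minf"
      by (rule span_minimal) (use b Minf in auto)
    show "Minf \<subseteq> span (b ` idx q)"
    proof
      fix m assume m: "m \<in> Minf"
      obtain c where c: "\<And>J. t * coeffs m J = (\<Sum>I\<in>idx q. c I * \<theta> I J)"
        by (rule cramer_lattice[of q \<theta> t "coeffs m"]) (use \<theta> det tnz coeffs(1)[OF m] in auto)
      \<comment> \<open>The inverse of the unit \<open>t\<close> removes the denominator from
        Cramer's formula.\<close>
      obtain t' where t': "t' * t = 1" using t by (metis dvd_def mult.commute)
      have "m = (\<Sum>I\<in>idx q. smul (t' * c I) (b I))"
      proof (rule \<phi>_eqD[OF m])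
        show "(\<Sum>I\<in>idx q. smul (t' * c I) (b I)) \<in> Minf"
          using b Minf by (intro subspace_sum subspace_scale) auto
        fix J
        have "\<phi> m J = to_frac (t' * (t * coeffs m J))"
          using t' by (simp add: coeffs(2)[OF m] flip: mult.assoc)
        also have "\<dots> = \<phi> (\<Sum>I\<in>idx q. smul (t' * c I) (b I)) J"
          by (simp add: c \<phi>b rhom_sum rhom_mult rhom_to_frac sum_distrib_left mult.assoc)
        finally show "\<phi> m J = \<phi> (\<Sum>I\<in>idx q. smul (t' * c I) (b I)) J" .
      qed
      also have "\<dots> \<in> span (b ` idx q)"
        by (intro span_sum span_scale span_base) auto
      finally show "m \<in> span (b ` idx q)" .
    qed
  qed
  ultimately show "free_submodule smul Minf" by (auto simp: free_submodule_def)
qed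

end

section \<open>Sections of the associated sheaf\<close>

lemma zariski_open_subset: "zariski_open U \<Longrightarrow> U \<subseteq> Proj"
  by (auto simp: zariski_open_def)

lemma zariski_open_inter:
  assumes "zariski_open U" "zariski_open V"
  shows "zariski_open (U \<inter> V)"
proof -
  obtain E F where E: "E \<subseteq> (\<Union>d. S_deg d)" "U = {P\<in>Proj. \<not> E \<subseteq> P}"
    and F: "F \<subseteq> (\<Union>d. S_deg d)" "V = {P\<in>Proj. \<not> F \<subseteq> P}"
    using assms by (auto simp: zariski_open_def)
  let ?G = "(\<lambda>(f, g). f * g) ` (E \<times> F)"
  have "U \<inter> V = {P\<in>Proj. \<not> ?G \<subseteq> P}"
  proof -
    have "?G \<subseteq> P \<longleftrightarrow> E \<subseteq> P \<or> F \<subseteq> P" if "P \<in> Proj" for P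
      using Proj_prime[OF that] by (auto simp: image_subset_iff subset_iff)
    then show ?thesis using E(2) F(2) by blast
  qed
  moreover have "?G \<subseteq> (\<Union>d. S_deg d)"
  proof
    fix x assume "x \<in> ?G"
    then obtain f g where x: "x = f * g" "f \<in> E" "g \<in> F" by auto
    then obtain d e where "f \<in> S_deg d" "g \<in> S_deg e" using E(1) F(1) by blast
    then have "x \<in> S_deg (d + e)" using x S_deg_mult by blast
    then show "x \<in> (\<Union>d. S_deg d)" by blast
  qed
  ultimately show ?thesis unfolding zariski_open_def by blast
qed

lemma zariski_open_principal: "g \<in> S_deg d \<Longrightarrow> zariski_open {P\<in>Proj. g \<notin> P}"
  unfolding zariski_open_def by (intro exI[of _ "{g}"]) auto

lemma zariski_open_finite_refine:
  assumes "zariski_open W" "P \<in> W"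
    and "\<And>i. i < (r::nat) \<Longrightarrow> \<exists>W'. zariski_open W' \<and> P \<in> W' \<and> \<Phi> i W'"
    and mono: "\<And>i V W. \<Phi> i W \<Longrightarrow> V \<subseteq> W \<Longrightarrow> \<Phi> i V"
  obtains W' where "zariski_open W'" "P \<in> W'" "W' \<subseteq> W" "\<And>i. i < r \<Longrightarrow> \<Phi> i W'"
proof -
  have "\<exists>W'. zariski_open W' \<and> P \<in> W' \<and> W' \<subseteq> W \<and> (\<forall>i<r. \<Phi> i W')"
    using assms(3)
  proof (induction r)
    case 0
    then show ?case using assms(1,2) by auto
  next
    case (Suc r)
    then obtain W1 where W1: "zariski_open W1" "P \<in> W1" "W1 \<subseteq> W" "\<forall>i<r. \<Phi> i W1" by auto
    obtain W2 where W2: "zariski_open W2" "P \<in> W2" "\<Phi> r W2" using Suc.prems by blast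
    have "\<forall>i<Suc r. \<Phi> i (W1 \<inter> W2)"
      using W1(4) W2(3) mono by (metis inf_le1 inf_le2 less_Suc_eq)
    then show ?case using W1 W2 zariski_open_inter[of W1 W2] by (intro exI[of _ "W1 \<inter> W2"]) auto
  qed
  then show ?thesis using that by blast
qed

text \<open>For a torsion-free module embedded by \<open>\<phi>\<close> in a vector space over \<open>K\<close>, the class of \<open>m/f\<close> in the
  homogeneous localisation is determined by the vector \<open>v = \<phi>(m)/f\<close>; it is \<open>fib M \<phi> P v\<close>.\<close>

definition fib :: "(int \<Rightarrow> 'm::ab_group_add set) \<Rightarrow> ('m \<Rightarrow> 'i \<Rightarrow> ('n::{finite,linorder}, 'k::field) mpoly fract) \<Rightarrow>
    ('n, 'k) mpoly set \<Rightarrow> ('i \<Rightarrow> ('n, 'k) mpoly fract) \<Rightarrow> ('m \<times> ('n, 'k) mpoly) set"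
  where "fib M \<phi> P v = {(m, f) \<in> loc_pairs M P. \<forall>i. \<phi> m i = to_frac f * v i}"

text \<open>The vectors given on all of \<open>W\<close> by a single fraction; sections are locally
  of this kind.\<close>

definition fracs :: "(int \<Rightarrow> 'm::ab_group_add set) \<Rightarrow> ('m \<Rightarrow> 'i \<Rightarrow> ('n::{finite,linorder}, 'k::field) mpoly fract) \<Rightarrow>
    ('n, 'k) mpoly set set \<Rightarrow> ('i \<Rightarrow> ('n, 'k) mpoly fract) set"
  where "fracs M \<phi> W = {v. \<exists>d m f. m \<in> M d \<and> f \<in> S_deg d \<and> (\<forall>P\<in>W. f \<notin> P) \<and>
    (\<forall>i. \<phi> m i = to_frac f * v i)}"

lemma fracs_mono: "v \<in> fracs M \<phi> W \<Longrightarrow> V \<subseteq> W \<Longrightarrow> v \<in> fracs M \<phi> V"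
  unfolding fracs_def by blast

lemma fib_nonempty: "v \<in> fracs M \<phi> W \<Longrightarrow> P \<in> W \<Longrightarrow> fib M \<phi> P v \<noteq> {}"
  by (fastforce simp: fracs_def fib_def loc_pairs_def)

lemma fib_inject:
  assumes P: "P \<in> Proj" and "fib M \<phi> P v = fib M \<phi> P w" "fib M \<phi> P v \<noteq> {}"
  shows "v = w"
proof -
  obtain m f where mf: "(m, f) \<in> fib M \<phi> P v" using assms(3) by auto
  then have "f \<noteq> 0" using Proj_0[OF P] by (auto simp: fib_def loc_pairs_def)
  moreover have "to_frac f * v i = to_frac f * w i" for i
  proof -
    have "(m, f) \<in> fib M \<phi> P w" using mf assms(2) by simp
    then have "\<phi> m i = to_frac f * w i" by (simp add: fib_def)
    moreover have "\<phi> m i = to_frac f * v i" using mf by (simp add: fib_def)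
    ultimately show ?thesis by simp
  qed
  ultimately show ?thesis by (simp add: fun_eq_iff)
qed

lemma fibE:
  assumes "(m, f) \<in> fib M \<phi> P v"
  obtains d where "m \<in> M d" "f \<in> S_deg d" "f \<notin> P" "\<And>i. \<phi> m i = to_frac f * v i"
  using assms unfolding fib_def loc_pairs_def by blast

lemma fibI:
  "m \<in> M d \<Longrightarrow> f \<in> S_deg d \<Longrightarrow> f \<notin> P \<Longrightarrow> (\<And>i. \<phi> m i = to_frac f * v i) \<Longrightarrow> (m, f) \<in> fib M \<phi> P v"
  unfolding fib_def loc_pairs_def by blast

text \<open>Injectivity of \<open>\<phi>\<close> is asked on each graded piece only, as fractions
  are compared after cross-multiplication to equal degrees. The index type is arbitrary: a one-point
  type gives the structure sheaf.\<close>

locale embedded_module =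
  fixes smul :: "('n::{finite,linorder}, 'k::field) mpoly \<Rightarrow> 'm::ab_group_add \<Rightarrow> 'm"
    and M :: "int \<Rightarrow> 'm set" and \<phi> :: "'m \<Rightarrow> 'i \<Rightarrow> ('n, 'k) mpoly fract"
  assumes phi_add: "\<phi> (m + m') i = \<phi> m i + \<phi> m' i"
    and phi_smul: "\<phi> (smul f m) i = to_frac f * \<phi> m i"
    and smul_0: "smul f 0 = 0"
    and M_0: "0 \<in> M d"
    and M_add: "m \<in> M d \<Longrightarrow> m' \<in> M d \<Longrightarrow> m + m' \<in> M d"
    and M_smul: "f \<in> S_deg e \<Longrightarrow> m \<in> M d \<Longrightarrow> smul f m \<in> M (e + d)"
    and phi_inj: "m \<in> M d \<Longrightarrow> m' \<in> M d \<Longrightarrow> (\<And>i. \<phi> m i = \<phi> m' i) \<Longrightarrow> m = m'"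
begin

lemma phi_0: "\<phi> 0 i = 0"
  using phi_smul[of 0 0 i] smul_0[of 0] by simp

lemma phi_diff: "\<phi> (m - m') i = \<phi> m i - \<phi> m' i"
  using phi_add[of "m - m'" m' i] by simp

lemma M_cross_add:
  assumes "m \<in> M d" "f \<in> S_deg d" "m' \<in> M d'" "f' \<in> S_deg d'"
  shows "smul f' m + smul f m' \<in> M (d + d')"
  using M_add[OF M_smul[OF assms(4,1)], of "smul f m'"] M_smul[OF assms(2,3)] by (simp add: add.commute[of d])

text \<open>In a vector space over \<open>K\<close> the factor \<open>u\<close> of
  \<open>loc_rel\<close> can be cancelled, and conversely \<open>u = 1\<close> suffices by
  injectivity of \<open>\<phi>\<close>.\<close>

lemma loc_frac_eq_fib:
  assumes P: "P \<in> Proj" and mf: "(m, f) \<in> loc_pairs M P" and v: "\<And>i. \<phi> m i = to_frac f * v i"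
  shows "loc_frac smul M P m f = fib M \<phi> P v"
proof -
  have nz: "g \<noteq> 0" if "g \<notin> P" for g using that Proj_0[OF P] by blast
  have f: "f \<noteq> 0" using mf nz by (auto simp: loc_pairs_def)
  have "((m, f), (m', f')) \<in> loc_rel smul M P \<longleftrightarrow> (\<forall>i. \<phi> m' i = to_frac f' * v i)"
    if mf': "(m', f') \<in> loc_pairs M P" for m' f'
  proof
    assume "((m, f), (m', f')) \<in> loc_rel smul M P"
    then obtain u where u: "u \<notin> P" "smul u (smul f' m - smul f m') = 0"
      by (auto simp: loc_rel_def)
    have "\<phi> m' i = to_frac f' * v i" for i
    proof -
      have "to_frac u * (to_frac f' * \<phi> m i - to_frac f * \<phi> m' i) = 0"
        using u(2) phi_0[of i] by (metis phi_diff phi_smul)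
      then have "to_frac f' * \<phi> m i = to_frac f * \<phi> m' i" using nz[OF u(1)] by simp
      then have "to_frac f * (to_frac f' * v i) = to_frac f * \<phi> m' i" by (simp add: v mult.left_commute)
      then show ?thesis using f by simp
    qed
    then show "\<forall>i. \<phi> m' i = to_frac f' * v i" by blast
  next
    assume v': "\<forall>i. \<phi> m' i = to_frac f' * v i"
    obtain d d' where d: "m \<in> M d" "f \<in> S_deg d" "m' \<in> M d'" "f' \<in> S_deg d'"
      using mf mf' by (auto simp: loc_pairs_def)
    have "smul f' m = smul f m'"
    proof (rule phi_inj)
      show "smul f' m \<in> M (d' + d)" by (rule M_smul[OF d(4,1)])
      show "smul f m' \<in> M (d' + d)" using M_smul[OF d(2,3)] by (simp add: add.commute)
      show "\<phi> (smul f' m) i = \<phi> (smul f m') i" for i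
        using v v' by (simp add: phi_smul mult.left_commute)
    qed
    then have "smul 1 (smul f' m - smul f m') = 0" by (simp add: smul_0)
    then show "((m, f), (m', f')) \<in> loc_rel smul M P"
      unfolding loc_rel_def using mf mf' S_deg_1 Proj_1[OF P] by blast
  qed
  moreover have "(m', f') \<in> loc_pairs M P" if "((m, f), (m', f')) \<in> loc_rel smul M P" for m' f'
    using that by (auto simp: loc_rel_def)
  ultimately show ?thesis unfolding loc_frac_def fib_def by blast
qed

lemma fracs_0: "(\<And>P. P \<in> W \<Longrightarrow> P \<in> Proj) \<Longrightarrow> (\<lambda>_. 0) \<in> fracs M \<phi> W"
  unfolding fracs_def using M_0[of 0] S_deg_1 Proj_1 phi_0 by fastforce

lemma fracs_add:
  assumes W: "W \<subseteq> Proj" and v: "v \<in> fracs M \<phi> W" and w: "w \<in> fracs M \<phi> W"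
  shows "(\<lambda>i. v i + w i) \<in> fracs M \<phi> W"
proof -
  obtain d m f where 1: "m \<in> M d" "f \<in> S_deg d" "\<And>P. P \<in> W \<Longrightarrow> f \<notin> P" "\<And>i. \<phi> m i = to_frac f * v i"
    using v by (auto simp: fracs_def)
  obtain d' m' f' where 2: "m' \<in> M d'" "f' \<in> S_deg d'" "\<And>P. P \<in> W \<Longrightarrow> f' \<notin> P" "\<And>i. \<phi> m' i = to_frac f' * w i"
    using w by (auto simp: fracs_def)
  have "smul f' m + smul f m' \<in> M (d + d')"
    by (rule M_cross_add[OF 1(1,2) 2(1,2)])
  moreover have "f * f' \<in> S_deg (d + d')" using 1 2 S_deg_mult by blast
  moreover have "\<forall>P\<in>W. f * f' \<notin> P" using W 1 2 Proj_prime by blast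
  moreover have "\<phi> (smul f' m + smul f m') i = to_frac (f * f') * (v i + w i)" for i
    by (simp add: phi_add phi_smul 1(4) 2(4) rhom_mult[OF rhom_to_frac] algebra_simps)
  ultimately show ?thesis unfolding fracs_def by blast
qed

lemma fib_cross_add:
  assumes P: "P \<in> Proj" and "(m, f) \<in> fib M \<phi> P v" "(m', f') \<in> fib M \<phi> P w"
  shows "(smul f' m + smul f m', f * f') \<in> fib M \<phi> P (\<lambda>i. v i + w i)"
proof -
  obtain d where d: "m \<in> M d" "f \<in> S_deg d" "f \<notin> P" "\<And>i. \<phi> m i = to_frac f * v i"
    by (rule fibE[OF assms(2)]) blast
  obtain d' where d': "m' \<in> M d'" "f' \<in> S_deg d'" "f' \<notin> P" "\<And>i. \<phi> m' i = to_frac f' * w i"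
    by (rule fibE[OF assms(3)]) blast
  show ?thesis
  proof (rule fibI)
    show "smul f' m + smul f m' \<in> M (d + d')" by (rule M_cross_add[OF d(1,2) d'(1,2)])
    show "f * f' \<in> S_deg (d + d')" using d d' S_deg_mult by blast
    show "f * f' \<notin> P" using P d d' Proj_prime by blast
    show "\<phi> (smul f' m + smul f m') i = to_frac (f * f') * (v i + w i)" for i
      by (simp add: phi_add phi_smul d d' rhom_mult[OF rhom_to_frac] algebra_simps)
  qed
qed

lemma loc_frac_of_fib: "P \<in> Proj \<Longrightarrow> (m, f) \<in> fib M \<phi> P v \<Longrightarrow> loc_frac smul M P m f = fib M \<phi> P v"
  by (rule loc_frac_eq_fib) (simp_all add: fib_def)

text \<open>The operations \<open>loc_add\<close> and \<open>loc_scale\<close> are unions over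
  representatives; these collapse since every choice gives the same class.\<close>

lemma UN_pair_const:
  assumes "X \<noteq> {}" "\<And>m f. (m, f) \<in> X \<Longrightarrow> G m f = Y"
  shows "(\<Union>(m, f)\<in>X. G m f) = Y"
  using assms by auto

lemma loc_add_fib:
  assumes P: "P \<in> Proj" and v: "fib M \<phi> P v \<noteq> {}" and w: "fib M \<phi> P w \<noteq> {}"
  shows "loc_add smul M P (fib M \<phi> P v) (fib M \<phi> P w) = fib M \<phi> P (\<lambda>i. v i + w i)"
    "fib M \<phi> P (\<lambda>i. v i + w i) \<noteq> {}"
proof -
  note mem = fib_cross_add[OF P]
  show "loc_add smul M P (fib M \<phi> P v) (fib M \<phi> P w) = fib M \<phi> P (\<lambda>i. v i + w i)"
    unfolding loc_add_def by (intro UN_pair_const v w loc_frac_of_fib[OF P] mem)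
  obtain x y where "x \<in> fib M \<phi> P v" "y \<in> fib M \<phi> P w" using v w by blast
  then show "fib M \<phi> P (\<lambda>i. v i + w i) \<noteq> {}"
    using mem[of "fst x" "snd x" v "fst y" "snd y" w] by auto
qed

end

section \<open>The structure sheaf as the case of a single coordinate\<close>

interpretation structure_sheaf: embedded_module "(*)" S_deg "\<lambda>f (_::unit). to_frac f"
proof
  show "f \<in> S_deg e \<Longrightarrow> m \<in> S_deg d \<Longrightarrow> f * m \<in> S_deg (e + d)" for f m :: "('n::{finite,linorder}, 'k::field) mpoly" and e d
    by (rule S_deg_mult)
qed (auto simp: rhom_add rhom_mult rhom_to_frac S_deg_add)

definition sfib :: "('n::{finite,linorder}, 'k::field) mpoly set \<Rightarrow> ('n, 'k) mpoly fract \<Rightarrow>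
    (('n, 'k) mpoly \<times> ('n, 'k) mpoly) set"
  where "sfib P c = fib S_deg (\<lambda>f (_::unit). to_frac f) P (\<lambda>_. c)"

definition sfracs :: "('n::{finite,linorder}, 'k::field) mpoly set set \<Rightarrow> ('n, 'k) mpoly fract set"
  where "sfracs W = {c. (\<lambda>_. c) \<in> fracs S_deg (\<lambda>f (_::unit). to_frac f) W}"

lemma sfracs_iff: "c \<in> sfracs W \<longleftrightarrow>
    (\<exists>d g h. g \<in> S_deg d \<and> h \<in> S_deg d \<and> (\<forall>P\<in>W. h \<notin> P) \<and> to_frac g = to_frac h * c)"
  by (auto simp: sfracs_def fracs_def)

lemma sfib_iff: "(g, h) \<in> sfib P c \<longleftrightarrow> (\<exists>d. g \<in> S_deg d \<and> h \<in> S_deg d \<and> h \<notin> P \<and> to_frac g = to_frac h * c)"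
  by (auto simp: sfib_def fib_def loc_pairs_def)

lemma sfracs_mono: "c \<in> sfracs W \<Longrightarrow> V \<subseteq> W \<Longrightarrow> c \<in> sfracs V"
  unfolding sfracs_def using fracs_mono by blast

lemma sfib_nonempty: "c \<in> sfracs W \<Longrightarrow> P \<in> W \<Longrightarrow> sfib P c \<noteq> {}"
  unfolding sfracs_def sfib_def using fib_nonempty by blast

lemma sfib_inject: "P \<in> Proj \<Longrightarrow> sfib P c = sfib P c' \<Longrightarrow> sfib P c \<noteq> {} \<Longrightarrow> c = c'"
  unfolding sfib_def by (metis fib_inject)

context embedded_module
begin

lemma sections_iff:
  assumes "U \<subseteq> Proj"
  shows "s \<in> sections smul M U \<longleftrightarrow> s \<in> extensional U \<and> (\<forall>P\<in>U. \<exists>W v. zariski_open W \<and> P \<in> W \<and> W \<subseteq> U \<and>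
    v \<in> fracs M \<phi> W \<and> (\<forall>P'\<in>W. s P' = fib M \<phi> P' v))"
proof -
  have "(\<exists>d m f. m \<in> M d \<and> f \<in> S_deg d \<and> (\<forall>P'\<in>W. f \<notin> P' \<and> s P' = loc_frac smul M P' m f)) \<longleftrightarrow>
      (\<exists>v. v \<in> fracs M \<phi> W \<and> (\<forall>P'\<in>W. s P' = fib M \<phi> P' v))" (is "?L \<longleftrightarrow> ?R")
    if W: "W \<subseteq> U" "W \<noteq> {}" for W
  proof
    assume ?L
    then obtain d m f where 1: "m \<in> M d" "f \<in> S_deg d" "\<And>P'. P' \<in> W \<Longrightarrow> f \<notin> P'"
      "\<And>P'. P' \<in> W \<Longrightarrow> s P' = loc_frac smul M P' m f" by blast
    have "f \<noteq> 0" using 1(3) W Proj_0 assms by blast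
    define v where "v = (\<lambda>i. \<phi> m i / to_frac f)"
    have v: "\<phi> m i = to_frac f * v i" for i using \<open>f \<noteq> 0\<close> by (simp add: v_def)
    have "v \<in> fracs M \<phi> W" unfolding fracs_def using 1 v by blast
    moreover have "s P' = fib M \<phi> P' v" if P': "P' \<in> W" for P'
      unfolding 1(4)[OF P']
      by (rule loc_frac_eq_fib) (use P' W assms 1 v in \<open>auto simp: loc_pairs_def\<close>)
    ultimately show ?R by blast
  next
    assume ?R
    then obtain v where v: "v \<in> fracs M \<phi> W" "\<And>P'. P' \<in> W \<Longrightarrow> s P' = fib M \<phi> P' v" by blast
    then obtain d m f where 1: "m \<in> M d" "f \<in> S_deg d" "\<And>P'. P' \<in> W \<Longrightarrow> f \<notin> P'" "\<And>i. \<phi> m i = to_frac f * v i"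
      by (auto simp: fracs_def)
    have "s P' = loc_frac smul M P' m f" if P': "P' \<in> W" for P'
      unfolding v(2)[OF P']
      by (rule loc_frac_eq_fib[symmetric]) (use P' W assms 1 in \<open>auto simp: loc_pairs_def\<close>)
    then show ?L using 1 by blast
  qed
  then show ?thesis unfolding sections_def mem_Collect_eq by (smt (verit) empty_iff)
qed

lemma loc_scale_fib:
  assumes P: "P \<in> Proj" and c: "sfib P c \<noteq> {}" and v: "fib M \<phi> P v \<noteq> {}"
  shows "loc_scale smul M P (sfib P c) (fib M \<phi> P v) = fib M \<phi> P (\<lambda>i. c * v i)"
    "fib M \<phi> P (\<lambda>i. c * v i) \<noteq> {}"
proof -
  have pair: "(smul g m, h * f) \<in> fib M \<phi> P (\<lambda>i. c * v i)"
    if gh: "(g, h) \<in> sfib P c" and mf: "(m, f) \<in> fib M \<phi> P v" for g h m f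
  proof -
    obtain d where d: "m \<in> M d" "f \<in> S_deg d" "f \<notin> P" "\<And>i. \<phi> m i = to_frac f * v i"
      by (rule fibE[OF mf]) blast
    obtain d' where d': "g \<in> S_deg d'" "h \<in> S_deg d'" "h \<notin> P" "to_frac g = to_frac h * c"
      using gh by (auto simp: sfib_iff)
    show ?thesis
    proof (rule fibI)
      show "smul g m \<in> M (d' + d)" "h * f \<in> S_deg (d' + d)"
        using d d' M_smul S_deg_mult by auto
      show "h * f \<notin> P" using P d d' Proj_prime by blast
      show "\<phi> (smul g m) i = to_frac (h * f) * (c * v i)" for i
        by (simp add: phi_smul d d' rhom_mult[OF rhom_to_frac] ac_simps)
    qed
  qed
  show "loc_scale smul M P (sfib P c) (fib M \<phi> P v) = fib M \<phi> P (\<lambda>i. c * v i)"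
    unfolding loc_scale_def by (intro UN_pair_const c v loc_frac_of_fib[OF P] pair)
  obtain x y where "x \<in> sfib P c" "y \<in> fib M \<phi> P v" using c v by blast
  then show "fib M \<phi> P (\<lambda>i. c * v i) \<noteq> {}"
    using pair[of "fst x" "snd x" "fst y" "snd y"] by auto
qed

lemma fracs_scale:
  assumes W: "W \<subseteq> Proj" and c: "c \<in> sfracs W" and v: "v \<in> fracs M \<phi> W"
  shows "(\<lambda>i. c * v i) \<in> fracs M \<phi> W"
proof -
  obtain d m f where 1: "m \<in> M d" "f \<in> S_deg d" "\<And>P. P \<in> W \<Longrightarrow> f \<notin> P" "\<And>i. \<phi> m i = to_frac f * v i"
    using v by (auto simp: fracs_def)
  obtain d' g h where 2: "g \<in> S_deg d'" "h \<in> S_deg d'" "\<And>P. P \<in> W \<Longrightarrow> h \<notin> P" "to_frac g = to_frac h * c"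
    using c by (auto simp: sfracs_iff)
  have "smul g m \<in> M (d' + d)" "h * f \<in> S_deg (d' + d)"
    using 1 2 M_smul S_deg_mult by auto
  moreover have "\<forall>P\<in>W. h * f \<notin> P" using W 1 2 Proj_prime by blast
  moreover have "\<phi> (smul g m) i = to_frac (h * f) * (c * v i)" for i
    by (simp add: phi_smul 1 2 rhom_mult[OF rhom_to_frac] ac_simps)
  ultimately show ?thesis unfolding fracs_def by blast
qed

lemma fracs_lin_comb:
  assumes W: "W \<subseteq> Proj" and c: "\<And>i. i < (r::nat) \<Longrightarrow> c i \<in> sfracs W" and v: "\<And>i. i < r \<Longrightarrow> v i \<in> fracs M \<phi> W"
  shows "(\<lambda>j. \<Sum>i<r. c i * v i j) \<in> fracs M \<phi> W"
  using c v
proof (induction r)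
  case 0
  then show ?case using fracs_0 W by auto
next
  case (Suc r)
  then show ?case using fracs_add[OF W _ fracs_scale[OF W]] by simp
qed

lemma lin_comb_fib:
  assumes W: "W \<subseteq> Proj" and P: "P \<in> W"
    and a: "\<And>i. i < r \<Longrightarrow> a i P = sfib P (c i)" "\<And>i. i < r \<Longrightarrow> sfib P (c i) \<noteq> {}"
    and e: "\<And>i. i < r \<Longrightarrow> e i P = fib M \<phi> P (v i)" "\<And>i. i < r \<Longrightarrow> fib M \<phi> P (v i) \<noteq> {}"
  shows "lin_comb smul M W r a e P = fib M \<phi> P (\<lambda>j. \<Sum>i<r. c i * v i j)"
proof -
  have Proj: "P \<in> Proj" using W P by blast
  \<comment> \<open>An arbitrary start \<open>w\<close> makes the induction go through, because
    \<open>foldr\<close> treats the last index first.\<close>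
  have "foldr (\<lambda>i. loc_add smul M P (loc_scale smul M P (a i P) (e i P))) [0..<r] (fib M \<phi> P w) =
      fib M \<phi> P (\<lambda>j. (\<Sum>i<r. c i * v i j) + w j)" if "fib M \<phi> P w \<noteq> {}" for w
    using a e that
  proof (induction r arbitrary: w)
    case (Suc r)
    have sc: "loc_scale smul M P (sfib P (c r)) (fib M \<phi> P (v r)) = fib M \<phi> P (\<lambda>j. c r * v r j)"
      "fib M \<phi> P (\<lambda>j. c r * v r j) \<noteq> {}"
      using loc_scale_fib[OF Proj, of "c r" "v r"] Suc.prems by auto
    note ad = loc_add_fib[OF Proj sc(2) Suc.prems(5)]
    have "loc_add smul M P (loc_scale smul M P (a r P) (e r P)) (fib M \<phi> P w) =
        fib M \<phi> P (\<lambda>j. c r * v r j + w j)"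
      using Suc.prems sc ad by simp
    then show ?case
      using Suc.IH[of "\<lambda>j. c r * v r j + w j"] Suc.prems ad(2) by (simp add: add.assoc)
  qed simp
  moreover have "loc_frac smul M P 0 1 = fib M \<phi> P (\<lambda>_. 0)"
    by (rule loc_frac_eq_fib[OF Proj])
      (auto simp: loc_pairs_def phi_0 intro!: exI[of _ 0] M_0 S_deg_1 Proj_1[OF Proj])
  moreover have "fib M \<phi> P (\<lambda>_. 0) \<noteq> {}"
    using fib_nonempty[OF fracs_0[of "{P}"]] Proj by blast
  ultimately show ?thesis using P by (simp add: lin_comb_def)
qed

end

lemma structure_sections_iff:
  assumes "U \<subseteq> Proj"
  shows "a \<in> structure_sections U \<longleftrightarrow> a \<in> extensional U \<and> (\<forall>P\<in>U. \<exists>W c. zariski_open W \<and> P \<in> W \<and> W \<subseteq> U \<and>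
    c \<in> sfracs W \<and> (\<forall>P'\<in>W. a P' = sfib P' c))"
proof -
  have "(\<exists>v. X v) \<longleftrightarrow> (\<exists>c. X (\<lambda>_. c))" for X :: "(unit \<Rightarrow> ('a, 'b) mpoly fract) \<Rightarrow> bool"
  proof
    assume "\<exists>v. X v"
    then obtain v where "X v" ..
    moreover have "v = (\<lambda>_. v ())" by (simp add: fun_eq_iff)
    ultimately show "\<exists>c. X (\<lambda>_. c)" by metis
  qed auto
  then show ?thesis
    unfolding structure_sections_def structure_sheaf.sections_iff[OF assms] sfracs_def sfib_def mem_Collect_eq by simp
qed

section \<open>Local freeness of the associated sheaf\<close>

text \<open>The shift \<open>c\<close> compares the grading with the degree of the coefficients. It
  is \<open>p\<close> for derivations, whose coefficients are values at \<open>p\<close>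
  coordinates, and \<open>card B - p\<close> for forms, whose coefficients are multiplied by
  \<open>Q\<close> and do not count the \<open>p\<close> differentials of degree 1.\<close>

locale graded_lattice_module = lattice_module a B smul \<phi> q Minf
  for a :: "'h \<Rightarrow> 'k::field ^ 'n::{finite,linorder}" and B :: "'h set"
    and smul :: "('n::{finite,linorder}, 'k::field) mpoly \<Rightarrow> 'm::ab_group_add \<Rightarrow> 'm"
    and \<phi> :: "'m \<Rightarrow> 'n set \<Rightarrow> ('n, 'k) mpoly fract" and q :: int and Minf :: "'m set" +
  fixes M :: "int \<Rightarrow> 'm set" and c :: int
  assumes M_eq: "M d = {m \<in> Minf. \<forall>I. \<phi> m I \<in> to_frac ` S_deg (d + c)}"

sublocale graded_lattice_module \<subseteq> embedded_module smul M \<phi>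
proof
  show "\<phi> (m + m') i = \<phi> m i + \<phi> m' i" for m m' i by (rule \<phi>_add)
  show "\<phi> (smul f m) i = to_frac f * \<phi> m i" for f m i by (rule \<phi>_smul)
  show "smul f 0 = 0" for f by simp
  show "0 \<in> M d" for d
    unfolding M_eq using subspace_0[OF Minf] \<phi>_0 by (auto simp: image_iff intro!: bexI[of _ 0])
  show "m + m' \<in> M d" if m: "m \<in> M d" "m' \<in> M d" for m m' d
  proof -
    have "\<phi> m I + \<phi> m' I \<in> to_frac ` S_deg (d + c)" for I
    proof -
      obtain g g' where "g \<in> S_deg (d + c)" "\<phi> m I = to_frac g" "g' \<in> S_deg (d + c)" "\<phi> m' I = to_frac g'"
        using m unfolding M_eq by blast
      then show ?thesis
        using S_deg_add[of g "d + c" g'] by (auto simp flip: rhom_add[OF rhom_to_frac])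
    qed
    then show ?thesis using m subspace_add[OF Minf] unfolding M_eq by (simp add: \<phi>_add)
  qed
  show "smul f m \<in> M (e + d)" if fm: "f \<in> S_deg e" "m \<in> M d" for f m d e
  proof -
    have "to_frac f * \<phi> m I \<in> to_frac ` S_deg (e + d + c)" for I
    proof -
      obtain g where "g \<in> S_deg (d + c)" "\<phi> m I = to_frac g" using fm unfolding M_eq by blast
      then show ?thesis
        using S_deg_mult[OF fm(1), of g "d + c"]
        by (auto simp: add.assoc rhom_mult[OF rhom_to_frac] image_iff intro!: bexI[of _ "f * g"])
    qed
    then show ?thesis using fm subspace_scale[OF Minf] unfolding M_eq by (simp add: \<phi>_smul)
  qed
  show "m = m'" if "m \<in> M d" "m' \<in> M d" "\<And>i. \<phi> m i = \<phi> m' i" for m m' d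
    using that unfolding M_eq by (intro \<phi>_eqD) auto
qed

context graded_lattice_module
begin

lemma M_coeffs:
  assumes "m \<in> M d"
  shows "coeffs m \<in> lattice q Q" "coeffs m I \<in> S_deg (d + c)" "\<phi> m I = to_frac (coeffs m I)"
proof -
  have m: "m \<in> Minf" "\<phi> m I \<in> to_frac ` S_deg (d + c)" using assms by (auto simp: M_eq)
  show "coeffs m \<in> lattice q Q" "\<phi> m I = to_frac (coeffs m I)" using coeffs[OF m(1)] by auto
  then show "coeffs m I \<in> S_deg (d + c)" using m(2) by auto
qed

lemma M_surj:
  assumes "\<eta> \<in> lattice q Q" "\<And>I. \<eta> I \<in> S_deg d"
  obtains m where "m \<in> M (d - c)" "\<And>I. \<phi> m I = to_frac (\<eta> I)"
proof -
  obtain m where "m \<in> Minf" "\<phi> m = (\<lambda>I. to_frac (\<eta> I))" using \<phi>_surj[OF assms(1)] by blast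
  then show ?thesis using that[of m] assms(2) by (auto simp: M_eq)
qed

lemma coord_power_S_deg: "coord i ^ n \<in> S_deg (int n)"
  using S_deg_power[OF S_deg_coord, of i n] by simp

lemma Proj_power:
  assumes "P \<in> Proj" "f \<notin> P"
  shows "f ^ n \<notin> P"
proof -
  have "f \<in> - P" using assms(2) by simp
  then have "f ^ n \<in> - P" by (rule satur_power[OF satur_compl_Proj[OF assms(1)]])
  then show ?thesis by simp
qed

lemma sfracsI:
  assumes "g \<in> S_deg d" "h \<in> S_deg d" "\<And>P. P \<in> W \<Longrightarrow> h \<notin> P" "h \<noteq> 0"
  shows "to_frac g / to_frac h \<in> sfracs W"
  unfolding sfracs_iff using assms by (intro exI[of _ d] exI[of _ g] exI[of _ h]) simp

text \<open>An element of degree \<open>d\<close> is brought to degree 0 by powers of an invertible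
  coordinate. Two exponents are used because \<open>d\<close> may be negative.\<close>

lemma frac_power_fracs:
  assumes W: "W \<subseteq> Proj" and x: "\<And>P. P \<in> W \<Longrightarrow> coord i \<notin> P" and m: "m \<in> M d" and n: "int n' = int n + d"
  shows "(\<lambda>I. to_frac (coord i ^ n) / to_frac (coord i ^ n') * \<phi> m I) \<in> fracs M \<phi> W"
proof -
  have "coord i \<noteq> (0 :: ('n, 'k) mpoly)" by (simp flip: linear_form_axis)
  moreover have "\<forall>P\<in>W. coord i ^ n' \<notin> P" using W x Proj_power by blast
  ultimately show ?thesis
    unfolding fracs_def using M_smul[OF coord_power_S_deg m, of i n] coord_power_S_deg[of i n']
    by (intro CollectI exI[of _ "int n'"] exI[of _ "smul (coord i ^ n) m"] exI[of _ "coord i ^ n'"])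
      (simp add: n phi_smul)
qed

text \<open>Near \<open>P\<close> the local basis is given by fixed fractions of \<open>m i\<close>
  by \<open>f i\<close>. Injectivity on sections that are single fractions makes the
  \<open>coeffs (m i)\<close> independent over \<open>S\<close>, surjectivity makes them generators
  at \<open>P\<close>, and \<open>good_of_basis\<close> applies.\<close>

theorem good_of_locally_free:
  assumes lf: "sheaf_locally_free smul M" and P: "P \<in> Proj"
  shows "good (- P) q Q"
proof -
  note sat = satur_compl_Proj[OF P]
  obtain U r e where U: "zariski_open U" "P \<in> U" and e: "\<And>i. i < r \<Longrightarrow> e i \<in> sections smul M U"
    and bij: "\<And>W. zariski_open W \<Longrightarrow> W \<subseteq> U \<Longrightarrow>
      bij_betw (\<lambda>a. lin_comb smul M W r a e) ({..<r} \<rightarrow>\<^sub>E structure_sections W) (sections smul M W)"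
    using lf P unfolding sheaf_locally_free_def by metis
  obtain i0 where i0: "coord i0 \<notin> P" using Proj_coord[OF P] .
  let ?x = "coord i0 :: ('n, 'k) mpoly"
  have xnz: "?x \<noteq> 0" using i0 Proj_0[OF P] by metis
  let ?\<Phi> = "\<lambda>i W. \<exists>v. v \<in> fracs M \<phi> W \<and> (\<forall>P'\<in>W. e i P' = fib M \<phi> P' v)"
  obtain W where W: "zariski_open W" "P \<in> W" "W \<subseteq> U \<inter> {P\<in>Proj. ?x \<notin> P}" "\<And>i. i < r \<Longrightarrow> ?\<Phi> i W"
  proof (rule zariski_open_finite_refine[of "U \<inter> {P\<in>Proj. ?x \<notin> P}" P r ?\<Phi>])
    show "zariski_open (U \<inter> {P\<in>Proj. ?x \<notin> P})"
      by (intro zariski_open_inter U zariski_open_principal[OF S_deg_coord])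
    show "P \<in> U \<inter> {P\<in>Proj. ?x \<notin> P}" using U P i0 by simp
    show "\<exists>W'. zariski_open W' \<and> P \<in> W' \<and> ?\<Phi> i W'" if "i < r" for i
      using e[OF that] U(2) unfolding sections_iff[OF zariski_open_subset[OF U(1)]] by blast
    show "?\<Phi> i V" if "?\<Phi> i W" "V \<subseteq> W" for i V W
      using that fracs_mono[of _ M \<phi> W V] by blast
  qed (use that in blast)
  have WU: "W \<subseteq> U" and WP: "W \<subseteq> Proj" and xW: "\<And>P'. P' \<in> W \<Longrightarrow> ?x \<notin> P'" using W(3) by auto
  obtain v where v: "\<And>i. i < r \<Longrightarrow> v i \<in> fracs M \<phi> W" "\<And>i P'. i < r \<Longrightarrow> P' \<in> W \<Longrightarrow> e i P' = fib M \<phi> P' (v i)"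
    using W(4) by metis
  have "\<exists>d m f. m \<in> M d \<and> f \<in> S_deg d \<and> (\<forall>P'\<in>W. f \<notin> P') \<and> (\<forall>I. \<phi> m I = to_frac f * v i I)" if "i < r" for i
    using v(1)[OF that] by (simp add: fracs_def)
  then obtain d m f where m: "\<And>i. i < r \<Longrightarrow> m i \<in> M (d i)" and f: "\<And>i. i < r \<Longrightarrow> f i \<in> S_deg (d i)"
    and fW: "\<And>i P'. i < r \<Longrightarrow> P' \<in> W \<Longrightarrow> f i \<notin> P'" and mf: "\<And>i I. i < r \<Longrightarrow> \<phi> (m i) I = to_frac (f i) * v i I"
    by metis
  have fP: "f i \<notin> P" and fnz: "f i \<noteq> 0" if "i < r" for i
    using fW[OF that W(2)] Proj_0[OF P] by auto
  have v_eq: "v i I = to_frac (coeffs (m i) I) / to_frac (f i)" if "i < r" for i I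
    using mf[OF that, of I] M_coeffs(3)[OF m[OF that], of I] fnz[OF that] by simp
  note bijW = bij[OF W(1) WU]
  have const_section: "(\<lambda>P'\<in>W. sfib P' k) \<in> structure_sections W" if "k \<in> sfracs W" for k
    unfolding structure_sections_iff[OF WP]
    using that W(1) by (intro conjI ballI exI[of _ W] exI[of _ k]) auto
  have lc: "lin_comb smul M W r (\<lambda>i\<in>{..<r}. \<lambda>P'\<in>W. sfib P' (k i)) e P' = fib M \<phi> P' (\<lambda>j. \<Sum>i<r. k i * v i j)"
    if k: "\<And>i. i < r \<Longrightarrow> k i \<in> sfracs W" and P': "P' \<in> W" for k P'
    by (rule lin_comb_fib[OF WP P'])
      (use P' k v in \<open>auto simp: sfib_nonempty[OF k P'] fib_nonempty[OF v(1) P']\<close>)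
  have zero_sfracs: "0 \<in> sfracs W"
    unfolding sfracs_def using structure_sheaf.fracs_0[of W] WP by auto
  have indep: "k0 = 0" if k: "\<And>i. i < r \<Longrightarrow> k i \<in> sfracs W" and z: "\<And>j. (\<Sum>i<r. k i * v i j) = 0"
    and y: "y < r" "k0 = k y" for k k0 y
  proof -
    let ?a = "\<lambda>i\<in>{..<r}. \<lambda>P'\<in>W. sfib P' (k i)"
    let ?b = "\<lambda>i\<in>{..<r}. \<lambda>P'\<in>W. sfib P' 0"
    have "lin_comb smul M W r ?a e P' = lin_comb smul M W r ?b e P'" for P'
    proof (cases "P' \<in> W")
      case True
      then show ?thesis using lc[OF k True] lc[of "\<lambda>_. 0", OF zero_sfracs True] z by simp
    next
      case False
      then show ?thesis by (simp add: lin_comb_def)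
    qed
    then have "lin_comb smul M W r ?a e = lin_comb smul M W r ?b e" by blast
    moreover have "?a \<in> {..<r} \<rightarrow>\<^sub>E structure_sections W" "?b \<in> {..<r} \<rightarrow>\<^sub>E structure_sections W"
      using const_section k zero_sfracs by auto
    ultimately have "?a = ?b"
      using bijW by (meson bij_betw_imp_inj_on inj_onD)
    then have "?a y P = ?b y P" by simp
    then have "sfib P (k y) = sfib P 0" using y W(2) by simp
    then show "k0 = 0" using sfib_inject[OF P] sfib_nonempty[OF k[OF y(1)] W(2)] y by blast
  qed
  show ?thesis
  proof (rule good_of_basis[OF sat, where Y="{..<r}" and m="\<lambda>i. coeffs (m i)"])
    fix i assume "i \<in> {..<r}"
    then show "coeffs (m i) \<in> lattice q Q" using M_coeffs(1)[OF m] by simp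
  next
    fix F k assume F: "finite F" "F \<subseteq> {..<r}" and z: "\<And>J. (\<Sum>i\<in>F. k i * coeffs (m i) J) = 0"
    show "\<forall>i\<in>F. k i = 0"
    proof (rule ccontr)
      assume "\<not> (\<forall>i\<in>F. k i = 0)"
      then obtain y where y: "y \<in> F" "k y \<noteq> 0" by blast
      then have yr: "y < r" using F by auto
      obtain \<delta> where \<delta>: "hz \<delta> (k y) \<noteq> 0" using hz_nonzero y by blast
      then have "\<delta> \<ge> 0" using S_deg_nonneg[OF hz_in] by blast
      moreover have "d y \<ge> 0" using S_deg_nonneg[OF f fnz] yr by blast
      ultimately have n: "int (nat (\<delta> + d y)) = \<delta> + d y" by simp
      define n where "n = nat (\<delta> + d y)"
      \<comment> \<open>The component of degree \<open>\<delta> + d y + c\<close> of the relation;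
        at \<open>y\<close> it retains \<open>hz \<delta> (k y)\<close>, which is nonzero.
        Multiplication by \<open>f i\<close> and division by \<open>?x ^ n\<close> turn its
        coefficients into elements of degree 0.\<close>
      define h where "h = (\<lambda>i. if i \<in> F then hz (\<delta> + d y - d i) (k i) else 0)"
      have hz0: "(\<Sum>i<r. h i * coeffs (m i) J) = 0" for J
      proof -
        have "(\<Sum>i<r. h i * coeffs (m i) J) = (\<Sum>i\<in>F. hz (\<delta> + d y + c) (k i * coeffs (m i) J))"
        proof (rule sum.mono_neutral_cong_right)
          fix i assume i: "i \<in> F"
          then have "i < r" using F by auto
          from hz_mult[OF M_coeffs(2)[OF m[OF this]], of "\<delta> + d y + c" J "k i"]
          show "h i * coeffs (m i) J = hz (\<delta> + d y + c) (k i * coeffs (m i) J)"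
            using i by (simp add: h_def mult.commute)
        qed (use F in \<open>auto simp: h_def\<close>)
        also have "\<dots> = 0" using z[of J] by (simp flip: hz_sum)
        finally show ?thesis .
      qed
      have "to_frac (h y * f y) / to_frac (?x ^ n) = 0"
      proof (rule indep[of "\<lambda>i. to_frac (h i * f i) / to_frac (?x ^ n)" y])
        fix i assume i: "i < r"
        have "h i * f i \<in> S_deg (\<delta> + d y)"
          using S_deg_mult[OF hz_in f[OF i], of "\<delta> + d y - d i" "k i"] by (simp add: h_def)
        moreover have "?x ^ n \<in> S_deg (\<delta> + d y)" using coord_power_S_deg[of i0 n] n by (simp add: n_def)
        ultimately show "to_frac (h i * f i) / to_frac (?x ^ n) \<in> sfracs W"
          using xnz Proj_power[OF _ xW] WP by (intro sfracsI) auto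
      next
        fix J
        have "(\<Sum>i<r. to_frac (h i * f i) / to_frac (?x ^ n) * v i J) =
            (\<Sum>i<r. to_frac (h i * coeffs (m i) J) / to_frac (?x ^ n))"
          by (rule sum.cong) (auto simp: v_eq fnz rhom_mult[OF rhom_to_frac])
        also have "\<dots> = to_frac (\<Sum>i<r. h i * coeffs (m i) J) / to_frac (?x ^ n)"
          by (simp add: sum_divide_distrib rhom_sum[OF rhom_to_frac])
        finally show "(\<Sum>i<r. to_frac (h i * f i) / to_frac (?x ^ n) * v i J) = 0"
          by (simp add: hz0)
      qed (use yr in auto)
      then show False using xnz fnz[OF yr] \<delta> y by (simp add: h_def)
    qed
  next
    fix \<eta> assume \<eta>: "\<eta> \<in> lattice q Q"
    let ?S = "\<lambda>\<eta>. \<exists>t\<in>- P. \<exists>k. \<forall>J. t * \<eta> J = (\<Sum>i<r. k i * coeffs (m i) J)"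
    have hom: "?S \<eta>" if \<eta>: "\<eta> \<in> lattice q Q" "\<And>I. \<eta> I \<in> S_deg \<delta>" for \<eta> \<delta>
    proof -
      obtain mm where mm: "mm \<in> M (\<delta> - c)" "\<And>I. \<phi> mm I = to_frac (\<eta> I)"
        by (rule M_surj[OF \<eta>]) blast
      \<comment> \<open>Two natural exponents whose difference \<open>nb - na\<close> is
        \<open>\<delta> - c\<close>, the degree of \<open>mm\<close>.\<close>
      define na where "na = nat \<bar>\<delta> - c\<bar>"
      define nb where "nb = nat (int na + (\<delta> - c))"
      have "int na + (\<delta> - c) \<ge> 0" unfolding na_def by linarith
      then have nb: "int nb = int na + (\<delta> - c)" by (simp add: nb_def)
      define w where "w = (\<lambda>I. to_frac (?x ^ na) / to_frac (?x ^ nb) * \<phi> mm I)"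
      have w: "w \<in> fracs M \<phi> W"
        unfolding w_def by (rule frac_power_fracs[OF WP xW mm(1) nb])
      have "(\<lambda>P'\<in>W. fib M \<phi> P' w) \<in> sections smul M W"
        unfolding sections_iff[OF WP] using w W(1)
        by (intro conjI ballI exI[of _ W] exI[of _ w]) auto
      then obtain a where a: "a \<in> {..<r} \<rightarrow>\<^sub>E structure_sections W"
        "lin_comb smul M W r a e = (\<lambda>P'\<in>W. fib M \<phi> P' w)"
        using bijW unfolding bij_betw_def by (metis (no_types, lifting) imageE)
      \<comment> \<open>Only germs at \<open>P\<close> are needed, so each section
        \<open>a i\<close> is replaced by the element of \<open>K\<close> that represents it
        there.\<close>
      have "\<exists>k. a i P = sfib P k \<and> sfib P k \<noteq> {}" if "i < r" for i
      proof -
        have "a i \<in> structure_sections W" using a(1) that by auto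
        then obtain W' k where "P \<in> W'" "k \<in> sfracs W'" "a i P = sfib P k"
          unfolding structure_sections_iff[OF WP] using W(2) by blast
        then show ?thesis using sfib_nonempty by blast
      qed
      then obtain k where k: "\<And>i. i < r \<Longrightarrow> a i P = sfib P (k i)" "\<And>i. i < r \<Longrightarrow> sfib P (k i) \<noteq> {}"
        by metis
      have "lin_comb smul M W r a e P = fib M \<phi> P (\<lambda>j. \<Sum>i<r. k i * v i j)"
        by (rule lin_comb_fib[OF WP W(2)]) (use k v(2) fib_nonempty[OF v(1) W(2)] W(2) in auto)
      then have "fib M \<phi> P w = fib M \<phi> P (\<lambda>j. \<Sum>i<r. k i * v i j)" using a(2) W(2) by simp
      then have w_eq: "w = (\<lambda>j. \<Sum>i<r. k i * v i j)"
        by (rule fib_inject[OF P]) (rule fib_nonempty[OF w W(2)])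
      have "\<exists>g\<in>- P. \<exists>n. to_frac g * (k i / to_frac (f i)) = to_frac n" if i: "i \<in> {..<r}" for i
      proof -
        obtain n g where "(n, g) \<in> sfib P (k i)" using k(2)[of i] i by auto
        then have g: "g \<notin> P" "to_frac n = to_frac g * k i" by (auto simp: sfib_iff)
        then have "to_frac (g * f i) * (k i / to_frac (f i)) = to_frac n"
          using fnz[of i] i by (simp add: rhom_mult[OF rhom_to_frac])
        moreover have "g * f i \<notin> P" using g(1) fP[of i] i Proj_prime[OF P] by simp
        ultimately show ?thesis by blast
      qed
      then obtain g s where g: "g \<in> - P" "\<And>i. i \<in> {..<r} \<Longrightarrow> to_frac g * (k i / to_frac (f i)) = to_frac (s i)"
        by (rule clear_denominators[OF sat finite_lessThan]) blast+
      have "(g * ?x ^ na) * \<eta> J = (\<Sum>i<r. (?x ^ nb * s i) * coeffs (m i) J)" for J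
      proof -
        have "to_frac (?x ^ na) * to_frac (\<eta> J) = to_frac (?x ^ nb) * w J"
          using xnz by (simp add: w_def mm(2))
        then have "to_frac ((g * ?x ^ na) * \<eta> J) = to_frac g * to_frac (?x ^ nb) * (\<Sum>i<r. k i * v i J)"
          using fun_cong[OF w_eq, of J] by (simp add: rhom_mult[OF rhom_to_frac] mult.assoc)
        also have "\<dots> = (\<Sum>i<r. to_frac (?x ^ nb) * (to_frac g * (k i / to_frac (f i))) * to_frac (coeffs (m i) J))"
          unfolding sum_distrib_left by (rule sum.cong) (simp_all add: v_eq ac_simps)
        also have "\<dots> = (\<Sum>i<r. to_frac (?x ^ nb) * to_frac (s i) * to_frac (coeffs (m i) J))"
          by (rule sum.cong) (simp_all only: g(2))
        also have "\<dots> = to_frac (\<Sum>i<r. (?x ^ nb * s i) * coeffs (m i) J)"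
          by (simp add: rhom_sum[OF rhom_to_frac] rhom_mult[OF rhom_to_frac])
        finally show ?thesis by simp
      qed
      moreover have "g * ?x ^ na \<in> - P" using g(1) Proj_power[OF P i0] Proj_prime[OF P] by simp
      ultimately show ?thesis by (intro bexI[of _ "g * ?x ^ na"] exI[of _ "\<lambda>i. ?x ^ nb * s i"]) auto
    qed
    \<comment> \<open>Passes from homogeneous to arbitrary lattice elements by adding components
      over the product of their denominators.\<close>
    have sum: "?S (\<lambda>J. \<Sum>\<delta>\<in>X. G \<delta> J)" if "finite X" "\<And>\<delta>. \<delta> \<in> X \<Longrightarrow> ?S (G \<delta>)" for X :: "int set" and G
      using that
    proof (induction X rule: finite_induct)
      case empty
      have "1 \<in> - P" using Proj_1[OF P] by simp
      then show ?case by (intro bexI[of _ 1] exI[of _ "\<lambda>_. 0"]) auto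
    next
      case (insert \<delta> X)
      obtain t k where 1: "t \<in> - P" "\<And>J. t * G \<delta> J = (\<Sum>i<r. k i * coeffs (m i) J)"
        using insert.prems by blast
      obtain t' k' where 2: "t' \<in> - P" "\<And>J. t' * (\<Sum>\<delta>\<in>X. G \<delta> J) = (\<Sum>i<r. k' i * coeffs (m i) J)"
        using insert.IH insert.prems by blast
      have "(t * t') * (\<Sum>\<delta>\<in>insert \<delta> X. G \<delta> J) = (\<Sum>i<r. (t' * k i + t * k' i) * coeffs (m i) J)" for J
      proof -
        have "(t * t') * (\<Sum>\<delta>\<in>insert \<delta> X. G \<delta> J) = t' * (t * G \<delta> J) + t * (t' * (\<Sum>\<delta>\<in>X. G \<delta> J))"
          using insert by (simp add: algebra_simps)
        also have "\<dots> = (\<Sum>i<r. (t' * k i + t * k' i) * coeffs (m i) J)"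
          unfolding 1 2 by (simp add: sum_distrib_left distrib_right sum.distrib mult.assoc)
        finally show ?thesis .
      qed
      moreover have "t * t' \<in> - P" using 1 2 Proj_prime[OF P] by simp
      ultimately show ?case by (intro bexI[of _ "t * t'"] exI[of _ "\<lambda>i. t' * k i + t * k' i"]) auto
    qed
    obtain X where X: "finite X" "\<And>y. y \<in> UNIV \<Longrightarrow> (\<Sum>\<delta>\<in>X. hz \<delta> (\<eta> y)) = \<eta> y"
      by (rule hz_decomp[of UNIV \<eta>]) auto
    have "?S (\<lambda>J. \<Sum>\<delta>\<in>X. hz \<delta> (\<eta> J))"
      by (rule sum[OF X(1)]) (rule hom[OF lattice_hz[OF \<eta>] hz_in])
    then have "?S \<eta>" using X(2) by simp
    then show "\<exists>t\<in>- P. \<exists>F k. finite F \<and> F \<subseteq> {..<r} \<and> (\<forall>J. t * \<eta> J = (\<Sum>i\<in>F. k i * coeffs (m i) J))"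
      by (meson finite_lessThan order_refl)
  qed
qed

text \<open>The tuple for \<open>P\<close> may be taken homogeneous, and it serves all points at
  which its quotient \<open>g\<close> and a coordinate are invertible. There the multiples
  \<open>v i\<close> of degree 0 are a basis: Cramer's rule expands every fraction, and independence
  over \<open>K\<close> makes the coefficients unique, so that they glue.\<close>

theorem locally_free_of_good:
  assumes good: "\<forall>P\<in>Proj. good (- P) q Q"
  shows "sheaf_locally_free smul M"
  unfolding sheaf_locally_free_def
proof
  fix P :: "('n, 'k) mpoly set" assume P: "P \<in> Proj"
  let ?e = "ee TYPE('n) q"
  obtain \<theta>0 t0 where \<theta>0: "\<And>I. I \<in> idx q \<Longrightarrow> \<theta>0 I \<in> lattice q Q" "det (pdm q \<theta>0) = Q ^ ?e * t0" "t0 \<notin> P"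
    using good P by (fastforce simp: good_def)
  obtain \<theta> d g where \<theta>: "\<And>I. I \<in> idx q \<Longrightarrow> \<theta> I \<in> lattice q Q" and \<theta>d: "\<And>I J. \<theta> I J \<in> S_deg (d I)"
    and det: "det (pdm q \<theta>) = Q ^ ?e * g" and gP: "g \<notin> P"
    and g: "g \<in> S_deg ((\<Sum>I\<in>idx q. d I) - int ?e * int (card B))"
    using homogeneous_tuple[OF ideal_set_Proj[OF P], of q \<theta>0 t0] \<theta>0 by metis
  define dg where "dg = (\<Sum>I\<in>idx q. d I) - int ?e * int (card B)"
  note g = g[folded dg_def]
  have gnz: "g \<noteq> 0" using gP Proj_0[OF P] by metis
  have detnz: "det (pdm q \<theta>) \<noteq> 0" using det gnz Q_nonzero by simp
  obtain i0 where i0: "coord i0 \<notin> P" using Proj_coord[OF P] .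
  let ?x = "coord i0 :: ('n, 'k) mpoly"
  have xnz: "?x \<noteq> 0" using i0 Proj_0[OF P] by metis
  define r where "r = card (idx q :: 'n set set)"
  obtain \<beta> where \<beta>: "bij_betw \<beta> {..<r} (idx q :: 'n set set)"
    unfolding r_def using ex_bij_betw_nat_finite[of "idx q :: 'n set set"] by (auto simp: atLeast0LessThan)
  have \<beta>I: "\<beta> i \<in> idx q" if "i < r" for i using bij_betwE[OF \<beta>] that by blast
  have "\<exists>m. m \<in> M (d I - c) \<and> (\<forall>J. \<phi> m J = to_frac (\<theta> I J))" if I: "I \<in> idx q" for I
    by (rule M_surj[OF \<theta>[OF I] \<theta>d]) blast
  then obtain b where b: "\<And>I. I \<in> idx q \<Longrightarrow> b I \<in> M (d I - c)" "\<And>I J. I \<in> idx q \<Longrightarrow> \<phi> (b I) J = to_frac (\<theta> I J)"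
    by metis
  \<comment> \<open>Large enough for all the differences that define \<open>nb I\<close> to be
    nonnegative.\<close>
  define na where "na = nat (\<bar>c\<bar> + (\<Sum>I\<in>idx q. \<bar>d I\<bar>))"
  define nb where "nb = (\<lambda>I. nat (int na + (d I - c)))"
  have nb: "int (nb I) = int na + (d I - c)" if "I \<in> idx q" for I
  proof -
    have "\<bar>d I\<bar> \<le> (\<Sum>I\<in>idx q. \<bar>d I\<bar>)" by (rule member_le_sum) (use that in auto)
    then show ?thesis by (simp add: na_def nb_def)
  qed
  define U where "U = {P\<in>Proj. g * ?x \<notin> P}"
  have U: "zariski_open U" "P \<in> U"
    unfolding U_def using zariski_open_principal[OF S_deg_mult[OF g S_deg_coord]] P gP i0 Proj_prime[OF P] by auto
  have UP: "U \<subseteq> Proj" and xU: "\<And>P'. P' \<in> U \<Longrightarrow> ?x \<notin> P'" and gU: "\<And>P'. P' \<in> U \<Longrightarrow> g \<notin> P'"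
    using Proj_prime by (auto simp: U_def)
  define v where "v = (\<lambda>i J. to_frac (?x ^ na) / to_frac (?x ^ nb (\<beta> i)) * \<phi> (b (\<beta> i)) J)"
  have v: "v i \<in> fracs M \<phi> U" if "i < r" for i
    unfolding v_def by (rule frac_power_fracs[OF UP xU b(1)[OF \<beta>I[OF that]] nb[OF \<beta>I[OF that]]])
  define e where "e = (\<lambda>i. \<lambda>P'\<in>U. fib M \<phi> P' (v i))"
  have e: "e i \<in> sections smul M U" if "i < r" for i
    unfolding sections_iff[OF UP] e_def using v[OF that] U(1)
    by (intro conjI ballI exI[of _ U] exI[of _ "v i"]) auto
  have indep: "k y = 0" if z: "\<And>J. (\<Sum>i<r. k i * v i J) = 0" and y: "y < r" for k y
  proof -
    define k' where "k' = (\<lambda>I. k (inv_into {..<r} \<beta> I) * (to_frac (?x ^ na) / to_frac (?x ^ nb I)))"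
    have k': "k' (\<beta> i) = k i * (to_frac (?x ^ na) / to_frac (?x ^ nb (\<beta> i)))" if "i < r" for i
      using bij_betw_inv_into_left[OF \<beta>, of i] that by (simp add: k'_def)
    have "k' (\<beta> y) = 0"
    proof (rule det_pdm_row_indep[OF detnz _ \<beta>I[OF y]])
      fix J
      have "(\<Sum>I\<in>idx q. k' I * to_frac (\<theta> I J)) = (\<Sum>i<r. k' (\<beta> i) * to_frac (\<theta> (\<beta> i) J))"
        by (rule sum.reindex_bij_betw[OF \<beta>, symmetric])
      also have "\<dots> = (\<Sum>i<r. k i * v i J)"
        by (rule sum.cong) (simp_all add: k' v_def b(2)[OF \<beta>I])
      finally show "(\<Sum>I\<in>idx q. k' I * to_frac (\<theta> I J)) = 0" using z by simp
    qed
    then show ?thesis using k'[OF y] xnz by simp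
  qed
  have expand: "\<exists>k. (\<forall>i<r. k i \<in> sfracs W) \<and> w = (\<lambda>J. \<Sum>i<r. k i * v i J)"
    if W: "W \<subseteq> U" "W \<noteq> {}" and w: "w \<in> fracs M \<phi> W" for W w
  proof -
    obtain dm m f where m: "m \<in> M dm" and f: "f \<in> S_deg dm" "\<And>P'. P' \<in> W \<Longrightarrow> f \<notin> P'"
      and mf: "\<And>I. \<phi> m I = to_frac f * w I"
      using w by (auto simp: fracs_def)
    have fnz: "f \<noteq> 0" using f(2) Proj_0 W UP by blast
    obtain s0 where s0: "\<And>J. g * coeffs m J = (\<Sum>I\<in>idx q. s0 I * \<theta> I J)"
      by (rule cramer_lattice[of q \<theta> g "coeffs m"]) (use \<theta> det gnz M_coeffs(1)[OF m] in auto)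
    \<comment> \<open>Cramer's coefficients may be inhomogeneous; their components of the fitting
      degree satisfy the same equation.\<close>
    define s where "s = (\<lambda>I. hz (dg + dm + c - d I) (s0 I))"
    have s: "g * coeffs m J = (\<Sum>I\<in>idx q. s I * \<theta> I J)" for J
    proof -
      have "g * coeffs m J \<in> S_deg (dg + (dm + c))" by (rule S_deg_mult[OF g M_coeffs(2)[OF m]])
      then have "g * coeffs m J = hz (dg + dm + c) (g * coeffs m J)" by (simp add: hz_same add.assoc)
      also have "\<dots> = (\<Sum>I\<in>idx q. hz (dg + dm + c) (\<theta> I J * s0 I))"
        by (simp add: s0 hz_sum mult.commute[of "s0 _"])
      also have "\<dots> = (\<Sum>I\<in>idx q. s I * \<theta> I J)"
        by (rule sum.cong) (simp_all add: hz_mult[OF \<theta>d] s_def mult.commute[of "hz _ _"])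
      finally show ?thesis .
    qed
    define k where "k = (\<lambda>i. to_frac (s (\<beta> i) * ?x ^ nb (\<beta> i)) / to_frac (g * f * ?x ^ na))"
    have nz: "g * f * ?x ^ na \<noteq> 0" using gnz fnz xnz by simp
    have "k i \<in> sfracs W" if i: "i < r" for i
    proof -
      have "s (\<beta> i) * ?x ^ nb (\<beta> i) \<in> S_deg ((dg + dm + c - d (\<beta> i)) + int (nb (\<beta> i)))"
        unfolding s_def by (rule S_deg_mult[OF hz_in coord_power_S_deg])
      then have "s (\<beta> i) * ?x ^ nb (\<beta> i) \<in> S_deg (dg + dm + int na)"
        by (simp add: nb[OF \<beta>I[OF i]] algebra_simps)
      moreover have "g * f * ?x ^ na \<in> S_deg (dg + dm + int na)"
        by (intro S_deg_mult g f coord_power_S_deg)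
      moreover have "g * f * ?x ^ na \<notin> P'" if "P' \<in> W" for P'
      proof -
        have "P' \<in> U" "P' \<in> Proj" using that W UP by auto
        then show ?thesis using gU f(2)[OF that] Proj_power[OF _ xU] Proj_prime by blast
      qed
      ultimately show ?thesis
        unfolding k_def using nz by (intro sfracsI) auto
    qed
    moreover have "w J = (\<Sum>i<r. k i * v i J)" for J
    proof -
      have "(\<Sum>i<r. k i * v i J) = (\<Sum>i<r. to_frac (s (\<beta> i) * \<theta> (\<beta> i) J) / to_frac (g * f))"
        by (rule sum.cong) (use xnz in \<open>simp_all add: k_def v_def b(2)[OF \<beta>I] rhom_mult[OF rhom_to_frac]\<close>)
      also have "\<dots> = (\<Sum>I\<in>idx q. to_frac (s I * \<theta> I J) / to_frac (g * f))"
        by (rule sum.reindex_bij_betw[OF \<beta>])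
      also have "\<dots> = to_frac (g * coeffs m J) / to_frac (g * f)"
        by (simp add: s rhom_sum[OF rhom_to_frac] sum_divide_distrib)
      also have "\<dots> = w J"
        using mf[of J] M_coeffs(3)[OF m, of J] gnz fnz by (simp add: rhom_mult[OF rhom_to_frac])
      finally show ?thesis by simp
    qed
    ultimately show ?thesis by blast
  qed
  show "\<exists>U r e. zariski_open U \<and> P \<in> U \<and> (\<forall>i<r. e i \<in> sections smul M U) \<and>
      (\<forall>W. zariski_open W \<and> W \<subseteq> U \<longrightarrow>
        bij_betw (\<lambda>a. lin_comb smul M W r a e) ({..<r} \<rightarrow>\<^sub>E structure_sections W) (sections smul M W))"
  proof (rule exI[of _ U], rule exI[of _ r], rule exI[of _ e], intro conjI allI impI)
    show "zariski_open U" "P \<in> U" by (rule U)+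
    show "e i \<in> sections smul M U" if "i < r" for i by (rule e[OF that])
    fix W assume "zariski_open W \<and> W \<subseteq> U"
    then have W: "zariski_open W" "W \<subseteq> U" by auto
    then have WP: "W \<subseteq> Proj" using UP by blast
    have eW: "e i P' = fib M \<phi> P' (v i)" if "P' \<in> W" for i P'
      using that W(2) by (auto simp: e_def)
    have v1: "v i \<in> fracs M \<phi> {P'}" if "P' \<in> W" "i < r" for i P'
      by (rule fracs_mono[OF v[OF that(2)]]) (use that W in auto)
    have local: "\<exists>W'. zariski_open W' \<and> P' \<in> W' \<and> W' \<subseteq> W \<and>
        (\<exists>k. \<forall>i<r. k i \<in> sfracs W' \<and> (\<forall>P''\<in>W'. a i P'' = sfib P'' (k i)))"
      if a: "a \<in> {..<r} \<rightarrow>\<^sub>E structure_sections W" and P': "P' \<in> W" for a P'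
    proof -
      let ?\<Phi> = "\<lambda>i W. \<exists>k. k \<in> sfracs W \<and> (\<forall>P''\<in>W. a i P'' = sfib P'' k)"
      have "\<exists>W'. zariski_open W' \<and> P' \<in> W' \<and> ?\<Phi> i W'" if "i < r" for i
      proof -
        have "a i \<in> structure_sections W" using a that by auto
        then show ?thesis using P' unfolding structure_sections_iff[OF WP] by blast
      qed
      moreover have "?\<Phi> i V" if "?\<Phi> i W" "V \<subseteq> W" for i V W
        using that sfracs_mono[of _ W V] by blast
      ultimately obtain W' where W': "zariski_open W'" "P' \<in> W'" "W' \<subseteq> W" "\<And>i. i < r \<Longrightarrow> ?\<Phi> i W'"
        by (rule zariski_open_finite_refine[OF W(1) P', of r ?\<Phi>]) blast+
      then show ?thesis by metis
    qed
    have lc: "lin_comb smul M W r a e P' = fib M \<phi> P' (\<lambda>J. \<Sum>i<r. k i * v i J)"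
      if P': "P' \<in> W" and k: "\<And>i. i < r \<Longrightarrow> k i \<in> sfracs {P'}" "\<And>i. i < r \<Longrightarrow> a i P' = sfib P' (k i)" for a P' k
      by (rule lin_comb_fib[OF WP P'])
        (use k(2) eW[OF P'] fib_nonempty[OF v1[OF P']] sfib_nonempty[OF k(1)] in auto)
    have ne: "fib M \<phi> P' (\<lambda>J. \<Sum>i<r. k i * v i J) \<noteq> {}"
      if P': "P' \<in> W" and k: "\<And>i. i < r \<Longrightarrow> k i \<in> sfracs {P'}" for P' k
      by (rule fib_nonempty[OF fracs_lin_comb[OF _ k v1[OF P']]]) (use P' WP in auto)
    have unique: "k i = k' i"
      if P': "P' \<in> W" and k: "\<And>i. i < r \<Longrightarrow> k i \<in> sfracs {P'}"
        and eq: "fib M \<phi> P' (\<lambda>J. \<Sum>i<r. k i * v i J) = fib M \<phi> P' (\<lambda>J. \<Sum>i<r. k' i * v i J)"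
        and i: "i < r" for P' k k' i
    proof -
      have "P' \<in> Proj" using P' WP by blast
      from fib_inject[OF this eq ne[OF P' k]]
      have "(\<Sum>i<r. k i * v i J) = (\<Sum>i<r. k' i * v i J)" for J by (simp add: fun_eq_iff)
      then have "(\<Sum>i<r. (k i - k' i) * v i J) = 0" for J by (simp add: left_diff_distrib sum_subtractf)
      then have "k i - k' i = 0" using indep[of "\<lambda>i. k i - k' i" i] i by blast
      then show ?thesis by simp
    qed
    show "bij_betw (\<lambda>a. lin_comb smul M W r a e) ({..<r} \<rightarrow>\<^sub>E structure_sections W) (sections smul M W)"
    proof (rule bij_betw_imageI)
      show "inj_on (\<lambda>a. lin_comb smul M W r a e) ({..<r} \<rightarrow>\<^sub>E structure_sections W)"
      proof (rule inj_onI)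
        fix a a' assume a: "a \<in> {..<r} \<rightarrow>\<^sub>E structure_sections W" "a' \<in> {..<r} \<rightarrow>\<^sub>E structure_sections W"
          and eq: "lin_comb smul M W r a e = lin_comb smul M W r a' e"
        have pt: "a i P' = a' i P'" if P': "P' \<in> W" and i: "i < r" for i P'
        proof -
          obtain k W1 where k: "P' \<in> W1" "\<And>i. i < r \<Longrightarrow> k i \<in> sfracs W1" "\<And>i. i < r \<Longrightarrow> a i P' = sfib P' (k i)"
            using local[OF a(1) P'] by blast
          obtain k' W2 where k': "P' \<in> W2" "\<And>i. i < r \<Longrightarrow> k' i \<in> sfracs W2" "\<And>i. i < r \<Longrightarrow> a' i P' = sfib P' (k' i)"
            using local[OF a(2) P'] by blast
          have 1: "k i \<in> sfracs {P'}" "k' i \<in> sfracs {P'}" if "i < r" for i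
            using sfracs_mono[of _ W1 "{P'}"] sfracs_mono[of _ W2 "{P'}"] k k' that by auto
          have "fib M \<phi> P' (\<lambda>J. \<Sum>i<r. k i * v i J) = fib M \<phi> P' (\<lambda>J. \<Sum>i<r. k' i * v i J)"
            using lc[where k=k and a=a, OF P' 1(1) k(3)] lc[where k=k' and a=a', OF P' 1(2) k'(3)] eq by simp
          then have "k i = k' i" using unique[of P' k k' i] P' 1(1) i by blast
          then show ?thesis using k(3) k'(3) i by simp
        qed
        show "a = a'"
        proof (rule PiE_ext[OF a])
          fix i assume "i \<in> {..<r}"
          then have i: "i < r" by simp
          have "a i \<in> extensional W" "a' i \<in> extensional W"
            using a i unfolding PiE_iff structure_sections_iff[OF WP] by auto
          then show "a i = a' i" by (rule extensionalityI) (rule pt[OF _ i])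
        qed
      qed
      show "(\<lambda>a. lin_comb smul M W r a e) ` ({..<r} \<rightarrow>\<^sub>E structure_sections W) = sections smul M W"
      proof (intro equalityI subsetI)
        fix s assume "s \<in> (\<lambda>a. lin_comb smul M W r a e) ` ({..<r} \<rightarrow>\<^sub>E structure_sections W)"
        then obtain a where a: "a \<in> {..<r} \<rightarrow>\<^sub>E structure_sections W" and s: "s = lin_comb smul M W r a e" by blast
        have "\<exists>W' w. zariski_open W' \<and> P' \<in> W' \<and> W' \<subseteq> W \<and> w \<in> fracs M \<phi> W' \<and> (\<forall>P''\<in>W'. s P'' = fib M \<phi> P'' w)"
          if P': "P' \<in> W" for P'
        proof -
          obtain W' k where W': "zariski_open W'" "P' \<in> W'" "W' \<subseteq> W"
            and k: "\<And>i. i < r \<Longrightarrow> k i \<in> sfracs W'" "\<And>i P''. i < r \<Longrightarrow> P'' \<in> W' \<Longrightarrow> a i P'' = sfib P'' (k i)"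
            using local[OF a P'] by blast
          have "(\<lambda>J. \<Sum>i<r. k i * v i J) \<in> fracs M \<phi> W'"
            by (rule fracs_lin_comb[OF _ k(1) fracs_mono[OF v]]) (use W' WP W(2) in auto)
          moreover have "s P'' = fib M \<phi> P'' (\<lambda>J. \<Sum>i<r. k i * v i J)" if P'': "P'' \<in> W'" for P''
            unfolding s
          proof (rule lc)
            show "P'' \<in> W" using P'' W' by auto
            show "k i \<in> sfracs {P''}" if "i < r" for i
              using sfracs_mono[OF k(1)[OF that], of "{P''}"] P'' by simp
            show "a i P'' = sfib P'' (k i)" if "i < r" for i by (rule k(2)[OF that P''])
          qed
          ultimately show ?thesis using W' by blast
        qed
        moreover have "s \<in> extensional W" by (simp add: s lin_comb_def)
        ultimately show "s \<in> sections smul M W" unfolding sections_iff[OF WP] by blast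
      next
        fix s assume s: "s \<in> sections smul M W"
        let ?K = "\<lambda>P' k. (\<forall>i<r. k i \<in> sfracs {P'}) \<and> s P' = fib M \<phi> P' (\<lambda>J. \<Sum>i<r. k i * v i J)"
        have loc: "\<exists>W' k. zariski_open W' \<and> P' \<in> W' \<and> W' \<subseteq> W \<and> (\<forall>i<r. k i \<in> sfracs W') \<and> (\<forall>P''\<in>W'. ?K P'' k)"
          if P': "P' \<in> W" for P'
        proof -
          obtain W' w where W': "zariski_open W'" "P' \<in> W'" "W' \<subseteq> W" "w \<in> fracs M \<phi> W'"
            "\<And>P''. P'' \<in> W' \<Longrightarrow> s P'' = fib M \<phi> P'' w"
            using s P' unfolding sections_iff[OF WP] by blast
          have "W' \<subseteq> U" "W' \<noteq> {}" using W' W by auto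
          then obtain k where k: "\<And>i. i < r \<Longrightarrow> k i \<in> sfracs W'" "w = (\<lambda>J. \<Sum>i<r. k i * v i J)"
            using expand[OF _ _ W'(4)] by blast
          have "?K P'' k" if P'': "P'' \<in> W'" for P''
            using W'(5)[OF P''] k(2) sfracs_mono[OF k(1), of _ "{P''}"] P'' by simp
          then show ?thesis using W'(1-3) k(1) by blast
        qed
        \<comment> \<open>The coefficients are chosen point by point. By \<open>unique\<close> they
          agree with every local choice, which makes them sections.\<close>
        define k0 where "k0 = (\<lambda>P'. SOME k. ?K P' k)"
        have k0: "?K P' (k0 P')" if "P' \<in> W" for P'
        proof -
          have "\<exists>k. ?K P' k" using loc[OF that] by blast
          from someI_ex[OF this] show ?thesis unfolding k0_def .
        qed
        have k0_eq: "k0 P' i = k i" if P': "P' \<in> W" and k: "?K P' k" and i: "i < r" for P' k i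
          using unique[OF P', of "k0 P'" k i] k0[OF P'] k i by auto
        define a where "a = (\<lambda>i\<in>{..<r}. \<lambda>P'\<in>W. sfib P' (k0 P' i))"
        have aS: "a \<in> {..<r} \<rightarrow>\<^sub>E structure_sections W"
        proof (rule PiE_I)
          fix i assume "i \<in> {..<r}"
          then have i: "i < r" by simp
          have "\<exists>W' k. zariski_open W' \<and> P' \<in> W' \<and> W' \<subseteq> W \<and> k \<in> sfracs W' \<and> (\<forall>P''\<in>W'. a i P'' = sfib P'' k)"
            if P': "P' \<in> W" for P'
          proof -
            obtain W' k where W': "zariski_open W'" "P' \<in> W'" "W' \<subseteq> W" "k i \<in> sfracs W'" "\<And>P''. P'' \<in> W' \<Longrightarrow> ?K P'' k"
              using loc[OF P'] i by blast
            have "a i P'' = sfib P'' (k i)" if P'': "P'' \<in> W'" for P''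
            proof -
              have "P'' \<in> W" using P'' W' by blast
              then show ?thesis using k0_eq[OF _ W'(5)[OF P''] i] i by (simp add: a_def)
            qed
            then show ?thesis using W' by blast
          qed
          moreover have "a i \<in> extensional W" using i by (simp add: a_def)
          ultimately show "a i \<in> structure_sections W" unfolding structure_sections_iff[OF WP] by blast
        qed (simp add: a_def)
        have "lin_comb smul M W r a e P' = s P'" if P': "P' \<in> W" for P'
        proof -
          have "lin_comb smul M W r a e P' = fib M \<phi> P' (\<lambda>J. \<Sum>i<r. k0 P' i * v i J)"
            by (rule lc[OF P']) (use k0[OF P'] P' in \<open>auto simp: a_def\<close>)
          then show ?thesis using k0[OF P'] by simp
        qed
        moreover have "lin_comb smul M W r a e \<in> extensional W" by (simp add: lin_comb_def)
        moreover have "s \<in> extensional W" using s unfolding sections_iff[OF WP] by blast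
        ultimately have "lin_comb smul M W r a e = s" by (intro extensionalityI)
        then show "s \<in> (\<lambda>a. lin_comb smul M W r a e) ` ({..<r} \<rightarrow>\<^sub>E structure_sections W)"
          using aS by blast
      qed
    qed
  qed
qed

theorem locally_free_iff_good: "sheaf_locally_free smul M \<longleftrightarrow> (\<forall>P\<in>Proj. good (- P) q Q)"
  using good_of_locally_free locally_free_of_good by blast

end

section \<open>Logarithmic multiderivations\<close>

text \<open>The second clause is the derivation property in each argument, already expanded in
  partial derivatives; for alternation adjacent repetitions are enough. These properties determine
  an element by its values at increasing lists of coordinates.\<close>

definition multider :: "nat \<Rightarrow> ('n::{finite,linorder}, 'k::field) mder \<Rightarrow> bool"
  where "multider p \<theta> \<longleftrightarrow>
    (\<forall>fs. length fs \<noteq> p \<longrightarrow> \<theta> fs = 0) \<and>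
    (\<forall>pre f post. \<theta> (pre @ f # post) = (\<Sum>i\<in>UNIV. pd i f * \<theta> (pre @ coord i # post))) \<and>
    (\<forall>pre f post. \<theta> (pre @ f # f # post) = 0)"

lemma multider_length: "multider p \<theta> \<Longrightarrow> length fs \<noteq> p \<Longrightarrow> \<theta> fs = 0"
  and multider_expand: "multider p \<theta> \<Longrightarrow> \<theta> (pre @ f # post) = (\<Sum>i\<in>UNIV. pd i f * \<theta> (pre @ coord i # post))"
  and multider_alternating: "multider p \<theta> \<Longrightarrow> \<theta> (pre @ f # f # post) = 0"
  unfolding multider_def by blast+

text \<open>Composition with the transposition pairs even with odd permutations, and paired terms
  cancel. Unlike a comparison of the sum with its negative, this is valid in characteristic
  2.\<close>

lemma sum_permutes_alternating_0:
  fixes t :: "(nat \<Rightarrow> nat) \<Rightarrow> 'r::comm_ring_1"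
  assumes k: "Suc k < p"
    and t: "\<And>\<sigma>. \<sigma> permutes {..<p} \<Longrightarrow> t (Transposition.transpose k (Suc k) \<circ> \<sigma>) = t \<sigma>"
  shows "(\<Sum>\<sigma> | \<sigma> permutes {..<p}. of_int (sign \<sigma>) * t \<sigma>) = 0"
proof -
  let ?\<tau> = "Transposition.transpose k (Suc k)"
  let ?A = "{\<sigma>. \<sigma> permutes {..<p} \<and> evenperm \<sigma>}" and ?B = "{\<sigma>. \<sigma> permutes {..<p} \<and> \<not> evenperm \<sigma>}"
  have \<tau>: "?\<tau> permutes {..<p}" using k by (intro permutes_swap_id) auto
  have comp: "?\<tau> \<circ> \<sigma> permutes {..<p}" if "\<sigma> permutes {..<p}" for \<sigma>
    using permutes_compose[OF that \<tau>] .
  have perm: "permutation \<sigma>" if "\<sigma> permutes {..<p}" for \<sigma>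
    using that permutation_permutes by blast
  have sgn: "sign (?\<tau> \<circ> \<sigma>) = - sign \<sigma>" if "\<sigma> permutes {..<p}" for \<sigma>
    by (simp add: sign_compose permutation_swap_id perm[OF that] sign_swap_id)
  have ev: "evenperm (?\<tau> \<circ> \<sigma>) \<longleftrightarrow> \<not> evenperm \<sigma>" if "\<sigma> permutes {..<p}" for \<sigma>
    using sgn[OF that] by (auto simp: sign_def split: if_splits)
  have inv: "?\<tau> \<circ> (?\<tau> \<circ> \<sigma>) = \<sigma>" for \<sigma> by (simp add: fun_eq_iff)
  have fin: "finite {\<sigma>. \<sigma> permutes {..<p}}" by (rule finite_permutations) simp
  have "{\<sigma>. \<sigma> permutes {..<p}} = ?A \<union> ?B" by auto
  then have "(\<Sum>\<sigma> | \<sigma> permutes {..<p}. of_int (sign \<sigma>) * t \<sigma>) =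
      (\<Sum>\<sigma>\<in>?A. of_int (sign \<sigma>) * t \<sigma>) + (\<Sum>\<sigma>\<in>?B. of_int (sign \<sigma>) * t \<sigma>)"
  proof (simp only:, intro sum.union_disjoint)
    show "finite ?A" "finite ?B" by (rule finite_subset[OF _ fin]; auto)+
  qed auto
  also have "(\<Sum>\<sigma>\<in>?B. of_int (sign \<sigma>) * t \<sigma>) = (\<Sum>\<sigma>\<in>?A. of_int (sign (?\<tau> \<circ> \<sigma>)) * t (?\<tau> \<circ> \<sigma>))"
    by (rule sum.reindex_bij_witness[of _ "\<lambda>\<sigma>. ?\<tau> \<circ> \<sigma>" "\<lambda>\<sigma>. ?\<tau> \<circ> \<sigma>"])
      (auto simp only: mem_Collect_eq ev comp inv)
  also have "\<dots> = - (\<Sum>\<sigma>\<in>?A. of_int (sign \<sigma>) * t \<sigma>)"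
    unfolding sum_negf[symmetric] by (rule sum.cong) (simp_all only: mem_Collect_eq sgn t of_int_minus mult_minus_left)
  finally show ?thesis by simp
qed

lemma multider_wedge:
  assumes Ds: "\<And>D. D \<in> set Ds \<Longrightarrow> derivation D"
  shows "multider (length Ds) (wedge Ds)"
  unfolding multider_def
proof (intro conjI allI impI)
  let ?p = "length Ds"
  show "wedge Ds fs = 0" if "length fs \<noteq> ?p" for fs using that by (simp add: wedge_def)
  fix pre post :: "('a, 'b) mpoly list" and f
  show "wedge Ds (pre @ f # post) = (\<Sum>i\<in>UNIV. pd i f * wedge Ds (pre @ coord i # post))"
  proof (cases "length pre + Suc (length post) = ?p")
    case True
    let ?k = "length pre"
    have nth: "(pre @ g # post) ! m = (if m = ?k then g else (pre @ f # post) ! m)" for g m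
      by (auto simp: nth_append nth_Cons')
    have "(\<Prod>i<?p. (Ds ! i) ((pre @ f # post) ! \<sigma> i)) =
        (\<Sum>j\<in>UNIV. pd j f * (\<Prod>i<?p. (Ds ! i) ((pre @ coord j # post) ! \<sigma> i)))"
      if \<sigma>: "\<sigma> permutes {..<?p}" for \<sigma>
    proof -
      have "?k \<in> {..<?p}" using True by simp
      \<comment> \<open>The one factor of the product that receives the argument at position
        \<open>?k\<close>.\<close>
      then obtain i0 where i0: "i0 < ?p" "\<sigma> i0 = ?k"
        using permutes_image[OF \<sigma>] by (metis imageE lessThan_iff)
      have other: "\<sigma> i \<noteq> ?k" if "i \<noteq> i0" for i
        using permutes_inj[OF \<sigma>] i0 that by (metis injD)
      define X where "X = (\<Prod>i\<in>{..<?p}-{i0}. (Ds ! i) ((pre @ f # post) ! \<sigma> i))"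
      have split: "(\<Prod>i<?p. (Ds ! i) ((pre @ g # post) ! \<sigma> i)) = (Ds ! i0) g * X" for g
      proof -
        have "(\<Prod>i<?p. (Ds ! i) ((pre @ g # post) ! \<sigma> i)) =
            (Ds ! i0) ((pre @ g # post) ! \<sigma> i0) * (\<Prod>i\<in>{..<?p}-{i0}. (Ds ! i) ((pre @ g # post) ! \<sigma> i))"
          using i0 by (intro prod.remove) auto
        also have "(\<Prod>i\<in>{..<?p}-{i0}. (Ds ! i) ((pre @ g # post) ! \<sigma> i)) = X"
          unfolding X_def by (rule prod.cong) (use other nth[of g] in auto)
        finally show ?thesis using i0 by simp
      qed
      have "derivation (Ds ! i0)" using Ds i0 by simp
      then show ?thesis
        unfolding split by (subst derivation_expand) (simp_all add: sum_distrib_right mult.assoc)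
    qed
    then have "wedge Ds (pre @ f # post) = (\<Sum>\<sigma> | \<sigma> permutes {..<?p}. of_int (sign \<sigma>) *
        (\<Sum>j\<in>UNIV. pd j f * (\<Prod>i<?p. (Ds ! i) ((pre @ coord j # post) ! \<sigma> i))))"
      using True by (simp add: wedge_def)
    also have "\<dots> = (\<Sum>\<sigma> | \<sigma> permutes {..<?p}. \<Sum>j\<in>UNIV. pd j f * (of_int (sign \<sigma>) *
        (\<Prod>i<?p. (Ds ! i) ((pre @ coord j # post) ! \<sigma> i))))"
      by (simp add: sum_distrib_left mult.left_commute)
    also have "\<dots> = (\<Sum>j\<in>UNIV. \<Sum>\<sigma> | \<sigma> permutes {..<?p}. pd j f * (of_int (sign \<sigma>) *
        (\<Prod>i<?p. (Ds ! i) ((pre @ coord j # post) ! \<sigma> i))))"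
      by (rule sum.swap)
    also have "\<dots> = (\<Sum>j\<in>UNIV. pd j f * wedge Ds (pre @ coord j # post))"
      using True by (simp add: wedge_def sum_distrib_left)
    finally show ?thesis .
  qed (simp add: wedge_def)
next
  let ?p = "length Ds"
  fix pre post :: "('a, 'b) mpoly list" and f
  show "wedge Ds (pre @ f # f # post) = 0"
  proof (cases "length (pre @ f # f # post) = ?p")
    case True
    let ?k = "length pre" and ?fs = "pre @ f # f # post"
    have nth: "?fs ! Transposition.transpose ?k (Suc ?k) m = ?fs ! m" for m
      by (auto simp: Transposition.transpose_def nth_append)
    have "(\<Sum>\<sigma> | \<sigma> permutes {..<?p}. of_int (sign \<sigma>) * (\<Prod>i<?p. (Ds ! i) (?fs ! \<sigma> i))) = 0"
      by (rule sum_permutes_alternating_0[of ?k]) (use True in \<open>auto simp: nth\<close>)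
    then show ?thesis using True by (simp add: wedge_def)
  qed (simp add: wedge_def)
qed

lemma multider_multiderivations:
  assumes "\<theta> \<in> multiderivations p"
  shows "multider p \<theta>"
  using assms unfolding multiderivations_def
proof (induction rule: module.span_induct_alt[OF module_mder, consumes 1])
  case 1
  then show ?case by (simp add: multider_def)
next
  case (2 c \<theta> \<theta>')
  then have \<theta>: "multider p \<theta>" using multider_wedge by blast
  show ?case
    unfolding multider_def
  proof (intro conjI allI impI)
    show "(mder_scale c \<theta> + \<theta>') fs = 0" if "length fs \<noteq> p" for fs
      using multider_length[OF \<theta> that] multider_length[OF 2(2) that] by (simp add: mder_scale_def)
    fix pre post :: "('a, 'b) mpoly list" and f
    show "(mder_scale c \<theta> + \<theta>') (pre @ f # post) = (\<Sum>i\<in>UNIV. pd i f * (mder_scale c \<theta> + \<theta>') (pre @ coord i # post))"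
      by (simp add: mder_scale_def multider_expand[OF \<theta>, of pre f post] multider_expand[OF 2(2), of pre f post]
          sum_distrib_left sum.distrib distrib_left mult.left_commute)
    show "(mder_scale c \<theta> + \<theta>') (pre @ f # f # post) = 0"
      by (simp add: mder_scale_def multider_alternating[OF \<theta>] multider_alternating[OF 2(2)])
  qed
qed

lemma multider_swap:
  assumes "multider p \<theta>"
  shows "\<theta> (pre @ f # g # post) = - \<theta> (pre @ g # f # post)"
proof -
  note expand = multider_expand[OF assms] and alt = multider_alternating[OF assms]
  have add: "\<theta> (pre @ (x + y) # post) = \<theta> (pre @ x # post) + \<theta> (pre @ y # post)" for pre x y post
    unfolding expand[of pre "x + y" post] expand[of pre x post] expand[of pre y post]
    by (simp add: pd_add distrib_right sum.distrib)
  have add2: "\<theta> (pre @ z # (x + y) # post) = \<theta> (pre @ z # x # post) + \<theta> (pre @ z # y # post)" for x y z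
    using add[of "pre @ [z]" x y post] by simp
  have "0 = \<theta> (pre @ (f + g) # (f + g) # post)" by (simp add: alt)
  also have "\<dots> = \<theta> (pre @ f # g # post) + \<theta> (pre @ g # f # post)"
    unfolding add add2 by (simp add: alt)
  finally show ?thesis by (simp add: eq_neg_iff_add_eq_0)
qed

lemma multider_repeat:
  assumes "multider p \<theta>" "i \<in> set js"
  shows "\<theta> (pre @ coord i # map coord js) = 0"
  using assms(2)
proof (induction js arbitrary: pre)
  case (Cons j js)
  show ?case
  proof (cases "i = j")
    case False
    then have "\<theta> ((pre @ [coord j]) @ coord i # map coord js) = 0"
      by (intro Cons.IH) (use Cons.prems in auto)
    then show ?thesis using multider_swap[OF assms(1), of pre "coord i" "coord j" "map coord js"] by simp
  qed (simp add: multider_alternating[OF assms(1)])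
qed simp

lemma multider_insort:
  assumes "multider p \<theta>" "sorted js" "distinct js" "i \<notin> set js"
  shows "\<theta> (pre @ coord i # map coord js) =
    (-1) ^ card {j \<in> set js. j < i} * \<theta> (pre @ map coord (insort i js))"
  using assms(2-4)
proof (induction js arbitrary: pre)
  case (Cons j js)
  show ?case
  proof (cases "i \<le> j")
    case True
    then have "{l \<in> set (j # js). l < i} = {}" using Cons.prems by fastforce
    then have "card {l \<in> set (j # js). l < i} = 0" by (simp only: card.empty)
    then show ?thesis using True by (simp only: power_0 insort_key.simps if_True list.map mult_1_left)
  next
    case False
    then have "{l \<in> set (j # js). l < i} = insert j {l \<in> set js. l < i}" by auto
    then have c: "card {l \<in> set (j # js). l < i} = Suc (card {l \<in> set js. l < i})"
      using Cons.prems by simp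
    have "\<theta> (pre @ coord i # map coord (j # js)) = - \<theta> ((pre @ [coord j]) @ coord i # map coord js)"
      using multider_swap[OF assms(1), of pre "coord i" "coord j" "map coord js"] by simp
    also have "\<dots> = - ((-1) ^ card {l \<in> set js. l < i} * \<theta> ((pre @ [coord j]) @ map coord (insort i js)))"
      using Cons.IH[of "pre @ [coord j]"] Cons.prems by simp
    also have "\<dots> = (-1) ^ card {l \<in> set (j # js). l < i} * \<theta> (pre @ map coord (insort i (j # js)))"
      unfolding c using False by simp
    finally show ?thesis .
  qed
qed simp

abbreviation coords :: "'n::{finite,linorder} set \<Rightarrow> ('n, 'k::field) mpoly list"
  where "coords J \<equiv> map coord (sorted_list_of_set J)"

lemma multider_insert:
  assumes "multider p \<theta>"
  shows "\<theta> (pre @ coord i # coords J) =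
    (if i \<in> J then 0 else (-1) ^ card {j \<in> J. j < i} * \<theta> (pre @ coords (insert i J)))"
  using multider_repeat[OF assms, of i "sorted_list_of_set J" pre]
    multider_insort[OF assms, of "sorted_list_of_set J" i pre]
  by (simp add: sorted_list_of_set_insert_remove)

text \<open>Expansion reduces arbitrary arguments to coordinates, and reordering reduces these to
  increasing lists. The prefix \<open>pre\<close> supports the induction and later holds the fixed
  argument \<open>Q\<close>.\<close>

lemma multider_ideal:
  assumes \<theta>: "multider p \<theta>" and N: "ideal_set N"
    and sorted: "\<And>J. card J = length fs \<Longrightarrow> \<theta> (pre @ coords J) \<in> N"
  shows "\<theta> (pre @ fs) \<in> N"
proof -
  have "\<theta> (pre @ map coord js) \<in> N" if "\<And>J. card J = length js \<Longrightarrow> \<theta> (pre @ coords J) \<in> N" for pre js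
    using that
  proof (induction js arbitrary: pre)
    case Nil
    then show ?case using Nil[of "{}"] by simp
  next
    case (Cons i js)
    have "\<theta> ((pre @ [coord i]) @ map coord js) \<in> N"
    proof (rule Cons.IH)
      fix J :: "'a set" assume J: "card J = length js"
      show "\<theta> ((pre @ [coord i]) @ coords J) \<in> N"
      proof (cases "i \<in> J")
        case True
        then show ?thesis using multider_insert[OF \<theta>, of pre i J] N by (simp add: ideal_set_def)
      next
        case False
        then have "\<theta> (pre @ coords (insert i J)) \<in> N" using J by (intro Cons.prems) simp
        then show ?thesis using multider_insert[OF \<theta>, of pre i J] False N by (simp add: ideal_set_def)
      qed
    qed
    then show ?case by simp
  qed
  then have "\<And>js. length js = length fs \<Longrightarrow> \<theta> (pre @ map coord js) \<in> N" using sorted by auto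
  then show ?thesis
  proof (induction fs arbitrary: pre)
    case Nil
    then show ?case using Nil[of "[]"] by simp
  next
    case (Cons f fs)
    have "\<theta> ((pre @ [coord i]) @ fs) \<in> N" for i
    proof (rule Cons.IH)
      fix js :: "'a list" assume "length js = length fs"
      then show "\<theta> ((pre @ [coord i]) @ map coord js) \<in> N" using Cons.prems[of "i # js"] by simp
    qed
    then have "(\<Sum>i\<in>UNIV. pd i f * \<theta> (pre @ coord i # fs)) \<in> N"
      using N by (intro ideal_set_sum) (simp_all add: ideal_set_def)
    then show ?case by (simp only: multider_expand[OF \<theta>, of pre f fs])
  qed
qed

lemma multider_coords_unique:
  assumes \<theta>: "multider p \<theta>" and z: "\<And>J. \<theta> (coords J) = 0"
  shows "\<theta> = 0"
proof
  fix fs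
  have "\<theta> ([] @ fs) \<in> {0}" by (rule multider_ideal[OF \<theta>]) (auto simp: ideal_set_def z)
  then show "\<theta> fs = 0 fs" by simp
qed

text \<open>Expanding an argument replaces it by a partial derivative, which lowers its degree by 1;
  the \<open>p\<close> arguments account for the summand \<open>int p\<close> at the
  coordinates.\<close>

lemma multider_S_deg:
  assumes \<theta>: "multider p \<theta>" and c: "\<And>J. \<theta> (coords J) \<in> S_deg (D + int p)"
    and fs: "list_all2 (\<lambda>f e. f \<in> S_deg e) fs es" "length fs = p"
  shows "\<theta> fs \<in> S_deg (sum_list es + D)"
proof -
  have coordlist: "\<theta> (pre @ map coord js) \<in> S_deg (D + int p)"
    if "\<And>J. \<theta> (pre @ coords J) \<in> S_deg (D + int p)" for pre js
    using that
  proof (induction js arbitrary: pre)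
    case Nil
    then show ?case using Nil[of "{}"] by simp
  next
    case (Cons i js)
    have "\<theta> ((pre @ [coord i]) @ map coord js) \<in> S_deg (D + int p)"
    proof (rule Cons.IH)
      fix J :: "'a set"
      have "(-1) ^ n * f \<in> S_deg e \<longleftrightarrow> f \<in> S_deg e" for n and f :: "('a, 'b) mpoly" and e
        using S_deg_uminus[of f e] S_deg_uminus[of "- f" e] by (cases "even n") auto
      then show "\<theta> ((pre @ [coord i]) @ coords J) \<in> S_deg (D + int p)"
        using Cons.prems[of "insert i J"] multider_insert[OF \<theta>, of pre i J]
        by (cases "i \<in> J") (simp_all only: append_assoc append.simps if_True if_False S_deg_0)
    qed
    then show ?case by simp
  qed
  \<comment> \<open>The degree \<open>D\<close> is generalised because it grows by 1 with each
    coordinate moved into the prefix.\<close>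
  have "\<theta> (pre @ fs) \<in> S_deg (sum_list es + D)"
    if "\<And>js. length js = length fs \<Longrightarrow> \<theta> (pre @ map coord js) \<in> S_deg (D + int (length fs))" for pre D
    using fs(1) that
  proof (induction arbitrary: pre D rule: list_all2_induct)
    case Nil
    then show ?case using Nil(1)[of "[]"] by simp
  next
    case (Cons f fs e es)
    have *: "\<theta> ((pre @ [coord i]) @ fs) \<in> S_deg (sum_list es + (D + 1))" for i
    proof (rule Cons.IH)
      fix js :: "'a list" assume "length js = length fs"
      then show "\<theta> ((pre @ [coord i]) @ map coord js) \<in> S_deg (D + 1 + int (length fs))"
        using Cons.prems[of "i # js"] by (simp add: add.assoc)
    qed
    have "(\<Sum>i\<in>UNIV. pd i f * \<theta> (pre @ coord i # fs)) \<in> S_deg (sum_list (e # es) + D)"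
    proof (intro S_deg_sum)
      fix i
      have "pd i f * \<theta> ((pre @ [coord i]) @ fs) \<in> S_deg ((e - 1) + (sum_list es + (D + 1)))"
        by (rule S_deg_mult[OF S_deg_pd[OF Cons.hyps(1)] *])
      also have "(e - 1) + (sum_list es + (D + 1)) = sum_list (e # es) + D" by simp
      finally show "pd i f * \<theta> (pre @ coord i # fs) \<in> S_deg (sum_list (e # es) + D)" by simp
    qed
    then show ?case by (simp only: multider_expand[OF \<theta>, of pre f fs])
  qed
  from this[of "[]" D] show ?thesis using coordlist[of "[]"] c fs(2) by simp
qed

text \<open>A nonzero product needs a permutation carrying one increasing list into the other, which
  leaves only equal sets and the identity. So any coefficients can be prescribed, as in
  \<open>star_coeffs_surj\<close>.\<close>

lemma wedge_pd_coords:
  assumes "card J' = card J"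
  shows "wedge (map pd (sorted_list_of_set J)) (coords J') = (if J' = J then 1 else 0 :: ('n::{finite,linorder}, 'k::field) mpoly)"
proof -
  let ?l = "sorted_list_of_set J" and ?l' = "sorted_list_of_set J'"
  let ?p = "card J"
  have prod: "(\<Prod>i<?p. (map pd ?l ! i) (coords J' ! \<sigma> i)) = (if J' = J \<and> \<sigma> = id then 1 else 0 :: ('n, 'k) mpoly)"
    if \<sigma>: "\<sigma> permutes {..<?p}" for \<sigma>
  proof -
    have \<sigma>lt: "\<sigma> i < ?p" if "i < ?p" for i using permutes_in_image[OF \<sigma>, of i] that by simp
    have "(\<Prod>i<?p. (map pd ?l ! i) (coords J' ! \<sigma> i)) =
        (\<Prod>i<?p. if ?l ! i = ?l' ! \<sigma> i then 1 else 0 :: ('n, 'k) mpoly)"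
      by (rule prod.cong) (use \<sigma>lt assms in \<open>auto simp: pd_coord\<close>)
    also have "\<dots> = (if \<forall>i<?p. ?l ! i = ?l' ! \<sigma> i then 1 else 0)"
      by (auto simp: prod_zero_iff)
    also have "(\<forall>i<?p. ?l ! i = ?l' ! \<sigma> i) \<longleftrightarrow> J' = J \<and> \<sigma> = id"
    proof
      assume eq: "\<forall>i<?p. ?l ! i = ?l' ! \<sigma> i"
      have "J \<subseteq> J'"
      proof
        fix j assume "j \<in> J"
        then have "j \<in> set ?l" by simp
        then obtain i where "i < length ?l" "?l ! i = j" unfolding in_set_conv_nth by blast
        then have "i < ?p" "?l ! i = j" by simp_all
        then have "j \<in> set ?l'" using eq \<sigma>lt[of i] assms by (metis length_sorted_list_of_set nth_mem)
        then show "j \<in> J'" by simp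
      qed
      then have JJ: "J = J'" using assms by (intro card_subset_eq) auto
      have "\<sigma> i = i" for i
      proof (cases "i < ?p")
        case True
        then have "?l ! i = ?l ! \<sigma> i" using eq JJ by simp
        then show ?thesis using True \<sigma>lt[OF True] by (simp add: nth_eq_iff_index_eq)
      next
        case False
        then show ?thesis using permutes_not_in[OF \<sigma>, of i] by simp
      qed
      then show "J' = J \<and> \<sigma> = id" using JJ by (simp add: fun_eq_iff)
    qed auto
    finally show ?thesis .
  qed
  have "wedge (map pd ?l) (coords J') =
      (\<Sum>\<sigma> | \<sigma> permutes {..<?p}. of_int (sign \<sigma>) * (\<Prod>i<?p. (map pd ?l ! i) (coords J' ! \<sigma> i) :: ('n, 'k) mpoly))"
    using assms by (simp add: wedge_def)
  also have "\<dots> = (\<Sum>\<sigma> | \<sigma> permutes {..<?p}. if \<sigma> = id then (if J' = J then 1 else 0) else 0)"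
  proof (rule sum.cong)
    fix \<sigma> assume "\<sigma> \<in> {\<sigma>. \<sigma> permutes {..<?p}}"
    then have "\<sigma> permutes {..<?p}" by simp
    show "of_int (sign \<sigma>) * (\<Prod>i<?p. (map pd ?l ! i) (coords J' ! \<sigma> i) :: ('n, 'k) mpoly) =
        (if \<sigma> = id then (if J' = J then 1 else 0) else 0)"
      unfolding prod[OF \<open>\<sigma> permutes {..<?p}\<close>] by (auto simp: sign_id)
  qed simp
  also have "\<dots> = (if J' = J then 1 else 0)"
    by (simp add: finite_permutations permutes_id)
  finally show ?thesis .
qed

lemma contr_coords:
  assumes "multider p \<theta>"
  shows "\<theta> (f # coords J) = contr (\<lambda>i. pd i f) (\<lambda>J. \<theta> (coords J)) J"
proof -
  have "\<theta> (f # coords J) = (\<Sum>i\<in>UNIV. pd i f * \<theta> (coord i # coords J))"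
    using multider_expand[OF assms, of "[]" f "coords J"] by simp
  also have "\<dots> = (\<Sum>i\<in>-J. (-1) ^ card {j\<in>J. j < i} * pd i f * \<theta> (coords (insert i J)))"
    by (rule sum.mono_neutral_cong_right) (use multider_insert[OF assms, of "[]" _ J] in auto)
  finally show ?thesis by (simp add: contr_def)
qed

text \<open>The coefficients of the contraction of \<open>\<theta>\<close> with the volume form.\<close>

definition star_coeffs :: "('n::{finite,linorder}, 'k::field) mder \<Rightarrow> 'n set \<Rightarrow> ('n, 'k) mpoly"
  where "star_coeffs \<theta> I = eps I * \<theta> (coords (- I))"

lemma eps_cases: "eps I = (1 :: 'r::comm_ring_1) \<or> eps I = (- 1 :: 'r)"
  unfolding eps_def by (cases "even (\<Sum>i\<in>I. pos i)") auto

text \<open>Inserting \<open>Q\<close> as first argument is contraction by the differential of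
  \<open>Q\<close>, and \<open>wdg_star\<close> converts it into exterior multiplication. By
  \<open>multider_ideal\<close> divisibility need only be tested at coordinates.\<close>

lemma star_coeffs_lattice_iff:
  fixes \<theta> :: "('n::{finite,linorder}, 'k::field) mder"
  assumes \<theta>: "multider p \<theta>"
  shows "star_coeffs \<theta> \<in> lattice (int CARD('n) - int p) Q \<longleftrightarrow>
    (\<forall>fs. length fs + 1 = p \<longrightarrow> Q dvd \<theta> (Q # fs))"
proof -
  have supp: "star_coeffs \<theta> I = 0" if "I \<notin> idx (int CARD('n) - int p)" for I
  proof -
    have "- I \<notin> idx (int p)" using that compl_idx[of "- I" "int p"] by simp
    then show ?thesis using multider_length[OF \<theta>] by (simp add: star_coeffs_def idx_def)
  qed
  have "Q dvd wdg (\<lambda>i. pd i Q) (star_coeffs \<theta>) J \<longleftrightarrow> Q dvd \<theta> (Q # coords (- J))" for J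
  proof -
    have "wdg (\<lambda>i. pd i Q) (star_coeffs \<theta>) J = eps J * \<theta> (Q # coords (- J))"
      using wdg_star[of "\<lambda>i. pd i Q" "\<lambda>J. \<theta> (coords J)" J]
      by (simp add: star_coeffs_def[abs_def] contr_coords[OF \<theta>])
    then show ?thesis using eps_cases[of J, where 'r="('n, 'k) mpoly"] by auto
  qed
  then have "star_coeffs \<theta> \<in> lattice (int CARD('n) - int p) Q \<longleftrightarrow> (\<forall>J. Q dvd \<theta> (Q # coords (- J)))"
    using supp by (simp add: lattice_def)
  also have "\<dots> \<longleftrightarrow> (\<forall>J. Q dvd \<theta> (Q # coords J))" by (metis double_compl)
  also have "\<dots> \<longleftrightarrow> (\<forall>fs. length fs + 1 = p \<longrightarrow> Q dvd \<theta> (Q # fs))"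
  proof
    assume J: "\<forall>J. Q dvd \<theta> (Q # coords J)"
    have N: "ideal_set {f. Q dvd f}" by (simp add: ideal_set_def)
    show "\<forall>fs. length fs + 1 = p \<longrightarrow> Q dvd \<theta> (Q # fs)"
    proof (intro allI impI)
      fix fs
      have "\<theta> ([Q] @ fs) \<in> {f. Q dvd f}" by (rule multider_ideal[OF \<theta> N]) (use J in auto)
      then show "Q dvd \<theta> (Q # fs)" by simp
    qed
  next
    assume fs: "\<forall>fs. length fs + 1 = p \<longrightarrow> Q dvd \<theta> (Q # fs)"
    show "\<forall>J. Q dvd \<theta> (Q # coords J)"
    proof
      fix J :: "'n set"
      show "Q dvd \<theta> (Q # coords J)"
      proof (cases "card J + 1 = p")
        case False
        then show ?thesis using multider_length[OF \<theta>, of "Q # coords J"] by simp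
      qed (use fs in simp)
    qed
  qed
  finally show ?thesis .
qed

lemma star_coeffs_surj:
  fixes \<eta> :: "'n::{finite,linorder} set \<Rightarrow> ('n, 'k::field) mpoly"
  assumes \<eta>: "\<And>I. I \<notin> idx (int CARD('n) - int p) \<Longrightarrow> \<eta> I = 0"
  obtains \<theta> where "\<theta> \<in> multiderivations p" "star_coeffs \<theta> = \<eta>"
proof -
  interpret module mder_scale by (rule module_mder)
  let ?X = "{J :: 'n set. card J = p}"
  define \<theta> where "\<theta> = (\<Sum>J\<in>?X. mder_scale (eps (- J) * \<eta> (- J)) (wedge (map pd (sorted_list_of_set J))))"
  have mem: "\<theta> \<in> multiderivations p"
    unfolding \<theta>_def multiderivations_def
  proof (intro span_sum span_scale span_base)
    fix J :: "'n set" assume "J \<in> ?X"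
    then show "wedge (map pd (sorted_list_of_set J)) \<in>
        {wedge Ds | Ds. length Ds = p \<and> (\<forall>D\<in>set Ds. derivation D)}"
      by (intro CollectI exI[of _ "map pd (sorted_list_of_set J)"]) (auto simp: derivation_pd)
  qed
  have app: "\<theta> fs = (\<Sum>J\<in>?X. eps (- J) * \<eta> (- J) * wedge (map pd (sorted_list_of_set J)) fs)" for fs
  proof -
    have "(\<Sum>J\<in>Y. F J) fs = (\<Sum>J\<in>Y. F J fs)" for F :: "'n set \<Rightarrow> ('n, 'k) mder" and Y
      by (induction Y rule: infinite_finite_induct) auto
    then show ?thesis by (simp add: \<theta>_def mder_scale_def)
  qed
  have "star_coeffs \<theta> I = \<eta> I" for I
  proof (cases "card (- I) = p")
    case True
    have "\<theta> (coords (- I)) = (\<Sum>J\<in>?X. if J = - I then eps I * \<eta> I else 0)"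
      unfolding app by (rule sum.cong) (use True in \<open>auto simp: wedge_pd_coords\<close>)
    then have "\<theta> (coords (- I)) = eps I * \<eta> I" using True by simp
    then show ?thesis by (simp add: star_coeffs_def flip: mult.assoc)
  next
    case False
    then have "- I \<notin> idx (int p)" by (simp add: idx_def)
    then have "I \<notin> idx (int CARD('n) - int p)" using compl_idx[of "- I" "int p"] by simp
    then show ?thesis
      using \<eta> multider_length[OF multider_multiderivations[OF mem], of "coords (- I)"] False
      by (simp add: star_coeffs_def)
  qed
  then show ?thesis using that mem by blast
qed

lemma (in arr) log_der_graded_lattice_module:
  "graded_lattice_module a B mder_scale (\<lambda>\<theta> I. to_frac (star_coeffs \<theta> I)) (int CARD('n) - int p)
    (log_der p Q) (log_der_deg p Q) (int p)"
proof -
  interpret D: module "mder_scale :: ('n, 'k) mpoly \<Rightarrow> _" by (rule module_mder)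
  have md: "multider p \<theta>" if "\<theta> \<in> log_der p Q" for \<theta>
    using that multider_multiderivations by (auto simp: log_der_def)
  show ?thesis
  proof
    show "to_frac (star_coeffs (m + m') I) = to_frac (star_coeffs m I) + to_frac (star_coeffs m' I)" for m m' I
      by (simp add: star_coeffs_def distrib_left flip: rhom_add[OF rhom_to_frac])
    show "to_frac (star_coeffs (mder_scale f m) I) = to_frac f * to_frac (star_coeffs m I)" for f m I
      by (simp add: star_coeffs_def mder_scale_def mult.left_commute flip: rhom_mult[OF rhom_to_frac])
    show "D.subspace (log_der p Q)"
      using D.subspace_span unfolding D.subspace_def log_der_def multiderivations_def
      by (auto simp: mder_scale_def)
    show "m = 0" if m: "m \<in> log_der p Q" and z: "\<And>I. to_frac (star_coeffs m I) = 0" for m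
    proof (rule multider_coords_unique[OF md[OF m]])
      fix J :: "'n set"
      have "eps (- J) * m (coords J) = 0" using z[of "- J"] by (simp add: star_coeffs_def)
      then have "eps (- J) * (eps (- J) * m (coords J)) = 0" by simp
      then show "m (coords J) = 0" by (simp flip: mult.assoc)
    qed
    show "\<exists>\<eta>\<in>lattice (int CARD('n) - int p) Q. (\<lambda>I. to_frac (star_coeffs m I)) = (\<lambda>I. to_frac (\<eta> I))"
      if m: "m \<in> log_der p Q" for m
      using star_coeffs_lattice_iff[OF md[OF m], of Q] m by (auto simp: log_der_def)
    show "\<exists>m\<in>log_der p Q. (\<lambda>I. to_frac (star_coeffs m I)) = (\<lambda>I. to_frac (\<eta> I))"
      if \<eta>: "\<eta> \<in> lattice (int CARD('n) - int p) Q" for \<eta>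
    proof -
      obtain \<theta> where \<theta>: "\<theta> \<in> multiderivations p" "star_coeffs \<theta> = \<eta>"
        by (rule star_coeffs_surj[of p \<eta>]) (use lattice_supp[OF \<eta>] in auto)
      then have "\<theta> \<in> log_der p Q"
        using star_coeffs_lattice_iff[OF multider_multiderivations[OF \<theta>(1)], of Q] \<eta> by (auto simp: log_der_def)
      then show ?thesis using \<theta>(2) by blast
    qed
    show "log_der_deg p Q d = {m \<in> log_der p Q. \<forall>I. to_frac (star_coeffs m I) \<in> to_frac ` S_deg (d + int p)}" for d
    proof -
      have "(\<forall>fs es. list_all2 (\<lambda>f e. f \<in> S_deg e) fs es \<and> length fs = p \<longrightarrow> m fs \<in> S_deg (sum_list es + d)) \<longleftrightarrow>
          (\<forall>I. to_frac (star_coeffs m I) \<in> to_frac ` S_deg (d + int p))" if m: "m \<in> log_der p Q" for m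
      proof -
        have "to_frac (star_coeffs m I) \<in> to_frac ` S_deg e \<longleftrightarrow> m (coords (- I)) \<in> S_deg e" for I e
          using eps_cases[of I, where 'r="('n, 'k) mpoly"] S_deg_uminus[of "m (coords (- I))" e]
            S_deg_uminus[of "- m (coords (- I))" e] by (auto simp: star_coeffs_def)
        then have "(\<forall>I. to_frac (star_coeffs m I) \<in> to_frac ` S_deg (d + int p)) \<longleftrightarrow>
            (\<forall>J. m (coords J) \<in> S_deg (d + int p))" by (metis double_compl)
        also have "\<dots> \<longleftrightarrow> (\<forall>fs es. list_all2 (\<lambda>f e. f \<in> S_deg e) fs es \<and> length fs = p \<longrightarrow> m fs \<in> S_deg (sum_list es + d))"
        proof
          assume "\<forall>J. m (coords J) \<in> S_deg (d + int p)"
          then show "\<forall>fs es. list_all2 (\<lambda>f e. f \<in> S_deg e) fs es \<and> length fs = p \<longrightarrow> m fs \<in> S_deg (sum_list es + d)"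
            using multider_S_deg[OF md[OF m]] by blast
        next
          assume H: "\<forall>fs es. list_all2 (\<lambda>f e. f \<in> S_deg e) fs es \<and> length fs = p \<longrightarrow> m fs \<in> S_deg (sum_list es + d)"
          show "\<forall>J. m (coords J) \<in> S_deg (d + int p)"
          proof
            fix J :: "'n set"
            show "m (coords J) \<in> S_deg (d + int p)"
            proof (cases "card J = p")
              case True
              have "list_all2 (\<lambda>f e. f \<in> S_deg e) (coords J :: ('n, 'k) mpoly list) (replicate p 1)"
                using True by (simp add: list_all2_conv_all_nth S_deg_coord)
              then show ?thesis
                using H[rule_format, of "coords J" "replicate p 1"] True by (simp add: sum_list_replicate add.commute)
            next
              case False
              then show ?thesis using multider_length[OF md[OF m], of "coords J"] by simp
            qed
          qed
        qed
        finally show ?thesis by blast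
      qed
      then show ?thesis unfolding log_der_deg_def by blast
    qed
  qed
qed

section \<open>Logarithmic forms\<close>

lemma to_frac_eq_Fract_mult: "h \<noteq> 0 \<Longrightarrow> to_frac h * w = to_frac f \<Longrightarrow> w = Fract f h"
  by (cases w) (auto simp: to_frac_def eq_fract ac_simps)

lemma pd_frac_0: "pd_frac i 0 = 0"
proof -
  have "pd_frac i (Fract 0 1) = Fract 0 1" by (subst pd_frac_Fract) (simp_all add: pd_0 eq_fract)
  then show ?thesis by (simp add: Zero_fract_def)
qed

lemma Q_pd_frac:
  assumes "Q \<noteq> 0"
  shows "to_frac Q * pd_frac i (Fract f Q) = to_frac (pd i f) - to_frac (pd i Q * f) / to_frac Q"
proof -
  have "to_frac Q * pd_frac i (Fract f Q) = Fract (pd i f * Q - pd i Q * f) Q"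
    using assms by (simp add: pd_frac_Fract to_frac_def eq_fract ac_simps)
  also have "\<dots> = to_frac (pd i f) - to_frac (pd i Q * f) / to_frac Q"
    using assms by (simp add: to_frac_def divide_fract)
  finally show ?thesis .
qed

text \<open>The quotient rule for \<open>\<omega> = \<eta> / Q\<close>. The first sum is the
  differential of \<open>\<eta>\<close>, with coefficients in \<open>S\<close>, so the pole
  condition on \<open>ext_d \<omega>\<close> comes down to \<open>Q\<close> dividing the product of
  its own differential with \<open>\<eta>\<close>.\<close>

lemma Q_ext_d:
  assumes "Q \<noteq> 0" and \<eta>: "\<And>I. to_frac Q * \<omega> I = to_frac (\<eta> I)"
  shows "to_frac Q * ext_d \<omega> J = to_frac (\<Sum>i\<in>J. (-1) ^ card {j\<in>J. j < i} * pd i (\<eta> (J - {i}))) -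
    to_frac (wdg (\<lambda>i. pd i Q) \<eta> J) / to_frac Q"
proof -
  let ?s = "\<lambda>i. (-1) ^ card {j\<in>J. j < i} :: ('a, 'b) mpoly"
  have s: "to_frac (?s i) = (-1) ^ card {j\<in>J. j < i}" for i
    by (simp add: rhom_power rhom_minus rhom_1 rhom_to_frac)
  have "to_frac Q * ext_d \<omega> J = (\<Sum>i\<in>J. to_frac (?s i) * (to_frac Q * pd_frac i (\<omega> (J - {i}))))"
    by (simp add: ext_d_def sum_distrib_left s mult.left_commute)
  also have "\<dots> = (\<Sum>i\<in>J. to_frac (?s i * pd i (\<eta> (J - {i}))) - to_frac (?s i * pd i Q * \<eta> (J - {i})) / to_frac Q)"
  proof (rule sum.cong)
    fix i
    have "\<omega> (J - {i}) = Fract (\<eta> (J - {i})) Q"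
      by (rule to_frac_eq_Fract_mult[OF assms(1) \<eta>])
    then show "to_frac (?s i) * (to_frac Q * pd_frac i (\<omega> (J - {i}))) =
        to_frac (?s i * pd i (\<eta> (J - {i}))) - to_frac (?s i * pd i Q * \<eta> (J - {i})) / to_frac Q"
      by (simp add: Q_pd_frac[OF assms(1)] rhom_mult[OF rhom_to_frac] right_diff_distrib mult.assoc)
  qed simp
  also have "\<dots> = to_frac (\<Sum>i\<in>J. ?s i * pd i (\<eta> (J - {i}))) - to_frac (wdg (\<lambda>i. pd i Q) \<eta> J) / to_frac Q"
    by (simp add: sum_subtractf wdg_def rhom_sum[OF rhom_to_frac] sum_divide_distrib)
  finally show ?thesis .
qed

lemma diff_divide_in_range_iff:
  assumes "h \<noteq> 0"
  shows "to_frac f - to_frac g / to_frac h \<in> range to_frac \<longleftrightarrow> h dvd g"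
proof
  assume "to_frac f - to_frac g / to_frac h \<in> range to_frac"
  then obtain k where "to_frac f - to_frac g / to_frac h = to_frac k" by auto
  then have "to_frac g / to_frac h = to_frac (f - k)"
    by (simp add: rhom_diff[OF rhom_to_frac] algebra_simps)
  then have "to_frac g = to_frac (f - k) * to_frac h"
    using assms by (simp add: divide_eq_eq)
  then have "g = (f - k) * h"
    by (simp only: to_frac_eq_iff flip: rhom_mult[OF rhom_to_frac])
  then show "h dvd g" by simp
next
  assume "h dvd g"
  then obtain k where "g = h * k" ..
  then have "to_frac f - to_frac g / to_frac h = to_frac (f - k)"
    using assms by (simp add: rhom_mult[OF rhom_to_frac] rhom_diff[OF rhom_to_frac])
  then show "to_frac f - to_frac g / to_frac h \<in> range to_frac" by simp
qed

lemma log_forms_iff: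
  fixes \<omega> :: "('n::{finite,linorder}, 'k::field) form"
  assumes Q: "Q \<noteq> 0"
  shows "\<omega> \<in> log_forms p Q \<longleftrightarrow> (\<exists>\<eta>\<in>lattice (int p) Q. \<forall>I. to_frac Q * \<omega> I = to_frac (\<eta> I))"
proof
  assume \<omega>: "\<omega> \<in> log_forms p Q"
  then have "\<forall>I. \<exists>f. to_frac Q * \<omega> I = to_frac f"
    by (auto simp: log_forms_def forms_S_def form_scale_def)
  then obtain \<eta> where \<eta>: "\<And>I. to_frac Q * \<omega> I = to_frac (\<eta> I)" by metis
  have "\<eta> I = 0" if "I \<notin> idx (int p)" for I
  proof -
    have "\<omega> I = 0" using \<omega> that by (auto simp: log_forms_def forms_K_def idx_def)
    then show ?thesis using \<eta>[of I] by simp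
  qed
  moreover have "Q dvd wdg (\<lambda>i. pd i Q) \<eta> J" for J
  proof -
    have "to_frac Q * ext_d \<omega> J \<in> range to_frac"
      using \<omega> by (auto simp: log_forms_def forms_S_def form_scale_def)
    then show ?thesis unfolding Q_ext_d[OF Q \<eta>] diff_divide_in_range_iff[OF Q] .
  qed
  ultimately have "\<eta> \<in> lattice (int p) Q" by (simp add: lattice_def)
  then show "\<exists>\<eta>\<in>lattice (int p) Q. \<forall>I. to_frac Q * \<omega> I = to_frac (\<eta> I)" using \<eta> by blast
next
  assume "\<exists>\<eta>\<in>lattice (int p) Q. \<forall>I. to_frac Q * \<omega> I = to_frac (\<eta> I)"
  then obtain \<eta> where \<eta>l: "\<eta> \<in> lattice (int p) Q" and \<eta>: "\<And>I. to_frac Q * \<omega> I = to_frac (\<eta> I)" by blast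
  have supp: "\<omega> I = 0" if "card I \<noteq> p" for I
  proof -
    have "\<eta> I = 0" using lattice_supp[OF \<eta>l, of I] that by (simp add: idx_def)
    then show ?thesis using \<eta>[of I] Q by simp
  qed
  have supp': "ext_d \<omega> J = 0" if "card J \<noteq> p + 1" for J
  proof -
    have "\<omega> (J - {i}) = 0" if "i \<in> J" for i
    proof (rule supp)
      have "card J = Suc (card (J - {i}))" using card.remove[of J i] that by simp
      then show "card (J - {i}) \<noteq> p" using \<open>card J \<noteq> p + 1\<close> by simp
    qed
    then show ?thesis by (simp add: ext_d_def pd_frac_0)
  qed
  have "to_frac Q * ext_d \<omega> J \<in> range to_frac" for J
    unfolding Q_ext_d[OF Q \<eta>] diff_divide_in_range_iff[OF Q] using \<eta>l by (simp add: lattice_def)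
  then show "\<omega> \<in> log_forms p Q"
    using supp supp' \<eta> by (auto simp: log_forms_def forms_S_def forms_K_def form_scale_def)
qed

lemma K_deg_iff:
  assumes Q: "Q \<in> S_deg b" "Q \<noteq> 0" and \<eta>: "to_frac Q * w = to_frac f"
  shows "w \<in> K_deg d \<longleftrightarrow> f \<in> S_deg (d + b)"
proof
  assume "w \<in> K_deg d"
  then obtain e e' g h where gh: "g \<in> S_deg e" "h \<in> S_deg e'" "h \<noteq> 0" "e - e' = d" "w = Fract g h"
    by (auto simp: K_deg_def)
  then have "Q * g = h * f"
    using \<eta> by (simp add: to_frac_def eq_fract ac_simps)
  then have "h * f \<in> S_deg (b + e)" using S_deg_mult[OF Q(1) gh(1)] by simp
  from S_deg_cancel[OF gh(2,3) this] show "f \<in> S_deg (d + b)"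
    using gh(4) by (simp add: algebra_simps)
next
  assume "f \<in> S_deg (d + b)"
  moreover have "w = Fract f Q" by (rule to_frac_eq_Fract_mult[OF Q(2) \<eta>])
  ultimately show "w \<in> K_deg d"
    unfolding K_deg_def using Q by (intro CollectI exI[of _ "d + b"] exI[of _ b] exI[of _ f] exI[of _ Q]) simp
qed

lemma (in arr) log_forms_graded_lattice_module:
  "graded_lattice_module a B form_scale (\<lambda>\<omega> I. to_frac Q * \<omega> I) (int p)
    (log_forms p Q) (log_forms_deg p Q) (int (card B) - int p)"
proof -
  interpret F: module "form_scale :: ('n, 'k) mpoly \<Rightarrow> _" by (rule module_form)
  note iff = log_forms_iff[OF Q_nonzero]
  show ?thesis
  proof
    show "to_frac Q * (m + m') I = to_frac Q * m I + to_frac Q * m' I" for m m' :: "('n, 'k) form" and I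
      by (simp add: distrib_left)
    show "to_frac Q * form_scale f m I = to_frac f * (to_frac Q * m I)" for f and m :: "('n, 'k) form" and I
      by (simp add: form_scale_def mult.left_commute)
    show "F.subspace (log_forms p Q)"
      unfolding F.subspace_def
    proof (intro conjI ballI allI)
      show "0 \<in> log_forms p Q" unfolding iff using lattice_0 by (intro bexI[of _ "\<lambda>_. 0"]) auto
    next
      fix x y :: "('n, 'k) form" assume "x \<in> log_forms p Q" "y \<in> log_forms p Q"
      then obtain \<eta> \<zeta> where "\<eta> \<in> lattice (int p) Q" "\<And>I. to_frac Q * x I = to_frac (\<eta> I)"
        "\<zeta> \<in> lattice (int p) Q" "\<And>I. to_frac Q * y I = to_frac (\<zeta> I)" unfolding iff by blast
      then show "x + y \<in> log_forms p Q"
        unfolding iff by (intro bexI[of _ "\<lambda>I. \<eta> I + \<zeta> I"] lattice_add)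
          (simp_all add: distrib_left rhom_add[OF rhom_to_frac])
    next
      fix f and x :: "('n, 'k) form" assume "x \<in> log_forms p Q"
      then obtain \<eta> where "\<eta> \<in> lattice (int p) Q" "\<And>I. to_frac Q * x I = to_frac (\<eta> I)" unfolding iff by blast
      then show "form_scale f x \<in> log_forms p Q"
        unfolding iff by (intro bexI[of _ "\<lambda>I. f * \<eta> I"] lattice_scale)
          (simp_all add: form_scale_def rhom_mult[OF rhom_to_frac] mult.left_commute)
    qed
    show "m = 0" if "\<And>I. to_frac Q * m I = 0" for m :: "('n, 'k) form"
      using that Q_nonzero by (simp add: fun_eq_iff)
    show "\<exists>\<eta>\<in>lattice (int p) Q. (\<lambda>I. to_frac Q * m I) = (\<lambda>I. to_frac (\<eta> I))" if "m \<in> log_forms p Q" for m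
      using that unfolding iff by auto
    show "\<exists>m\<in>log_forms p Q. (\<lambda>I. to_frac Q * m I) = (\<lambda>I. to_frac (\<eta> I))" if \<eta>: "\<eta> \<in> lattice (int p) Q" for \<eta>
    proof -
      define m where "m = (\<lambda>I. to_frac (\<eta> I) / to_frac Q)"
      have m: "to_frac Q * m I = to_frac (\<eta> I)" for I using Q_nonzero by (simp add: m_def)
      then have "m \<in> log_forms p Q" unfolding iff using \<eta> by blast
      then show ?thesis using m by blast
    qed
    show "log_forms_deg p Q d = {m \<in> log_forms p Q. \<forall>I. to_frac Q * m I \<in> to_frac ` S_deg (d + (int (card B) - int p))}" for d
    proof -
      have "m I \<in> K_deg (d - int (card I)) \<longleftrightarrow> to_frac Q * m I \<in> to_frac ` S_deg (d + (int (card B) - int p))"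
        if m: "m \<in> log_forms p Q" for m I
      proof -
        obtain \<eta> where \<eta>: "\<eta> \<in> lattice (int p) Q" "\<And>I. to_frac Q * m I = to_frac (\<eta> I)"
          using m unfolding iff by blast
        have "m I \<in> K_deg (d - int (card I)) \<longleftrightarrow> \<eta> I \<in> S_deg (d - int (card I) + int (card B))"
          by (rule K_deg_iff[OF Q_S_deg Q_nonzero \<eta>(2)])
        also have "\<dots> \<longleftrightarrow> \<eta> I \<in> S_deg (d + (int (card B) - int p))"
        proof (cases "I \<in> idx (int p)")
          case True
          then have "int (card I) = int p" by (simp add: idx_def)
          then have "d - int (card I) + int (card B) = d + (int (card B) - int p)" by linarith
          then show ?thesis by (simp only:)
        next
          case False
          then have "\<eta> I = 0" using lattice_supp[OF \<eta>(1)] by blast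
          then show ?thesis by simp
        qed
        finally show ?thesis unfolding \<eta>(2) by auto
      qed
      then show ?thesis unfolding log_forms_deg_def by blast
    qed
  qed
qed

theorem theorem3p3:
  fixes A :: "('k::field ^ 'n::{finite,linorder}) set set"
    and \<alpha> :: "('k ^ 'n::{finite,linorder}) set \<Rightarrow> ('n, 'k) mpoly"
    and p :: nat
  assumes "arrangement A"
    and "essential A"
    and "\<forall>H\<in>A. defines_hyperplane (\<alpha> H) H"
    and "p > 0"
  shows
    "(sheaf_locally_free mder_scale (log_der_deg p (defining_poly \<alpha> A)) \<longleftrightarrow>
      sheaf_locally_free form_scale (log_forms_deg p (defining_poly \<alpha> A))) \<and>
     (sheaf_locally_free mder_scale (log_der_deg p (defining_poly \<alpha> A)) \<longleftrightarrow>
      (\<forall>X\<in>intersection_lattice A. codim X < CARD('n) \<longrightarrow>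
        free_submodule mder_scale (log_der p (defining_poly \<alpha> (localization A X))))) \<and>
     (sheaf_locally_free mder_scale (log_der_deg p (defining_poly \<alpha> A)) \<longleftrightarrow>
      (\<forall>X\<in>intersection_lattice A. codim X < CARD('n) \<longrightarrow>
        free_submodule form_scale (log_forms p (defining_poly \<alpha> (localization A X)))))"
proof -
  interpret arrangement_data A \<alpha> by unfold_locales fact+
  let ?G = "\<lambda>q X. good {t. t dvd 1} q (arr.Q nv (localization A X))"
  let ?q = "int CARD('n) - int p"
  have sub: "B \<subseteq> A \<Longrightarrow> arr nv B" for B by (rule arr_subset)
  note QA = defining_poly_arr[OF subset_refl] and QX = defining_poly_arr[OF localization_subset]
  have flats: "(\<forall>P\<in>Proj. good (- P) q (arr.Q nv A)) \<longleftrightarrow>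
      (\<forall>X\<in>intersection_lattice A. codim X < CARD('n) \<longrightarrow> ?G q X)" for q
    using good_localization_if_Proj good_Proj_if_localization \<open>essential A\<close> by blast
  \<comment> \<open>Derivations and forms live in complementary degrees. The duality is available
    for bases over \<open>S\<close>, so the two sheaf conditions are compared through the
    flats.\<close>
  have dual: "?G ?q X \<longleftrightarrow> ?G (int p) X" for X
    using arr.good_dual_iff[OF sub[OF localization_subset], of "int p"] by simp
  have sheafD: "sheaf_locally_free mder_scale (log_der_deg p (arr.Q nv A)) \<longleftrightarrow>
      (\<forall>P\<in>Proj. good (- P) ?q (arr.Q nv A))"
    by (rule graded_lattice_module.locally_free_iff_good[OF arr.log_der_graded_lattice_module[OF sub[OF subset_refl]]])
  have sheafF: "sheaf_locally_free form_scale (log_forms_deg p (arr.Q nv A)) \<longleftrightarrow>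
      (\<forall>P\<in>Proj. good (- P) (int p) (arr.Q nv A))"
    by (rule graded_lattice_module.locally_free_iff_good[OF arr.log_forms_graded_lattice_module[OF sub[OF subset_refl]]])
  have freeD: "free_submodule mder_scale (log_der p (arr.Q nv (localization A X))) \<longleftrightarrow> ?G ?q X" for X
    by (rule lattice_module.free_iff_good[OF graded_lattice_module.axioms(1)[OF
          arr.log_der_graded_lattice_module[OF sub[OF localization_subset]]]])
  have freeF: "free_submodule form_scale (log_forms p (arr.Q nv (localization A X))) \<longleftrightarrow> ?G (int p) X" for X
    by (rule lattice_module.free_iff_good[OF graded_lattice_module.axioms(1)[OF
          arr.log_forms_graded_lattice_module[OF sub[OF localization_subset]]]])
  show ?thesis
    unfolding QA QX sheafD sheafF freeD freeF flats dual by blast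
qed

end
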